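(* Let $F/\mathbf{F}_q$ be an algebraic function field of one variable with full constant field $\mathbf{F}_q$, let $P_1,\dots,P_s$ be pairwise distinct places of $F$ (of arbitrary degrees), and let $G$ be a divisor of $F$ whose support contains none of $P_1,\dots,P_s$. Put $d_i=\deg P_i$, $n=d_1+\cdots+d_s$, $\mu=\max_i d_i$, $\nu_i=\#\{j\mid d_j=i\}$, and let $m=\mathrm{lcm}(d_1,\dots,d_s)$. Let $\tilde F=F\mathbf{F}_{q^m}$ be the constant field extension, $\sigma$ the Frobenius automorphism of $\tilde F/F$ (acting as $\alpha\mapsto\alpha^q$ on $\mathbf{F}_{q^m}$), and for each $i$ let $\tilde P_{i,1},\dots,\tilde P_{i,d_i}$ be the places of $\tilde F$ lying over $P_i$, numbered so that $\sigma\tilde P_{i,j}=\tilde P_{i,j+1}$ (indices mod $d_i$). All these places have degree one, and their residue fields are identified with $\mathbf{F}_{q^m}$; for $f\in F$ regular at $P_i$ the value $f(\tilde P_{i,1})$ lies in the subfield $\mathbf{F}_{q^{d_i}}$ (the image of the residue field of $P_i$). Let $\pi_i:\mathbf{F}_{q^{d_i}}\to\mathbf{F}_q^{d_i}$ be $\mathbf{F}_q$-linear isomorphisms, $\pi=\pi_1\times\cdots\times\pi_s:\Lambda\to\mathbf{F}_q^n$ where $\Lambda=\prod_i\mathbf{F}_{q^{d_i}}$, and define the code $$C=\{(\pi_1(f(\tilde P_{1,1})),\dots,\pi_s(f(\tilde P_{s,1})))\mid f\in\mathcal{L}(G)\}\subseteq\mathbf{F}_q^n .$$ Let $\varphi:\Lambda\to\mathbf{F}_{q^m}^n$,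 $\varphi(x_1,\dots,x_s)=(x_1,\sigma x_1,\dots,\sigma^{d_1-1}x_1,\dots,x_s,\dots,\sigma^{d_s-1}x_s)$, and let $$\tilde C_{\mathrm{ord}}=\{(f(\tilde P_{1,1}),f(\tilde P_{1,2}),\dots,f(\tilde P_{s,d_s}))\mid f\in\mathcal{L}(\mathrm{Con}_{\tilde F/F}(G))\}\subseteq\mathbf{F}_{q^m}^n .$$ Suppose we have a $t$-error correcting algorithm for $\tilde C_{\mathrm{ord}}$, i.e. given $\mathbf{y}=\mathbf{z}+\mathbf{e}'$ with $\mathbf{z}\in\tilde C_{\mathrm{ord}}$ and $w(\mathbf{e}')\le t$ it outputs $\mathbf{z}$. Let $a$ be a positive integer with $$\sum_{i=a+1}^{\mu} i\nu_i < t+1\le\sum_{i=a}^{\mu} i\nu_i .$$ Then for every $\mathbf{c}\in C$ and every $\mathbf{e}\in\mathbf{F}_q^n$ with $$w(\mathbf{e})\le\left\lceil\frac{t+1-\sum_{i=a+1}^{\mu}(i-a)\nu_i}{a}\right\rceil-1,$$ applying the algorithm to $\varphi(\pi^{-1}(\mathbf{c}+\mathbf{e}))$ returns $\varphi(\pi^{-1}(\mathbf{c}))$, from which $\mathbf{c}=\pi(\varphi^{-1}(\varphi(\pi^{-1}(\mathbf{c}))))$ is recovered; that is, up to this many errors of $C$ can be corrected.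
   Context: $w(\cdot)$ denotes Hamming weight (number of nonzero components). $\mathcal{L}(G)=\{f\in F\mid (f)\ge -G\}\cup\{0\}$, and $\mathcal{L}(\mathrm{Con}_{\tilde F/F}(G))$ is the analogous space in $\tilde F$ for the conorm of $G$ (the divisor of $\tilde F$ obtained by replacing each place $P$ of $F$ in $G$ by the sum of the places of $\tilde F$ over it, with the same coefficient; the extension is unramified). $\mathcal{L}(G)\subseteq\mathcal{L}(\mathrm{Con}_{\tilde F/F}(G))$. The map $\varphi$ is $\mathbf{F}_q$-linear and injective, where $\mathbf{F}_{q^{d_i}}\subseteq\mathbf{F}_{q^m}$. *)

theory Defs
  imports Complex_Main "HOL-Algebra.Algebra" "HOL-Algebra.Free_Abelian_Groups"
begin

section \<open>Algebraic function fields inside an ambient field\<close>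

text \<open>
  All fields are subfields of one ambient field \<open>L\<close>, given by their underlying sets.
  Places, valuations and divisors follow Stichtenoth's textbook: a place is the maximal ideal of
  a valuation ring of \<open>F/K\<close>, and discreteness is not part of the definition.
\<close>

definition function_field :: "('a, 'b) ring_scheme \<Rightarrow> 'a set \<Rightarrow> 'a set \<Rightarrow> bool" where
  "function_field L K F \<longleftrightarrow>
     field L \<and> subfield K L \<and> subfield F L \<and> K \<subseteq> F \<and>
     (\<exists>x\<in>F. ring.transcendental L K x \<and>
             ring.finite_dimension L (generate_field L (insert x K)) F)"

definition full_constant_field :: "('a, 'b) ring_scheme \<Rightarrow> 'a set \<Rightarrow> 'a set \<Rightarrow> bool" where
  "full_constant_field L K F \<longleftrightarrow> (\<forall>z\<in>F. ring.algebraic L K z \<longrightarrow> z \<in> K)"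

definition valuation_ring ::
    "('a, 'b) ring_scheme \<Rightarrow> 'a set \<Rightarrow> 'a set \<Rightarrow> 'a set \<Rightarrow> bool" where
  "valuation_ring L K F V \<longleftrightarrow>
     subring V L \<and> K \<subset> V \<and> V \<subset> F \<and>
     (\<forall>z\<in>F. z \<noteq> \<zero>\<^bsub>L\<^esub> \<longrightarrow> z \<in> V \<or> inv\<^bsub>L\<^esub> z \<in> V)"

definition places :: "('a, 'b) ring_scheme \<Rightarrow> 'a set \<Rightarrow> 'a set \<Rightarrow> 'a set set" where
  "places L K F = {P. \<exists>V. valuation_ring L K F V \<and> maximalideal P (L\<lparr>carrier := V\<rparr>)}"

text \<open>The valuation ring of a place \<open>P\<close>, as a ring; \<open>P\<close> determines it uniquely.\<close>

definition place_ring ::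
    "('a, 'b) ring_scheme \<Rightarrow> 'a set \<Rightarrow> 'a set \<Rightarrow> 'a set \<Rightarrow> ('a, 'b) ring_scheme" where
  "place_ring L K F P =
     L\<lparr>carrier := (THE V. valuation_ring L K F V \<and> maximalideal P (L\<lparr>carrier := V\<rparr>))\<rparr>"

text \<open>
  The normalized discrete valuation: \<open>z = t\<^sup>k u\<close> with \<open>t\<close> a generator of \<open>P\<close> and \<open>u\<close> a unit.
  It is meaningful only for \<open>z\<close> nonzero in \<open>F\<close>.
\<close>

definition place_val ::
    "('a, 'b) ring_scheme \<Rightarrow> 'a set \<Rightarrow> 'a set \<Rightarrow> 'a set \<Rightarrow> 'a \<Rightarrow> int" where
  "place_val L K F P z =
     (THE k. \<exists>t \<in> carrier (place_ring L K F P). \<exists>u \<in> Units (place_ring L K F P).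
        P = PIdl\<^bsub>place_ring L K F P\<^esub> t \<and> z = t [^]\<^bsub>L\<^esub> (k::int) \<otimes>\<^bsub>L\<^esub> u)"

definition residue_class ::
    "('a, 'b) ring_scheme \<Rightarrow> 'a set \<Rightarrow> 'a set \<Rightarrow> 'a set \<Rightarrow> 'a \<Rightarrow> 'a set" where
  "residue_class L K F P f = P +>\<^bsub>place_ring L K F P\<^esub> f"

definition place_degree :: "('a, 'b) ring_scheme \<Rightarrow> 'a set \<Rightarrow> 'a set \<Rightarrow> 'a set \<Rightarrow> nat" where
  "place_degree L K F P =
     ring.dim (place_ring L K F P Quot P)
       (residue_class L K F P ` K) (carrier (place_ring L K F P Quot P))"

text \<open>
  The value \<open>f(P)\<close> at a place of degree one, whose residue field is identified with the constant
  field \<open>K\<close> by means of the canonical map \<open>K \<rightarrow> \<O>\<^sub>P/P\<close>.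
\<close>

definition place_eval ::
    "('a, 'b) ring_scheme \<Rightarrow> 'a set \<Rightarrow> 'a set \<Rightarrow> 'a \<Rightarrow> 'a set \<Rightarrow> 'a" where
  "place_eval L K F f P =
     (THE a. a \<in> K \<and> residue_class L K F P f = residue_class L K F P a)"

text \<open>The support of a divisor \<open>G\<close> is \<open>Poly_Mapping.keys G\<close>.\<close>

definition divisors :: "('a, 'b) ring_scheme \<Rightarrow> 'a set \<Rightarrow> 'a set \<Rightarrow> ('a set \<Rightarrow>\<^sub>0 int) set" where
  "divisors L K F = carrier (free_Abelian_group (places L K F))"

definition riemann_roch_space ::
    "('a, 'b) ring_scheme \<Rightarrow> 'a set \<Rightarrow> 'a set \<Rightarrow> ('a set \<Rightarrow>\<^sub>0 int) \<Rightarrow> 'a set" where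
  "riemann_roch_space L K F G =
     {f \<in> F. f \<noteq> \<zero>\<^bsub>L\<^esub> \<and> (\<forall>P \<in> places L K F. place_val L K F P f \<ge> - Poly_Mapping.lookup G P)}
     \<union> {\<zero>\<^bsub>L\<^esub>}"


section \<open>Constant field extensions\<close>

definition constant_field_extension ::
    "('a, 'b) ring_scheme \<Rightarrow> 'a set \<Rightarrow> 'a set \<Rightarrow> 'a set \<Rightarrow> bool" where
  "constant_field_extension L K F K' \<longleftrightarrow>
     function_field L K F \<and> subfield K' L \<and> K \<subseteq> K' \<and>
     (\<forall>z\<in>K'. ring.algebraic L K z) \<and>
     carrier L = generate_field L (F \<union> K')"

text \<open>
  From here on, the ambient field \<open>L\<close> itself is the extension \<open>F K'\<close>, with constants \<open>K'\<close>.
\<close>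

definition places_over :: "('a, 'b) ring_scheme \<Rightarrow> 'a set \<Rightarrow> 'a set \<Rightarrow> 'a set set" where
  "places_over L K' P = {P' \<in> places L K' (carrier L). P \<subseteq> P'}"

text \<open>
  Constant field extensions of a finite field are unramified, hence no ramification indices.
  The sum is finite, as only finitely many places lie over a given place.
\<close>

definition conorm ::
    "('a, 'b) ring_scheme \<Rightarrow> 'a set \<Rightarrow> ('a set \<Rightarrow>\<^sub>0 int) \<Rightarrow> ('a set \<Rightarrow>\<^sub>0 int)" where
  "conorm L K' G = frag_extend (\<lambda>P. \<Sum>P' \<in> places_over L K' P. frag_of P') G"

definition frobenius_automorphism ::
    "('a, 'b) ring_scheme \<Rightarrow> 'a set \<Rightarrow> 'a set \<Rightarrow> 'a set \<Rightarrow> ('a \<Rightarrow> 'a) \<Rightarrow> bool" where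
  "frobenius_automorphism L K F K' \<sigma> \<longleftrightarrow>
     \<sigma> \<in> ring_iso L L \<and> (\<forall>x\<in>F. \<sigma> x = x) \<and> (\<forall>\<alpha>\<in>K'. \<sigma> \<alpha> = \<alpha> [^]\<^bsub>L\<^esub> card K)"


section \<open>Vectors, weights and decoders\<close>

text \<open>Vectors of length \<open>n\<close> are lists of length \<open>n\<close>.\<close>

definition vecs :: "'a set \<Rightarrow> nat \<Rightarrow> 'a list set" where
  "vecs K n = {v. length v = n \<and> set v \<subseteq> K}"

definition vec_add :: "('a, 'b) ring_scheme \<Rightarrow> 'a list \<Rightarrow> 'a list \<Rightarrow> 'a list" where
  "vec_add L = map2 (\<lambda>x y. x \<oplus>\<^bsub>L\<^esub> y)"

definition vec_smult :: "('a, 'b) ring_scheme \<Rightarrow> 'a \<Rightarrow> 'a list \<Rightarrow> 'a list" where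
  "vec_smult L a = map (\<lambda>x. a \<otimes>\<^bsub>L\<^esub> x)"

definition hamming_weight :: "('a, 'b) ring_scheme \<Rightarrow> 'a list \<Rightarrow> nat" where
  "hamming_weight L v = card {k. k < length v \<and> v ! k \<noteq> \<zero>\<^bsub>L\<^esub>}"

definition linear_iso_to_vecs ::
    "('a, 'b) ring_scheme \<Rightarrow> 'a set \<Rightarrow> 'a set \<Rightarrow> nat \<Rightarrow> ('a \<Rightarrow> 'a list) \<Rightarrow> bool" where
  "linear_iso_to_vecs L K E n p \<longleftrightarrow>
     bij_betw p E (vecs K n) \<and>
     (\<forall>x\<in>E. \<forall>y\<in>E. p (x \<oplus>\<^bsub>L\<^esub> y) = vec_add L (p x) (p y)) \<and>
     (\<forall>a\<in>K. \<forall>x\<in>E. p (a \<otimes>\<^bsub>L\<^esub> x) = vec_smult L a (p x))"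

text \<open>\<open>A\<close> corrects up to \<open>t\<close> errors of the code \<open>C \<subseteq> K\<^sup>n\<close>.\<close>

definition corrects_errors ::
    "('a, 'b) ring_scheme \<Rightarrow> 'a set \<Rightarrow> nat \<Rightarrow> 'a list set \<Rightarrow> int \<Rightarrow> ('a list \<Rightarrow> 'a list) \<Rightarrow> bool" where
  "corrects_errors L K n C t A \<longleftrightarrow>
     (\<forall>z\<in>C. \<forall>e\<in>vecs K n. int (hamming_weight L e) \<le> t \<longrightarrow> A (vec_add L z e) = z)"


section \<open>The codes\<close>

text \<open>
  Indices are zero-based: \<open>P i\<close> for \<open>i < s\<close>, and \<open>Pt i j\<close> for \<open>j < d i\<close>.
\<close>

definition Lambda :: "nat \<Rightarrow> (nat \<Rightarrow> 'a set) \<Rightarrow> 'a list set" where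
  "Lambda s E = {x. length x = s \<and> (\<forall>i<s. x ! i \<in> E i)}"

definition prod_map :: "nat \<Rightarrow> (nat \<Rightarrow> 'a \<Rightarrow> 'a list) \<Rightarrow> 'a list \<Rightarrow> 'a list" where
  "prod_map s \<pi> x = concat (map (\<lambda>i. \<pi> i (x ! i)) [0..<s])"

definition conjugates_map :: "nat \<Rightarrow> (nat \<Rightarrow> nat) \<Rightarrow> ('a \<Rightarrow> 'a) \<Rightarrow> 'a list \<Rightarrow> 'a list" where
  "conjugates_map s d \<sigma> x = concat (map (\<lambda>i. map (\<lambda>j. (\<sigma> ^^ j) (x ! i)) [0..<d i]) [0..<s])"

definition place_code ::
    "('a, 'b) ring_scheme \<Rightarrow> 'a set \<Rightarrow> 'a set \<Rightarrow> 'a set \<Rightarrow> nat \<Rightarrow> (nat \<Rightarrow> nat \<Rightarrow> 'a set) \<Rightarrow>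
     (nat \<Rightarrow> 'a \<Rightarrow> 'a list) \<Rightarrow> ('a set \<Rightarrow>\<^sub>0 int) \<Rightarrow> 'a list set" where
  "place_code L K F K' s Pt \<pi> G =
     {concat (map (\<lambda>i. \<pi> i (place_eval L K' (carrier L) f (Pt i 0))) [0..<s]) | f.
        f \<in> riemann_roch_space L K F G}"

definition extended_code ::
    "('a, 'b) ring_scheme \<Rightarrow> 'a set \<Rightarrow> nat \<Rightarrow> (nat \<Rightarrow> nat) \<Rightarrow> (nat \<Rightarrow> nat \<Rightarrow> 'a set) \<Rightarrow>
     ('a set \<Rightarrow>\<^sub>0 int) \<Rightarrow> 'a list set" where
  "extended_code L K' s d Pt G =
     {concat (map (\<lambda>i. map (\<lambda>j. place_eval L K' (carrier L) f (Pt i j)) [0..<d i]) [0..<s]) | f.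
        f \<in> riemann_roch_space L K' (carrier L) (conorm L K' G)}"

end

theory Submission
  imports Defs
begin

text \<open>
  An error vector of weight \<open>w\<close> meets at most \<open>w\<close> of the blocks of lengths \<open>d\<^sub>i\<close>, and \<open>\<phi>\<close> after the
  inverse of \<open>\<pi>\<close> spreads it over exactly the met blocks. If these had total length at least \<open>t + 1\<close>,
  then bounding each length by \<open>a + max (d\<^sub>i - a) 0\<close> would force \<open>w\<close> above the stated bound. So it
  remains to see that \<open>C\<close> is mapped into the extended code, that is: a function \<open>f\<close> in \<open>L(G)\<close> lies
  in the space of the conorm of \<open>G\<close>, and its value at the first place over \<open>P\<^sub>i\<close> exists, lies in
  the field of degree \<open>d\<^sub>i\<close> over \<open>K\<close>, and is carried by \<open>\<sigma>\<close> to the values at the conjugate places.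

  For a place with valuation ring \<open>V\<close> of a function field over a finite field, \<open>V/zV\<close> is finite for
  every \<open>z \<noteq> 0\<close>: it suffices to take \<open>z = x\<close> a polynomial in \<open>y\<close> with \<open>F\<close> finite over \<open>K(y)\<close>,
  and then to count the sums \<open>s\<^sub>0 + s\<^sub>1 x + \<dots> + s\<^sub>n x\<^sup>n\<close> with digits incongruent modulo \<open>x\<close>. Hence
  \<open>V\<close> is a discrete valuation ring with finite residue field. In the constant field extension put
  \<open>B = V K'\<close>, and let \<open>t\<close> generate the maximal ideal of \<open>V\<close>. Some power \<open>Q\<close> of \<open>q\<close> satisfies
  \<open>b\<^sup>Q - b \<in> tB\<close> for all \<open>b \<in> B\<close>. So \<open>B/tB\<close> is finite and reduced, which makes \<open>t\<close> a
  uniformizer of every valuation ring above \<open>V\<close> and leaves only finitely many of them.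
\<close>

section \<open>Powers and roots in fields\<close>

text \<open>Places come from arbitrary valuation rings, so \<open>place_val\<close> and
  \<open>place_eval\<close> (definite descriptions) and \<open>conorm\<close> (a sum, which is 0
  over an infinite set) have their intended values only once discreteness, unramifiedness and the
  finiteness of residue fields and fibres are proved. Most of the development serves this. The count
  of expansions works because multiplication by x raises degrees in y by a fixed amount: |S|^n
  expansions embed into a set of at most C A^n elements, where C comes from a common denominator,
  and growing n gives |S| \<le> A without any trace of C. Q is q raised to a multiple of both m and
  the residue degree of V. The map b -> b^Q - b is additive, commutes with factors from K', and
  sends V into tV, hence B into tB. In a ring V' above V, b can therefore be divided by t up to
  units of V' that lie in B, and V' is the localization of B at the trace of its maximal ideal, a
  set determined by residues modulo t. Power maps also locate the values: a residue fixed by the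
  power q^d comes from an element of K' with the same property, and the subfield of order q^d
  consists of all such elements.\<close>

context field begin

lemma inv_facts:
  assumes "x \<in> carrier R" "x \<noteq> \<zero>"
  shows "inv x \<in> carrier R" "inv x \<noteq> \<zero>" "x \<otimes> inv x = \<one>" "inv x \<otimes> x = \<one>" "inv (inv x) = x"
  using assms field_Units by (auto simp: Units_inv_inv)

lemma inv_mult:
  assumes "x \<in> carrier R" "x \<noteq> \<zero>" "y \<in> carrier R" "y \<noteq> \<zero>"
  shows "inv (x \<otimes> y) = inv x \<otimes> inv y"
proof (rule comm_inv_char)
  have "(x \<otimes> y) \<otimes> (inv x \<otimes> inv y) = (x \<otimes> inv x) \<otimes> (y \<otimes> inv y)"
    using assms inv_facts[of x] inv_facts[of y] by (simp add: m_ac)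
  then show "(x \<otimes> y) \<otimes> (inv x \<otimes> inv y) = \<one>"
    using assms inv_facts[of x] inv_facts[of y] by simp
qed (use assms inv_facts[of x] inv_facts[of y] in auto)

lemma cancel_inv:
  assumes "x \<in> carrier R" "x \<noteq> \<zero>" "y \<in> carrier R"
  shows "x \<otimes> (inv x \<otimes> y) = y" "inv x \<otimes> (x \<otimes> y) = y"
    "x \<otimes> (y \<otimes> inv x) = y" "inv x \<otimes> (y \<otimes> x) = y"
    "(y \<otimes> inv x) \<otimes> x = y" "(y \<otimes> x) \<otimes> inv x = y"
proof -
  note i = inv_facts[OF assms(1,2)]
  show "x \<otimes> (inv x \<otimes> y) = y" "inv x \<otimes> (x \<otimes> y) = y"
    using i assms by (simp_all add: m_assoc[symmetric])
  then show "x \<otimes> (y \<otimes> inv x) = y" "inv x \<otimes> (y \<otimes> x) = y"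
    using i assms by (simp_all add: m_comm[of y])
  show "(y \<otimes> inv x) \<otimes> x = y" "(y \<otimes> x) \<otimes> inv x = y"
    using i assms by (simp_all add: m_assoc)
qed

lemma pow_nonzero: "x \<in> carrier R \<Longrightarrow> x \<noteq> \<zero> \<Longrightarrow> x [^] (n::nat) \<noteq> \<zero>"
  by (induction n) (auto simp: integral_iff)

lemma card_eval_roots_le:
  assumes p: "p \<in> carrier (poly_ring R)" "p \<noteq> []"
    and S: "S \<subseteq> carrier R" "\<And>x. x \<in> S \<Longrightarrow> eval p x = \<zero>"
  shows "finite S \<and> card S \<le> length p - 1"
proof -
  have sub: "S \<subseteq> set_mset (roots p)"
    using roots_mem_iff_is_root[OF p(1)] p(2) S by (auto simp: is_root_def)
  have "card (set_mset (roots p)) \<le> size (roots p)"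
    by (simp add: size_multiset_overloaded_eq) (metis card_eq_sum count_greater_eq_one_iff sum_mono)
  then have "card S \<le> size (roots p)" using card_mono[OF finite_set_mset sub] by linarith
  then show ?thesis using size_roots_le_degree[OF p(1)] finite_subset[OF sub] by simp
qed

lemma card_roots_of_unity_le:
  assumes N: "N > 0" and S: "S \<subseteq> {x \<in> carrier R. x [^] N = \<one>}"
  shows "finite S \<and> card S \<le> N"
proof -
  \<comment> \<open>The coefficient list of X^N - 1, leading coefficient first.\<close>
  define p where "p = \<one> # replicate (N - 1) \<zero> @ [\<ominus> \<one>]"
  have "p \<in> carrier (poly_ring R)"
    unfolding p_def univ_poly_def polynomial_def by auto
  moreover have "eval p x = x [^] N \<oplus> \<ominus> \<one>" if "x \<in> carrier R" for x
    using that N eval_replicate[of "[\<ominus> \<one>]" x "N - 1"] by (simp add: p_def)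
  then have "eval p x = \<zero>" if "x \<in> S" for x using that S by (auto simp: r_neg)
  moreover have "p \<noteq> []" "length p - 1 = N" "S \<subseteq> carrier R" using N S by (auto simp: p_def)
  ultimately show ?thesis using card_eval_roots_le[of p S] by simp
qed

text \<open>The nonzero elements of \<open>S\<close> already exhaust the at most
  \<open>card S - 1\<close> roots of X^(card S - 1) = 1. It serves twice: to find residues in the
  image of \<open>K'\<close>, and values in \<open>E i\<close>.\<close>

lemma fixed_by_power_mem:
  assumes S: "S \<subseteq> carrier R" "finite S" "\<zero> \<in> S" "\<one> \<in> S" "\<And>a. a \<in> S \<Longrightarrow> a [^] card S = a"
    and x: "x \<in> carrier R" "x [^] card S = x"
  shows "x \<in> S"
proof (rule ccontr)
  assume n: "x \<notin> S"
  let ?Q = "card S"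
  have Q: "?Q > 0" using S(2,3) card_gt_0_iff by blast
  have one: "a [^] (?Q - 1) = \<one>" if "a \<in> carrier R" "a \<noteq> \<zero>" "a [^] ?Q = a" for a
  proof -
    have "a [^] Suc (?Q - 1) = a [^] (?Q - 1) \<otimes> a" by simp
    moreover have "Suc (?Q - 1) = ?Q" using Q by simp
    ultimately have "a [^] (?Q - 1) \<otimes> a = \<one> \<otimes> a" using that by simp
    then show ?thesis using that m_rcancel[of a "a [^] (?Q - 1)" \<one>] by simp
  qed
  \<comment> \<open>With \<open>?Q = 1\<close> the exponent \<open>?Q - 1\<close> would be 0 and the
    root count would say nothing.\<close>
  have Q1: "?Q \<noteq> 1"
  proof
    assume "?Q = 1"
    then obtain c where "S = {c}" using card_1_singletonE by blast
    then show False using S(3,4) one_not_zero by simp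
  qed
  have "insert x (S - {\<zero>}) \<subseteq> {x \<in> carrier R. x [^] (?Q - 1) = \<one>}"
    using one x n S by auto
  from card_roots_of_unity_le[OF _ this] have "card (insert x (S - {\<zero>})) \<le> ?Q - 1"
    using Q Q1 by linarith
  moreover have "card (insert x (S - {\<zero>})) = Suc (?Q - 1)"
    using n S(2) card_Diff_singleton[OF S(3)] by simp
  ultimately show False by simp
qed

lemma eval_map2_add:
  assumes "length p = length q" "set p \<subseteq> carrier R" "set q \<subseteq> carrier R" "a \<in> carrier R"
  shows "eval (map2 (\<oplus>) p q) a = eval p a \<oplus> eval q a"
  using assms
proof (induction p q rule: list_induct2)
  case (Cons x xs y ys)
  have [simp]: "eval xs a \<in> carrier R" "eval ys a \<in> carrier R"
    using Cons.prems by (auto intro!: eval_in_carrier)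
  have "x \<in> carrier R" "y \<in> carrier R" "a [^] length ys \<in> carrier R" using Cons.prems by auto
  then show ?case
    using Cons by (auto simp: l_distr a_ac)
qed simp

text \<open>Here \<open>p\<close> is ((1 + X)^n - X^n - 1) / X, the inner binomial terms. Its length
  n - 1 matters: for n = q, the q - 1 nonzero elements of a field of order q are enough zeros to
  make it vanish.\<close>

lemma power_one_plus_expansion:
  assumes "n \<ge> 1"
  shows "\<exists>p. set p \<subseteq> carrier R \<and> length p = n - 1 \<and>
    (\<forall>x\<in>carrier R. (\<one> \<oplus> x) [^] n = x [^] n \<oplus> x \<otimes> eval p x \<oplus> \<one>)"
  using assms
proof (induction n rule: dec_induct)
  case base
  show ?case by (rule exI[of _ "[]"]) (auto simp: a_ac)
next
  case (step n)
  then obtain p where p: "set p \<subseteq> carrier R" "length p = n - 1"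
    "\<And>x. x \<in> carrier R \<Longrightarrow> (\<one> \<oplus> x) [^] n = x [^] n \<oplus> x \<otimes> eval p x \<oplus> \<one>" by auto
  \<comment> \<open>Pascal's rule: the two aligned lists are X^(n-1) + p and X p + 1.\<close>
  let ?q = "map2 (\<oplus>) (\<one> # p) (p @ [\<one>])"
  have "(\<one> \<oplus> x) [^] Suc n = x [^] Suc n \<oplus> x \<otimes> eval ?q x \<oplus> \<one>" if x: "x \<in> carrier R" for x
  proof -
    define e where "e = eval p x"
    have e: "e \<in> carrier R" unfolding e_def by (rule eval_in_carrier) (use p x in auto)
    define u where "u = x [^] (n - 1)"
    have u: "u \<in> carrier R" "x [^] n = u \<otimes> x" using x step(1)
      by (auto simp: u_def) (metis Suc_diff_1 Suc_le_lessD One_nat_def nat_pow_Suc)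
    have "eval ?q x = eval (\<one> # p) x \<oplus> eval (p @ [\<one>]) x"
      by (rule eval_map2_add) (use p x in auto)
    also have "\<dots> = (u \<oplus> e) \<oplus> (e \<otimes> x \<oplus> \<one>)"
      using p x eval_append_aux[of p \<one> x] u by (simp add: e_def u_def)
    finally have q: "eval ?q x = (u \<oplus> e) \<oplus> (e \<otimes> x \<oplus> \<one>)" .
    have "(\<one> \<oplus> x) [^] Suc n = (u \<otimes> x \<oplus> x \<otimes> e \<oplus> \<one>) \<otimes> (\<one> \<oplus> x)"
      using p(3)[OF x] by (simp add: e_def u(2))
    also have "\<dots> = u \<otimes> x \<otimes> x \<oplus> x \<otimes> ((u \<oplus> e) \<oplus> (e \<otimes> x \<oplus> \<one>)) \<oplus> \<one>"
      using x e u(1) by algebra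
    finally show ?thesis using q u(2) by simp
  qed
  moreover have "set ?q \<subseteq> carrier R"
    using p(1) by (auto elim!: in_set_zipE simp: subset_iff)
  ultimately show ?case using p(2) step(1) by (intro exI[of _ ?q]) auto
qed

lemma eval_eq_zero_if_many_roots:
  assumes p: "set p \<subseteq> carrier R" and S: "finite S" "S \<subseteq> carrier R" "card S \<ge> length p"
    and z: "\<And>x. x \<in> S \<Longrightarrow> eval p x = \<zero>" and x: "x \<in> carrier R"
  shows "eval p x = \<zero>"
proof -
  \<comment> \<open>Leading zeros in \<open>p\<close> are allowed, while the root count asks for a
    normalized polynomial.\<close>
  define r where "r = normalize p"
  have r: "r \<in> carrier (poly_ring R)"
    unfolding r_def univ_poly_def partial_object.simps
    using normalize_gives_polynomial[OF p] by blast
  have ev: "eval r y = eval p y" if "y \<in> carrier R" for y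
    unfolding r_def by (rule eval_normalize[OF p that])
  have "r = []"
  proof (rule ccontr)
    assume ne: "r \<noteq> []"
    have "card S \<le> length r - 1" using card_eval_roots_le[OF r ne S(2)] ev z S(2) by (simp add: subset_iff)
    also have "\<dots> < length p"
      using ne normalize_length_le[of p, folded r_def] by (cases r) auto
    finally show False using S by simp
  qed
  then show ?thesis using ev[OF x] by simp
qed

lemma subfield_power_card:
  assumes K: "subfield K R" "finite K" and x: "x \<in> K"
  shows "x [^] card K = x"
proof -
  interpret K: field "R\<lparr>carrier := K\<rparr>" using K(1) subfield_iff(2) by blast
  have sub: "K \<subseteq> carrier R" using subfieldE(3)[OF K(1)] .
  interpret G: group "Multiplicative_Group.mult_of (R\<lparr>carrier := K\<rparr>)" by (rule K.field_mult_group)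
  have [simp]: "y [^]\<^bsub>R\<lparr>carrier := K\<rparr>\<^esub> n = y [^] n" for y and n :: nat
    by (simp add: nat_pow_def)
  have pos: "card K > 0" using K(2) x card_gt_0_iff by blast
  show ?thesis
  proof (cases "x = \<zero>")
    case True then show ?thesis using pos by (simp add: nat_pow_zero)
  next
    case False
    then have "x [^]\<^bsub>Multiplicative_Group.mult_of (R\<lparr>carrier := K\<rparr>)\<^esub> order (Multiplicative_Group.mult_of (R\<lparr>carrier := K\<rparr>)) = \<one>"
      using G.pow_order_eq_1[of x] x by simp
    then have "x [^] (card K - 1) = \<one>"
      using K.order_mult_of K(2) by (simp add: Multiplicative_Group.nat_pow_mult_of order_def)
    moreover have "x [^] Suc (card K - 1) = x [^] (card K - 1) \<otimes> x" by simp
    moreover have "Suc (card K - 1) = card K" using pos by simp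
    moreover have "x \<in> carrier R" using x sub by blast
    ultimately show ?thesis by simp
  qed
qed

text \<open>
  \<open>(1 + X)\<^sup>q - 1 - X\<^sup>q\<close> has degree below \<open>q = |K|\<close> and vanishes on \<open>K\<close>, so it is zero. This avoids
  binomial coefficients modulo the characteristic.
\<close>

lemma frobenius_add:
  assumes K: "subfield K R" "finite K" and x: "x \<in> carrier R" and y: "y \<in> carrier R"
  shows "(x \<oplus> y) [^] card K = x [^] card K \<oplus> y [^] card K"
proof -
  have sub: "K \<subseteq> carrier R" "\<zero> \<in> K" "\<one> \<in> K" using subringE(1-3)[OF subfieldE(1)[OF K(1)]] .
  have q: "card K \<ge> 1" using sub(3) K(2) card_gt_0_iff by (metis One_nat_def Suc_leI empty_iff)
  obtain p where p: "set p \<subseteq> carrier R" "length p = card K - 1"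
    "\<And>x. x \<in> carrier R \<Longrightarrow> (\<one> \<oplus> x) [^] card K = x [^] card K \<oplus> x \<otimes> eval p x \<oplus> \<one>"
    using power_one_plus_expansion[OF q] by blast
  have "eval p a = \<zero>" if a: "a \<in> K - {\<zero>}" for a
  proof -
    have ac: "a \<in> carrier R" "a \<noteq> \<zero>" "eval p a \<in> carrier R" using a sub p by (auto intro: eval_in_carrier)
    have "\<one> \<oplus> a \<in> K" using a sub subringE(7)[OF subfieldE(1)[OF K(1)]] by blast
    then have "\<one> \<oplus> a = a \<oplus> a \<otimes> eval p a \<oplus> \<one>"
      using p(3)[OF ac(1)] subfield_power_card[OF K] a by auto
    then have "a \<otimes> eval p a = (\<one> \<oplus> a) \<ominus> (\<one> \<oplus> a)"
      using ac by algebra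
    then have "a \<otimes> eval p a = \<zero>" using ac by (simp add: r_neg minus_eq)
    then show ?thesis using ac integral by blast
  qed
  note vanish = this
  have ev: "eval p z = \<zero>" if "z \<in> carrier R" for z
  proof (rule eval_eq_zero_if_many_roots[OF p(1), of "K - {\<zero>}"])
    show "length p \<le> card (K - {\<zero>})" using card_Diff_singleton[OF sub(2)] p(2) by simp
  qed (use K(2) sub that vanish in auto)
  then have one: "(\<one> \<oplus> z) [^] card K = z [^] card K \<oplus> \<one>" if "z \<in> carrier R" for z
    using p(3)[OF that] that by simp
  show ?thesis
  proof (cases "y = \<zero>")
    case True then show ?thesis using x q by (simp add: nat_pow_zero)
  next
    case False
    note i = inv_facts[OF y False]
    \<comment> \<open>The formula with one summand equal to 1 is carried to general \<open>y\<close>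
      by homogeneity.\<close>
    have "x \<oplus> y = y \<otimes> (\<one> \<oplus> inv y \<otimes> x)"
      using x y i by (simp add: r_distr m_assoc[symmetric] a_comm)
    then have "(x \<oplus> y) [^] card K = y [^] card K \<otimes> (\<one> \<oplus> inv y \<otimes> x) [^] card K"
      using x y i by (simp add: nat_pow_distrib)
    also have "\<dots> = y [^] card K \<otimes> (inv y \<otimes> x) [^] card K \<oplus> y [^] card K"
      using one[of "inv y \<otimes> x"] x y i by (simp add: r_distr)
    also have "y [^] card K \<otimes> (inv y \<otimes> x) [^] card K = (y \<otimes> (inv y \<otimes> x)) [^] card K"
      using x y i by (simp add: nat_pow_distrib)
    also have "y \<otimes> (inv y \<otimes> x) = x" using x y i by (simp add: m_assoc[symmetric])
    finally show ?thesis .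
  qed
qed

lemma frobenius_power_add:
  assumes K: "subfield K R" "finite K" and x: "x \<in> carrier R" and y: "y \<in> carrier R"
  shows "(x \<oplus> y) [^] (card K ^ n) = x [^] (card K ^ n) \<oplus> y [^] (card K ^ n)"
proof (induction n)
  case 0
  show ?case using x y by (simp only: power_0 nat_pow_eone a_closed)
next
  case (Suc n)
  have *: "z [^] (card K ^ Suc n) = (z [^] (card K ^ n)) [^] card K" if "z \<in> carrier R" for z
    by (subst nat_pow_pow[OF that]) (simp only: power_Suc mult.commute)
  show ?case
    unfolding *[OF x] *[OF y] *[OF a_closed[OF x y]] Suc
    by (rule frobenius_add[OF K]) (use x y in auto)
qed

end

section \<open>Valuation rings\<close>

text \<open>The constants do not occur, and \<open>F\<close> may be the whole carrier: one locale
  serves both the rings \<open>V\<close> of \<open>F\<close> and the rings \<open>V'\<close> of the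
  extension, whose constants differ.\<close>

locale valuation = field R for R (structure) +
  fixes F V
  assumes subfield_F: "subfield F R" and subring_V: "subring V R" and V_sub_F: "V \<subseteq> F"
    and mem_or_inv_mem: "\<And>z. z \<in> F \<Longrightarrow> z \<noteq> \<zero> \<Longrightarrow> z \<in> V \<or> inv z \<in> V"
begin

text \<open>This is the maximal ideal; zero is listed apart since \<open>inv \<zero>\<close> has no
  prescribed value.\<close>

definition nonunits where "nonunits = {z \<in> V. z = \<zero> \<or> inv z \<notin> V}"

lemma F_carrier: "z \<in> F \<Longrightarrow> z \<in> carrier R"
  using subfieldE(3)[OF subfield_F] by blast

lemma V_carrier: "z \<in> V \<Longrightarrow> z \<in> carrier R" and V_F: "z \<in> V \<Longrightarrow> z \<in> F"
  using V_sub_F F_carrier by blast+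

lemma V_closed [intro]:
  "\<zero> \<in> V" "\<one> \<in> V" "x \<in> V \<Longrightarrow> \<ominus> x \<in> V"
  "x \<in> V \<Longrightarrow> y \<in> V \<Longrightarrow> x \<otimes> y \<in> V" "x \<in> V \<Longrightarrow> y \<in> V \<Longrightarrow> x \<oplus> y \<in> V"
  using subringE[OF subring_V] by auto

lemma V_minus [intro]: "x \<in> V \<Longrightarrow> y \<in> V \<Longrightarrow> x \<ominus> y \<in> V"
  by (simp add: minus_eq V_closed)

lemma V_pow [intro]: "x \<in> V \<Longrightarrow> x [^] (n::nat) \<in> V"
  by (induction n) auto

lemma F_closed [intro]:
  "\<zero> \<in> F" "\<one> \<in> F" "x \<in> F \<Longrightarrow> \<ominus> x \<in> F"
  "x \<in> F \<Longrightarrow> y \<in> F \<Longrightarrow> x \<otimes> y \<in> F" "x \<in> F \<Longrightarrow> y \<in> F \<Longrightarrow> x \<oplus> y \<in> F"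
  "x \<in> F \<Longrightarrow> x \<noteq> \<zero> \<Longrightarrow> inv x \<in> F"
  using subringE[OF subfieldE(1)[OF subfield_F]] subfield_m_inv[OF subfield_F] by auto

lemma nonunits_V: "z \<in> nonunits \<Longrightarrow> z \<in> V"
  by (simp add: nonunits_def)

lemma zero_nonunit [simp, intro]: "\<zero> \<in> nonunits"
  by (auto simp: nonunits_def)

lemma one_not_nonunit [simp]: "\<one> \<notin> nonunits"
  using V_closed(2) by (auto simp: nonunits_def)

lemma unitD:
  assumes "u \<in> V" "u \<notin> nonunits" shows "u \<noteq> \<zero>" "inv u \<in> V" "inv u \<notin> nonunits"
  using assms inv_facts[of u] V_carrier by (auto simp: nonunits_def)

lemma inv_nonunit:
  assumes "z \<in> F" "z \<notin> V" shows "inv z \<in> nonunits" "z \<noteq> \<zero>"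
proof -
  show z: "z \<noteq> \<zero>" using assms V_closed(1) by blast
  show "inv z \<in> nonunits"
    using assms mem_or_inv_mem[of z] inv_facts[OF F_carrier[OF assms(1)] z] z by (auto simp: nonunits_def)
qed

lemma nonunits_mult [intro]:
  assumes "z \<in> nonunits" "v \<in> V" shows "z \<otimes> v \<in> nonunits"
proof (rule ccontr)
  assume n: "z \<otimes> v \<notin> nonunits"
  have z: "z \<in> V" "z \<in> carrier R" "v \<in> carrier R" using assms nonunits_V V_carrier by auto
  note zv = unitD[OF V_closed(4)[OF z(1) assms(2)] n]
  have nz: "z \<noteq> \<zero>" "v \<noteq> \<zero>" using zv z by auto
  have "inv (z \<otimes> v) = inv z \<otimes> inv v" using inv_mult z nz by auto
  then have "v \<otimes> inv (z \<otimes> v) = inv z" using z nz inv_facts[of z] inv_facts[of v]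
    by (simp add: cancel_inv)
  then have "inv z \<in> V" using zv assms(2) V_closed(4) by metis
  then show False using assms(1) nz by (auto simp: nonunits_def)
qed

lemma nonunits_mult' [intro]:
  assumes "z \<in> nonunits" "v \<in> V" shows "v \<otimes> z \<in> nonunits"
  using nonunits_mult[OF assms] m_comm assms nonunits_V V_carrier by metis

text \<open>Divisibility is a total preorder. The second alternative is strict (its cofactor is a
  nonunit), as descent arguments require.\<close>

lemma quotient_cases:
  assumes "x \<in> V" "y \<in> V"
  shows "(\<exists>w\<in>V. x = y \<otimes> w) \<or> (\<exists>w\<in>nonunits. y = x \<otimes> w)"
proof (cases "y = \<zero>")
  case True
  then show ?thesis using assms V_carrier by (intro disjI2 bexI[of _ \<zero>]) auto
next
  case False
  note c = V_carrier[OF assms(1)] V_carrier[OF assms(2)]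
  note i = inv_facts[OF c(2) False]
  show ?thesis
  proof (cases "x \<otimes> inv y \<in> V")
    case True
    moreover have "x = y \<otimes> (x \<otimes> inv y)" using c i by (simp add: m_lcomm)
    ultimately show ?thesis by blast
  next
    case n: False
    have xF: "x \<otimes> inv y \<in> F" using assms V_F False by auto
    note n' = inv_nonunit[OF xF n]
    have x: "x \<noteq> \<zero>" using n'(2) c i by auto
    have "inv (x \<otimes> inv y) = inv x \<otimes> y" using inv_mult[OF c(1) x i(1,2)] i by simp
    moreover have "x \<otimes> (inv x \<otimes> y) = y" using c inv_facts[OF c(1) x] by (simp add: m_assoc[symmetric])
    ultimately show ?thesis using n'(1) by metis
  qed
qed

text \<open>One summand divides the other and can be taken out of the sum.\<close>

lemma nonunits_add [intro]:
  assumes "x \<in> nonunits" "y \<in> nonunits" shows "x \<oplus> y \<in> nonunits"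
proof -
  have c: "x \<in> V" "y \<in> V" "x \<in> carrier R" "y \<in> carrier R" using assms nonunits_V V_carrier by auto
  from quotient_cases[OF c(1,2)] show ?thesis
  proof
    assume "\<exists>w\<in>V. x = y \<otimes> w"
    then obtain w where w: "w \<in> V" "x = y \<otimes> w" by blast
    then have "x \<oplus> y = y \<otimes> (w \<oplus> \<one>)" using c V_carrier[OF w(1)] by (simp add: r_distr)
    then show ?thesis using nonunits_mult[OF assms(2), of "w \<oplus> \<one>"] w V_closed(2,5) by auto
  next
    assume "\<exists>w\<in>nonunits. y = x \<otimes> w"
    then obtain w where w: "w \<in> V" "y = x \<otimes> w" using nonunits_V by blast
    then have "x \<oplus> y = x \<otimes> (w \<oplus> \<one>)" using c V_carrier[OF w(1)] by (simp add: r_distr a_comm)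
    then show ?thesis using nonunits_mult[OF assms(1), of "w \<oplus> \<one>"] w V_closed(2,5) by auto
  qed
qed

lemma nonunits_uminus [intro]: "x \<in> nonunits \<Longrightarrow> \<ominus> x \<in> nonunits"
  using nonunits_mult[of x "\<ominus> \<one>"] nonunits_V V_carrier V_closed(2,3) by (auto simp: r_minus)

lemma nonunits_minus [intro]: "x \<in> nonunits \<Longrightarrow> y \<in> nonunits \<Longrightarrow> x \<ominus> y \<in> nonunits"
  by (auto simp: minus_eq)

lemma unit_mult:
  assumes "u \<in> V - nonunits" "v \<in> V - nonunits" shows "u \<otimes> v \<in> V - nonunits"
proof
  show "u \<otimes> v \<in> V" using assms by auto
  show "u \<otimes> v \<notin> nonunits"
  proof
    assume a: "u \<otimes> v \<in> nonunits"
    have c: "u \<in> carrier R" "v \<in> carrier R" using assms V_carrier by auto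
    have u: "u \<noteq> \<zero>" "inv u \<in> V" using unitD assms by auto
    have "(u \<otimes> v) \<otimes> inv u = v" using c inv_facts[OF c(1) u(1)] u(1) by (simp add: m_assoc cancel_inv)
    then show False using nonunits_mult[OF a u(2)] assms by auto
  qed
qed

lemma unit_inv:
  assumes "u \<in> V - nonunits" shows "inv u \<in> V - nonunits"
  using unitD assms by auto

lemma one_unit: "\<one> \<in> V - nonunits" using V_closed by auto

lemma one_minus_unit:
  assumes "x \<in> nonunits" shows "\<one> \<ominus> x \<in> V - nonunits"
proof
  have c: "x \<in> V" "x \<in> carrier R" using assms nonunits_V V_carrier by auto
  then show "\<one> \<ominus> x \<in> V" using V_closed by auto
  show "\<one> \<ominus> x \<notin> nonunits"
  proof
    assume "\<one> \<ominus> x \<in> nonunits"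
    then have "(\<one> \<ominus> x) \<oplus> x \<in> nonunits" using assms by blast
    moreover have "(\<one> \<ominus> x) \<oplus> x = \<one>" using c by algebra
    ultimately show False by simp
  qed
qed

lemma unit_pow: "u \<in> V - nonunits \<Longrightarrow> u [^] (n::nat) \<in> V - nonunits"
  by (induction n) (simp_all only: nat_pow_0 nat_pow_Suc one_unit unit_mult)

lemma nonunit_pow: "z \<in> nonunits \<Longrightarrow> n > 0 \<Longrightarrow> z [^] (n::nat) \<in> nonunits"
proof (induction n)
  case (Suc n)
  then show ?case using V_pow[OF nonunits_V, of z n] by auto
qed simp

lemma ring_V: "ring (R\<lparr>carrier := V\<rparr>)" by (rule subring_is_ring[OF subring_V])

lemma cring_V: "cring (R\<lparr>carrier := V\<rparr>)"
  using subcring_iff[of V] subcringI'[OF subring_V] V_carrier by blast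

lemma nonunits_ideal: "ideal nonunits (R\<lparr>carrier := V\<rparr>)"
proof (rule idealI[OF ring_V])
  have "subgroup nonunits (add_monoid R)"
    by (rule add.subgroupI) (use nonunits_V V_carrier in \<open>auto simp flip: a_inv_def\<close>)
  from add.subgroup_incl[OF this subring.axioms(1)[OF subring_V]]
  show "subgroup nonunits (add_monoid (R\<lparr>carrier := V\<rparr>))" using nonunits_V by auto
qed (auto intro: nonunits_mult nonunits_mult')

lemma ideal_memD:
  assumes "ideal J (R\<lparr>carrier := V\<rparr>)" "u \<in> J" "u \<in> V - nonunits"
  shows "J = V"
proof
  interpret J: ideal J "R\<lparr>carrier := V\<rparr>" by fact
  show "J \<subseteq> V" using J.a_subset by simp
  show "V \<subseteq> J"
  proof
    fix v assume v: "v \<in> V"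
    have u: "u \<noteq> \<zero>" "inv u \<in> V" using unitD assms(3) by auto
    have "v \<otimes> inv u \<otimes> u \<in> J" using J.I_l_closed[OF assms(2), of "v \<otimes> inv u"] v u V_closed(4) by simp
    moreover have "v \<otimes> inv u \<otimes> u = v"
      using V_carrier v assms(3) inv_facts[of u] u by (simp add: m_assoc)
    ultimately show "v \<in> J" by simp
  qed
qed

text \<open>A proper ideal contains no unit, so the ring is local. This turns places into the sets
  \<open>nonunits\<close> of valuation rings.\<close>

lemma maximalideal_iff: "maximalideal P (R\<lparr>carrier := V\<rparr>) \<longleftrightarrow> P = nonunits"
proof
  assume "maximalideal P (R\<lparr>carrier := V\<rparr>)"
  then interpret P: maximalideal P "R\<lparr>carrier := V\<rparr>" .
  have "P \<subseteq> nonunits"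
  proof
    fix x assume x: "x \<in> P"
    then have "x \<in> V" using P.a_subset by auto
    then show "x \<in> nonunits" using ideal_memD[OF P.is_ideal x] P.I_notcarr by auto
  qed
  then show "P = nonunits"
  proof -
    have "nonunits = P \<or> nonunits = V"
      using P.I_maximal[OF nonunits_ideal] nonunits_V \<open>P \<subseteq> nonunits\<close> by auto
    then show ?thesis using V_closed(2) one_not_nonunit by blast
  qed
next
  assume P: "P = nonunits"
  show "maximalideal P (R\<lparr>carrier := V\<rparr>)"
    unfolding P
  proof (rule maximalidealI[OF nonunits_ideal])
    show "carrier (R\<lparr>carrier := V\<rparr>) \<noteq> nonunits"
    proof
      assume "carrier (R\<lparr>carrier := V\<rparr>) = nonunits"
      from equalityD1[OF this] have "V \<subseteq> nonunits" by simp
      then show False using V_closed(2) one_not_nonunit by blast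
    qed
    fix J assume J: "ideal J (R\<lparr>carrier := V\<rparr>)" "nonunits \<subseteq> J" "J \<subseteq> carrier (R\<lparr>carrier := V\<rparr>)"
    show "J = nonunits \<or> J = carrier (R\<lparr>carrier := V\<rparr>)"
      using ideal_memD[OF J(1)] J(2,3) by auto
  qed
qed

text \<open>The ring is recovered from its maximal ideal, which makes the definite description in
  \<open>place_ring\<close> legitimate.\<close>

lemma V_eq: "V = {z \<in> F. z = \<zero> \<or> inv z \<notin> nonunits}"
proof (intro Set.set_eqI iffI)
  fix z assume z: "z \<in> V"
  have "inv z \<notin> nonunits" if "z \<noteq> \<zero>"
    using inv_facts[OF V_carrier[OF z] that] z by (auto simp: nonunits_def)
  then show "z \<in> {z \<in> F. z = \<zero> \<or> inv z \<notin> nonunits}" using z V_F by blast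
next
  fix z assume "z \<in> {z \<in> F. z = \<zero> \<or> inv z \<notin> nonunits}"
  then show "z \<in> V" using inv_nonunit V_closed(1) by blast
qed

end

lemma (in field) valuation_if_ring:
  assumes "valuation_ring R k E V" "subfield E R" shows "valuation R E V"
proof (rule valuation.intro[OF field_axioms valuation_axioms.intro])
  show "subfield E R" by (rule assms(2))
qed (use assms(1) in \<open>auto simp: valuation_ring_def\<close>)

section \<open>Finiteness of residue class rings\<close>

context ring begin

text \<open>Values at \<open>y\<close> of polynomials of degree below \<open>l\<close>, in Horner
  form. \<open>K\<close> may be any set, because it is later also a set of digits, with
  \<open>y\<close> as the base of an expansion.\<close>

fun pspace :: "'a set \<Rightarrow> 'a \<Rightarrow> nat \<Rightarrow> 'a set" where
  "pspace K y 0 = {\<zero>}"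
| "pspace K y (Suc l) = (\<lambda>(c, a). c \<oplus> y \<otimes> a) ` (K \<times> pspace K y l)"

text \<open>Coefficients come from a mere set, unlike in \<open>Span\<close>: the uses include a
  subfield, K[y], its parts of bounded degree, the ring \<open>V\<close>, and a finite set of
  representatives.\<close>

fun lspan :: "'a set \<Rightarrow> 'a list \<Rightarrow> 'a set" where
  "lspan A [] = {\<zero>}"
| "lspan A (u # us) = (\<lambda>(a, x). a \<otimes> u \<oplus> x) ` (A \<times> lspan A us)"

lemma lspan_ConsI: "a \<in> A \<Longrightarrow> x \<in> lspan A us \<Longrightarrow> a \<otimes> u \<oplus> x \<in> lspan A (u # us)"
  by force

lemma lspan_finite: "finite A \<Longrightarrow> finite (lspan A us) \<and> card (lspan A us) \<le> card A ^ length us"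
proof (induction us)
  case (Cons u us)
  then have "finite (A \<times> lspan A us)" by simp
  from card_image_le[OF this] have "card (lspan A (u # us)) \<le> card (A \<times> lspan A us)"
    unfolding lspan.simps .
  also have "\<dots> \<le> card A * card A ^ length us"
    using Cons by (simp add: card_cartesian_product)
  finally show ?case using Cons by simp
qed simp

lemma pspace_SucI: "c \<in> K \<Longrightarrow> a \<in> pspace K y l \<Longrightarrow> c \<oplus> y \<otimes> a \<in> pspace K y (Suc l)"
  by force

lemma lspan_carrier: "A \<subseteq> carrier R \<Longrightarrow> set us \<subseteq> carrier R \<Longrightarrow> lspan A us \<subseteq> carrier R"
  by (induction us) auto

lemma lspan_add:
  assumes "A \<subseteq> carrier R" "set us \<subseteq> carrier R" "\<And>a b. a \<in> A \<Longrightarrow> b \<in> A \<Longrightarrow> a \<oplus> b \<in> A"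
    and "x \<in> lspan A us" "y \<in> lspan A us"
  shows "x \<oplus> y \<in> lspan A us"
  using assms(2,4,5)
proof (induction us arbitrary: x y)
  case (Cons u us)
  then obtain a b x' y' where x: "x = a \<otimes> u \<oplus> x'" "y = b \<otimes> u \<oplus> y'"
    and m: "a \<in> A" "b \<in> A" "x' \<in> lspan A us" "y' \<in> lspan A us" by auto
  have c: "a \<in> carrier R" "b \<in> carrier R" "x' \<in> carrier R" "y' \<in> carrier R" "u \<in> carrier R"
    using m assms(1) lspan_carrier[OF assms(1)] Cons.prems by auto
  have "x \<oplus> y = (a \<oplus> b) \<otimes> u \<oplus> (x' \<oplus> y')" unfolding x using c by (simp add: l_distr a_ac)
  moreover have "x' \<oplus> y' \<in> lspan A us" using Cons m by auto
  ultimately show ?case using assms(3) m by auto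
qed simp

text \<open>Two coefficient sets, because scaling may enlarge them: multiplication by an element of
  \<open>pspace K y e\<close> takes \<open>pspace K y l\<close> to
  \<open>pspace K y (l + e)\<close>.\<close>

lemma lspan_scale:
  assumes "A \<subseteq> carrier R" "set us \<subseteq> carrier R" "c \<in> carrier R"
    and "\<And>a. a \<in> A \<Longrightarrow> c \<otimes> a \<in> B" and "x \<in> lspan A us"
  shows "c \<otimes> x \<in> lspan B us"
  using assms(2,5)
proof (induction us arbitrary: x)
  case (Cons u us)
  then obtain a x' where x: "x = a \<otimes> u \<oplus> x'" and m: "a \<in> A" "x' \<in> lspan A us" by auto
  have c: "a \<in> carrier R" "x' \<in> carrier R" "u \<in> carrier R"
    using m assms(1) lspan_carrier[OF assms(1)] Cons.prems by auto
  have "c \<otimes> x = (c \<otimes> a) \<otimes> u \<oplus> (c \<otimes> x')" unfolding x using c assms(3) by (simp add: r_distr m_assoc)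
  moreover have "c \<otimes> x' \<in> lspan B us" using Cons m by auto
  ultimately show ?case using assms(4) m by auto
qed (use assms in simp)

lemma lspan_mono: "A \<subseteq> B \<Longrightarrow> lspan A us \<subseteq> lspan B us"
proof (induction us)
  case (Cons u us)
  then have "A \<times> lspan A us \<subseteq> B \<times> lspan B us" by auto
  then show ?case by (simp only: lspan.simps image_mono)
qed simp

lemma lspan_zero: "set us \<subseteq> carrier R \<Longrightarrow> \<zero> \<in> A \<Longrightarrow> \<zero> \<in> lspan A us"
proof (induction us)
  case (Cons u us)
  then show ?case by (auto intro!: image_eqI[of _ _ "(\<zero>, \<zero>)"])
qed simp

lemma lspan_mem:
  assumes "A \<subseteq> carrier R" "set us \<subseteq> carrier R" "\<zero> \<in> A" "a \<in> A" "u \<in> set us"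
  shows "a \<otimes> u \<in> lspan A us"
  using assms(2,5)
proof (induction us)
  case (Cons v us)
  have c: "a \<in> carrier R" "u \<in> carrier R" "v \<in> carrier R" using Cons.prems assms(1,4) by auto
  show ?case
  proof (cases "u = v")
    case True
    have "a \<otimes> u = a \<otimes> v \<oplus> \<zero>" using True c by simp
    then show ?thesis using lspan_zero[of us A] assms(3,4) Cons.prems by auto
  next
    case False
    then have "a \<otimes> u \<in> lspan A us" using Cons by auto
    moreover have "a \<otimes> u = \<zero> \<otimes> v \<oplus> a \<otimes> u" using c by simp
    ultimately show ?thesis using lspan_ConsI[OF assms(3)] by metis
  qed
qed simp

lemma Span_eq_lspan: "Span K us = lspan K us"
proof (induction us)
  case (Cons u us)
  have "line_extension K u (lspan K us) = lspan K (u # us)"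
    by (auto simp: line_extension_mem_iff) force
  then show ?case using Cons by simp
qed simp

end

section \<open>The ring K[y] and denominators for elements of K(y)\<close>

context field begin

context
  fixes K y
  assumes K: "subfield K R" and y: "y \<in> carrier R"
begin

lemma K_closed:
  "\<zero> \<in> K" "\<one> \<in> K" "x \<in> K \<Longrightarrow> \<ominus> x \<in> K" "x \<in> K \<Longrightarrow> x \<in> carrier R"
  "x \<in> K \<Longrightarrow> z \<in> K \<Longrightarrow> x \<otimes> z \<in> K" "x \<in> K \<Longrightarrow> z \<in> K \<Longrightarrow> x \<oplus> z \<in> K"
  using subringE[OF subfieldE(1)[OF K]] by auto

lemma pspace_carrier: "pspace K y l \<subseteq> carrier R"
  by (induction l) (use y K_closed(4) in auto)

lemma pspace_zero: "\<zero> \<in> pspace K y l"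
  by (induction l) (use y K_closed in \<open>auto intro!: image_eqI[of _ _ "(\<zero>, \<zero>)"]\<close>)

lemma pspace_Suc: "pspace K y l \<subseteq> pspace K y (Suc l)"
proof (induction l)
  case 0
  show ?case using pspace_zero[of "Suc 0"] by simp
next
  case (Suc l)
  then have "K \<times> pspace K y l \<subseteq> K \<times> pspace K y (Suc l)" by blast
  from image_mono[OF this] show ?case by (simp only: pspace.simps)
qed

lemma pspace_mono: "l \<le> k \<Longrightarrow> pspace K y l \<subseteq> pspace K y k"
  using lift_Suc_mono_le[of "pspace K y"] pspace_Suc by blast

lemma pspace_card: "finite K \<Longrightarrow> finite (pspace K y l) \<and> card (pspace K y l) \<le> card K ^ l"
proof (induction l)
  case (Suc l)
  have "card (pspace K y (Suc l)) \<le> card (K \<times> pspace K y l)"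
    unfolding pspace.simps by (rule card_image_le) (use Suc in simp)
  also have "\<dots> \<le> card K * card K ^ l" using Suc by (simp add: card_cartesian_product)
  finally show ?case using Suc by simp
qed simp

lemma pspace_add: "a \<in> pspace K y l \<Longrightarrow> b \<in> pspace K y l \<Longrightarrow> a \<oplus> b \<in> pspace K y l"
proof (induction l arbitrary: a b)
  case (Suc l)
  then obtain c c' a' b' where ab: "a = c \<oplus> y \<otimes> a'" "b = c' \<oplus> y \<otimes> b'" "c \<in> K" "c' \<in> K"
    "a' \<in> pspace K y l" "b' \<in> pspace K y l" by auto
  have car: "c \<in> carrier R" "c' \<in> carrier R" "a' \<in> carrier R" "b' \<in> carrier R"
    using ab pspace_carrier K_closed(4) by blast+
  have "a \<oplus> b = (c \<oplus> c') \<oplus> y \<otimes> (a' \<oplus> b')" unfolding ab using car y by (simp add: r_distr a_ac)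
  then show ?case using Suc.IH[OF ab(5,6)] K_closed(6)[OF ab(3,4)] by auto
qed simp

lemma pspace_scale: "c \<in> K \<Longrightarrow> a \<in> pspace K y l \<Longrightarrow> c \<otimes> a \<in> pspace K y l"
proof (induction l arbitrary: a)
  case (Suc l)
  then obtain c' a' where a: "a = c' \<oplus> y \<otimes> a'" "c' \<in> K" "a' \<in> pspace K y l" by auto
  have car: "c \<in> carrier R" "c' \<in> carrier R" "a' \<in> carrier R"
    using a Suc.prems pspace_carrier K_closed(4) by blast+
  have "c \<otimes> a = c \<otimes> c' \<oplus> y \<otimes> (c \<otimes> a')" unfolding a using car y by (simp add: r_distr m_lcomm)
  then show ?case using Suc.IH[OF Suc.prems(1) a(3)] K_closed(5)[OF Suc.prems(1) a(2)] by auto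
qed (use K_closed(4) in simp)

lemma pspace_var_mult: "a \<in> pspace K y l \<Longrightarrow> y \<otimes> a \<in> pspace K y (Suc l)"
proof -
  assume a: "a \<in> pspace K y l"
  then have "y \<otimes> a = \<zero> \<oplus> y \<otimes> a" using y pspace_carrier[of l] by auto
  then show ?thesis using pspace_SucI[OF K_closed(1) a] by metis
qed

lemma pspace_mult: "a \<in> pspace K y l \<Longrightarrow> b \<in> pspace K y k \<Longrightarrow> a \<otimes> b \<in> pspace K y (l + k)"
proof (induction l arbitrary: a)
  case 0
  then show ?case using pspace_carrier[of k] pspace_zero by auto
next
  case (Suc l)
  then obtain c a' where a: "a = c \<oplus> y \<otimes> a'" "c \<in> K" "a' \<in> pspace K y l" by auto
  have car: "c \<in> carrier R" "a' \<in> carrier R" "b \<in> carrier R"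
    using a Suc.prems pspace_carrier K_closed(4) by blast+
  have "a \<otimes> b = c \<otimes> b \<oplus> y \<otimes> (a' \<otimes> b)" unfolding a using car y by (simp add: l_distr m_assoc)
  moreover have "y \<otimes> (a' \<otimes> b) \<in> pspace K y (Suc l + k)"
    using pspace_var_mult[OF Suc.IH[OF a(3) Suc.prems(2)]] by simp
  moreover have "c \<otimes> b \<in> pspace K y (Suc l + k)"
    using pspace_scale[OF a(2) Suc.prems(2)] pspace_mono[of k "Suc l + k"] by auto
  ultimately show ?case using pspace_add by metis
qed

definition polys where "polys = (\<Union>l. pspace K y l)"

lemma polys_common:
  assumes "a \<in> polys" "b \<in> polys"
  obtains l where "a \<in> pspace K y l" "b \<in> pspace K y l"
proof -
  obtain i j where "a \<in> pspace K y i" "b \<in> pspace K y j" using assms by (auto simp: polys_def)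
  then show ?thesis using pspace_mono[of i "max i j"] pspace_mono[of j "max i j"] that by auto
qed

lemma K_polys: "K \<subseteq> polys"
proof
  fix c assume c: "c \<in> K"
  then have "c = c \<oplus> y \<otimes> \<zero>" using y K_closed(4) by simp
  then have "c \<in> pspace K y (Suc 0)" using pspace_SucI[OF c, of \<zero> y 0] by simp
  then show "c \<in> polys" unfolding polys_def by blast
qed

lemma polys_subring: "subring polys R"
proof (rule subringI)
  show "polys \<subseteq> carrier R" using pspace_carrier by (auto simp: polys_def)
  show "\<one> \<in> polys" using K_polys K_closed(2) by blast
  show "\<ominus> h \<in> polys" if h: "h \<in> polys" for h
  proof -
    obtain l where l: "h \<in> pspace K y l" using h by (auto simp: polys_def)
    then have "h \<in> carrier R" using pspace_carrier by blast
    then have "\<ominus> h = \<ominus> \<one> \<otimes> h" by (simp add: l_minus)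
    then show ?thesis using pspace_scale[OF K_closed(3)[OF K_closed(2)] l] by (auto simp: polys_def)
  qed
  show "h \<otimes> k \<in> polys" if "h \<in> polys" "k \<in> polys" for h k
    using that pspace_mult unfolding polys_def by blast
  show "h \<oplus> k \<in> polys" if hk: "h \<in> polys" "k \<in> polys" for h k
  proof -
    obtain l where "h \<in> pspace K y l" "k \<in> pspace K y l" using polys_common[OF hk] .
    from pspace_add[OF this] show ?thesis by (auto simp: polys_def)
  qed
qed

lemma y_polys: "y \<in> polys"
proof -
  have "\<one> = \<one> \<oplus> y \<otimes> \<zero>" using y by simp
  then have "\<one> \<in> pspace K y (Suc 0)" using pspace_SucI[OF K_closed(2), of \<zero> y 0] by simp
  from pspace_var_mult[OF this] have "y \<in> pspace K y (Suc (Suc 0))" by (simp only: r_one[OF y])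
  then show ?thesis unfolding polys_def by blast
qed

lemma polys_min:
  assumes "subring V R" "K \<subseteq> V" "y \<in> V" shows "polys \<subseteq> V"
proof -
  note E = subringE[OF assms(1)]
  have "pspace K y l \<subseteq> V" for l
  proof (induction l)
    case (Suc l)
    have "c \<oplus> y \<otimes> a \<in> V" if "c \<in> K" "a \<in> pspace K y l" for c a
      by (rule E(7)) (use that Suc assms(2,3) E(6) in auto)
    then show ?case by auto
  qed (use E(2) in simp)
  then show ?thesis by (auto simp: polys_def)
qed

text \<open>Having a nonzero denominator in K[y] survives each way of building the generated field;
  for an inverse, the old numerator becomes the denominator.\<close>

lemma generate_field_fraction:
  assumes "z \<in> generate_field R (insert y K)"
  shows "\<exists>h\<in>polys. h \<noteq> \<zero> \<and> h \<otimes> z \<in> polys"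
proof -
  note S = subringE[OF polys_subring]
  have c: "z \<in> carrier R" if "z \<in> generate_field R (insert y K)" for z
    using generate_field_in_carrier[of "insert y K" z] that y K_closed(4) by auto
  from assms show ?thesis
  proof (induction rule: generate_field.induct)
    case one then show ?case using S(3) by (intro bexI[of _ \<one>]) auto
  next
    case (incl h)
    then have "h \<in> polys" using K_polys y_polys by blast
    then show ?case using S(1,3) by (intro bexI[of _ \<one>]) auto
  next
    case (a_inv h)
    then obtain g where g: "g \<in> polys" "g \<noteq> \<zero>" "g \<otimes> h \<in> polys" by blast
    have "g \<otimes> \<ominus> h = \<ominus> (g \<otimes> h)" using c[OF a_inv(1)] g S(1) by (auto simp: r_minus)
    then show ?case using g S(5) by auto
  next
    case (m_inv h)
    then obtain g where g: "g \<in> polys" "g \<noteq> \<zero>" "g \<otimes> h \<in> polys" by blast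
    have gc: "g \<in> carrier R" "h \<in> carrier R" using c[OF m_inv(1)] g S(1) by auto
    have "(g \<otimes> h) \<otimes> inv h = g"
      using gc m_inv(2) by (simp add: cancel_inv)
    moreover have "g \<otimes> h \<noteq> \<zero>" using g gc m_inv(2) integral by blast
    ultimately show ?case using g by (intro bexI[of _ "g \<otimes> h"]) auto
  next
    case (eng_add h1 h2)
    then obtain g1 g2 where g: "g1 \<in> polys" "g1 \<noteq> \<zero>" "g1 \<otimes> h1 \<in> polys"
      "g2 \<in> polys" "g2 \<noteq> \<zero>" "g2 \<otimes> h2 \<in> polys" by blast
    have gc: "g1 \<in> carrier R" "g2 \<in> carrier R" "h1 \<in> carrier R" "h2 \<in> carrier R"
      using g S(1) c eng_add by auto
    have "(g1 \<otimes> g2) \<otimes> (h1 \<oplus> h2) = g2 \<otimes> (g1 \<otimes> h1) \<oplus> g1 \<otimes> (g2 \<otimes> h2)"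
      using gc by (simp add: r_distr m_ac)
    then have "(g1 \<otimes> g2) \<otimes> (h1 \<oplus> h2) \<in> polys" using g S(6,7) by metis
    moreover have "g1 \<otimes> g2 \<noteq> \<zero>" using g gc integral by blast
    ultimately show ?case using g S(6) by blast
  next
    case (eng_mult h1 h2)
    then obtain g1 g2 where g: "g1 \<in> polys" "g1 \<noteq> \<zero>" "g1 \<otimes> h1 \<in> polys"
      "g2 \<in> polys" "g2 \<noteq> \<zero>" "g2 \<otimes> h2 \<in> polys" by blast
    have gc: "g1 \<in> carrier R" "g2 \<in> carrier R" "h1 \<in> carrier R" "h2 \<in> carrier R"
      using g S(1) c eng_mult by auto
    have "(g1 \<otimes> g2) \<otimes> (h1 \<otimes> h2) = (g1 \<otimes> h1) \<otimes> (g2 \<otimes> h2)"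
      using gc by (simp add: m_ac)
    then have "(g1 \<otimes> g2) \<otimes> (h1 \<otimes> h2) \<in> polys" using g S(6,7) by metis
    moreover have "g1 \<otimes> g2 \<noteq> \<zero>" using g gc integral by blast
    ultimately show ?case using g S(6) by blast
  qed
qed

lemma common_denominator:
  assumes "finite S" "S \<subseteq> generate_field R (insert y K)"
  shows "\<exists>h\<in>polys. h \<noteq> \<zero> \<and> (\<forall>z\<in>S. h \<otimes> z \<in> polys)"
  using assms
proof (induction S rule: finite_induct)
  case empty
  show ?case using subringE(3)[OF polys_subring] by (intro bexI[of _ \<one>]) auto
next
  case (insert x S)
  note S = subringE[OF polys_subring]
  have c: "z \<in> carrier R" if "z \<in> generate_field R (insert y K)" for z
    using generate_field_in_carrier[of "insert y K" z] that y K_closed(4) by auto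
  from insert obtain h where h: "h \<in> polys" "h \<noteq> \<zero>" "\<And>z. z \<in> S \<Longrightarrow> h \<otimes> z \<in> polys" by auto
  obtain g where g: "g \<in> polys" "g \<noteq> \<zero>" "g \<otimes> x \<in> polys"
    using generate_field_fraction insert.prems by auto
  have gc: "g \<in> carrier R" "h \<in> carrier R" using g h S by auto
  have "(g \<otimes> h) \<otimes> z \<in> polys" if "z \<in> insert x S" for z
  proof (cases "z = x")
    case True
    have "(g \<otimes> h) \<otimes> x = h \<otimes> (g \<otimes> x)" using gc c[of x] insert.prems by (simp add: m_ac)
    then show ?thesis using S(6) h g True by metis
  next
    case False
    have "(g \<otimes> h) \<otimes> z = g \<otimes> (h \<otimes> z)" using gc c[of z] insert.prems that by (auto simp add: m_ac)
    then show ?thesis using S(6) h g False that by (metis insertE)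
  qed
  moreover have "g \<otimes> h \<noteq> \<zero>" using g h gc integral by blast
  ultimately show ?case using S(6) g h by blast
qed

end
end

text \<open>Lets a constant factor be dropped from an estimate valid for all exponents: (1 + 1/b)^n
  outgrows every \<open>C\<close>.\<close>

lemma power_growth_le:
  fixes a b C :: nat
  assumes b: "b \<ge> 1" and le: "\<And>n. a ^ n \<le> C * b ^ n"
  shows "a \<le> b"
proof (rule ccontr)
  assume "\<not> a \<le> b"
  then have "Suc b \<le> a" by simp
  have "1 < real (Suc b) / real b" using b by (simp add: field_simps)
  then obtain n where n: "real C < (real (Suc b) / real b) ^ n"
    using real_arch_pow by blast
  have "real C * real b ^ n < real (Suc b) ^ n"
    using n b by (simp add: power_divide field_simps)
  also have "\<dots> \<le> real a ^ n" using \<open>Suc b \<le> a\<close> by (intro power_mono) auto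
  finally have "C * b ^ n < a ^ n" by (simp flip: of_nat_power of_nat_mult)
  then show False using le[of n] by simp
qed

section \<open>Clearing denominators in algebraic relations and in spans\<close>

context field begin

lemma eval_closed:
  assumes "subring V R" "set p \<subseteq> V" "z \<in> V" shows "eval p z \<in> V"
proof -
  note E = subringE[OF assms(1)]
  have pw: "z [^] (n::nat) \<in> V" for n by (induction n) (use E assms(3) in auto)
  show ?thesis using assms(2) by (induction p) (use E pw in auto)
qed

text \<open>Coefficient lists end with the constant term, hence the reverse induction: vanishing
  last coefficients are removed by cancelling \<open>z\<close>, and the first nonzero one is then a
  multiple of \<open>z\<close>.\<close>

lemma constant_term_relation:
  assumes "A \<subseteq> carrier R" "z \<in> carrier R" "z \<noteq> \<zero>" "set p \<subseteq> A" "\<exists>c\<in>set p. c \<noteq> \<zero>" "eval p z = \<zero>"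
  shows "\<exists>q c. set q \<subseteq> A \<and> c \<in> A \<and> c \<noteq> \<zero> \<and> c = z \<otimes> (\<ominus> eval q z)"
  using assms(4-6)
proof (induction p rule: rev_induct)
  case (snoc c p)
  have pc: "set p \<subseteq> carrier R" "c \<in> carrier R" using snoc.prems assms(1) by auto
  have e: "eval p z \<in> carrier R" using eval_in_carrier pc assms by auto
  have eq: "eval p z \<otimes> z \<oplus> c = \<zero>" using eval_append_aux[OF pc assms(2)] snoc.prems by simp
  show ?case
  proof (cases "c = \<zero>")
    case True
    then have "eval p z = \<zero>" using eq e assms integral by auto
    then show ?thesis using snoc True by auto
  next
    case False
    have "c \<oplus> eval p z \<otimes> z = \<zero>" using eq e pc assms(2) by (simp add: a_comm)
    then have "c = \<ominus> (eval p z \<otimes> z)" using e pc assms(2) minus_equality by simp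
    also have "\<dots> = z \<otimes> (\<ominus> eval p z)" using e assms(2) by (simp add: r_minus m_comm)
    finally show ?thesis using snoc.prems False by auto
  qed
qed simp

text \<open>Provides a nonzero multiple of \<open>z\<close> inside K[y]: the constant term of an
  algebraic relation whose denominators have been cleared.\<close>

lemma polys_relation:
  assumes K: "subfield K R" and y: "y \<in> carrier R" and z: "z \<in> carrier R" "z \<noteq> \<zero>"
    and alg: "algebraic (generate_field R (insert y K)) z"
  shows "\<exists>q c. set q \<subseteq> polys K y \<and> c \<in> polys K y \<and> c \<noteq> \<zero> \<and> c = z \<otimes> (\<ominus> eval q z)"
proof -
  let ?G = "generate_field R (insert y K)"
  have G: "subfield ?G R" using generate_field_is_subfield[of "insert y K"] y subfieldE(3)[OF K] by auto
  have "(algebraic over ?G) z" using alg by (simp add: over_def)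
  then obtain p where p: "p \<in> carrier (?G[X])" "p \<noteq> []" "eval p z = \<zero>"
    using algebraicE[OF subfieldE(1)[OF G] z(1)] by blast
  from p(1,2) have p': "set p \<subseteq> ?G" "hd p \<noteq> \<zero>" by (auto simp: univ_poly_def polynomial_def)
  have pc: "set p \<subseteq> carrier R" using p' subfieldE(3)[OF G] by blast
  obtain h where h: "h \<in> polys K y" "h \<noteq> \<zero>" "\<forall>c\<in>set p. h \<otimes> c \<in> polys K y"
    using common_denominator[OF K y _ p'(1)] by auto
  have sub: "polys K y \<subseteq> carrier R" using subringE(1)[OF polys_subring[OF K y]] .
  have hc: "h \<in> carrier R" using h sub by blast
  have ev: "eval (map ((\<otimes>) h) p) z = h \<otimes> eval p z"
    using pc
  proof (induction p)
    case (Cons a p)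
    then have "eval p z \<in> carrier R" using eval_in_carrier z by auto
    then show ?case using Cons hc z by (auto simp: r_distr m_assoc)
  qed (use hc in simp)
  show ?thesis
  proof (rule constant_term_relation[OF sub z])
    show "set (map ((\<otimes>) h) p) \<subseteq> polys K y" using h by auto
    have "hd p \<in> set p" using p(2) by simp
    moreover have "h \<otimes> hd p \<noteq> \<zero>" using h(2) hc p'(2) pc \<open>hd p \<in> set p\<close> integral by blast
    ultimately show "\<exists>c\<in>set (map ((\<otimes>) h) p). c \<noteq> \<zero>" by auto
    show "eval (map ((\<otimes>) h) p) z = \<zero>" using ev p hc by simp
  qed
qed

lemma lspan_denominator:
  assumes K: "subfield K R" and y: "y \<in> carrier R" and us: "set us \<subseteq> carrier R"
    and s: "s \<in> lspan (generate_field R (insert y K)) us"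
  shows "\<exists>h\<in>polys K y. h \<noteq> \<zero> \<and> h \<otimes> s \<in> lspan (polys K y) us"
  using us s
proof (induction us arbitrary: s)
  case Nil
  show ?case using subringE(3)[OF polys_subring[OF K y]] Nil by (intro bexI[of _ \<one>]) auto
next
  case (Cons u us)
  note P = subringE[OF polys_subring[OF K y]]
  let ?G = "generate_field R (insert y K)"
  have G: "?G \<subseteq> carrier R" using generate_field_incl[of "insert y K"] y subfieldE(3)[OF K] by auto
  obtain a x where s: "s = a \<otimes> u \<oplus> x" "a \<in> ?G" "x \<in> lspan ?G us" using Cons.prems by auto
  obtain h where h: "h \<in> polys K y" "h \<noteq> \<zero>" "h \<otimes> x \<in> lspan (polys K y) us"
    using Cons.IH[OF _ s(3)] Cons.prems by auto
  obtain g where g: "g \<in> polys K y" "g \<noteq> \<zero>" "g \<otimes> a \<in> polys K y"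
    using generate_field_fraction[OF K y s(2)] by blast
  have us: "set us \<subseteq> carrier R" using Cons.prems by simp
  have c: "g \<in> carrier R" "h \<in> carrier R" "a \<in> carrier R" "u \<in> carrier R" "x \<in> carrier R"
    using g h s P(1) G Cons.prems lspan_carrier[OF G us] by auto
  have "(g \<otimes> h) \<otimes> s = (h \<otimes> (g \<otimes> a)) \<otimes> u \<oplus> g \<otimes> (h \<otimes> x)"
    unfolding s using c by (simp add: r_distr m_ac)
  moreover have "g \<otimes> (h \<otimes> x) \<in> lspan (polys K y) us"
    by (rule lspan_scale[OF P(1) us c(1) _ h(3)]) (use P(6) g in auto)
  ultimately have "(g \<otimes> h) \<otimes> s \<in> lspan (polys K y) (u # us)"
    using lspan_ConsI[OF P(6)[OF h(1) g(3)]] by metis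
  moreover have "g \<otimes> h \<noteq> \<zero>" using g h c integral by blast
  ultimately show ?case using P(6)[OF g(1) h(1)] by blast
qed

lemma lspan_polys_pspace:
  assumes K: "subfield K R" and y: "y \<in> carrier R" and us: "set us \<subseteq> carrier R"
    and s: "s \<in> lspan (polys K y) us"
  shows "\<exists>l. s \<in> lspan (pspace K y l) us"
  using us s
proof (induction us arbitrary: s)
  case (Cons u us)
  obtain a x where s: "s = a \<otimes> u \<oplus> x" "a \<in> polys K y" "x \<in> lspan (polys K y) us"
    using Cons.prems by auto
  obtain i where i: "x \<in> lspan (pspace K y i) us" using Cons.IH[OF _ s(3)] Cons.prems by auto
  obtain j where j: "a \<in> pspace K y j" using s(2) by (auto simp: polys_def[OF K y])
  have "a \<in> pspace K y (max i j)" using pspace_mono[OF K y, of j "max i j"] j by auto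
  moreover have "x \<in> lspan (pspace K y (max i j)) us"
    using lspan_mono[OF pspace_mono[OF K y, of i "max i j"], of us] i by auto
  ultimately show ?case unfolding s(1) using lspan_ConsI by blast
qed simp

text \<open>A uniform length \<open>l\<close> exists because the sets \<open>pspace K y l\<close>
  increase with \<open>l\<close> and \<open>S\<close> is finite.\<close>

lemma lspan_denominator_finite:
  assumes K: "subfield K R" and y: "y \<in> carrier R" and us: "set us \<subseteq> carrier R"
    and S: "finite S" "S \<subseteq> lspan (generate_field R (insert y K)) us"
  shows "\<exists>h l. h \<in> carrier R \<and> h \<noteq> \<zero> \<and> (\<forall>s\<in>S. h \<otimes> s \<in> lspan (pspace K y l) us)"
proof -
  note P = subringE[OF polys_subring[OF K y]]
  let ?G = "generate_field R (insert y K)"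
  have G: "?G \<subseteq> carrier R" using generate_field_incl[of "insert y K"] y subfieldE(3)[OF K] by auto
  have "\<exists>h\<in>polys K y. h \<noteq> \<zero> \<and> (\<forall>s\<in>S. h \<otimes> s \<in> lspan (polys K y) us)"
    using S
  proof (induction S rule: finite_induct)
    case empty
    then show ?case using P(3) by (intro bexI[of _ \<one>]) auto
  next
    case (insert x S)
    then obtain h where h: "h \<in> polys K y" "h \<noteq> \<zero>" "\<And>s. s \<in> S \<Longrightarrow> h \<otimes> s \<in> lspan (polys K y) us"
      by auto
    obtain g where g: "g \<in> polys K y" "g \<noteq> \<zero>" "g \<otimes> x \<in> lspan (polys K y) us"
      using lspan_denominator[OF K y us, of x] insert.prems by auto
    have c: "g \<in> carrier R" "h \<in> carrier R" using g h P(1) by auto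
    have sc: "c \<otimes> z \<in> lspan (polys K y) us" if "c \<in> polys K y" "z \<in> lspan (polys K y) us" for c z
      by (rule lspan_scale[OF P(1) us _ _ that(2)]) (use that P in auto)
    have car: "z \<in> carrier R" if "z \<in> insert x S" for z
      using that insert.prems lspan_carrier[OF G us] by blast
    have "(g \<otimes> h) \<otimes> z \<in> lspan (polys K y) us" if z: "z \<in> insert x S" for z
    proof (cases "z = x")
      case True
      have "(g \<otimes> h) \<otimes> z = h \<otimes> (g \<otimes> x)" using c car[OF z] True by (simp add: m_ac)
      then show ?thesis using sc[OF h(1) g(3)] by simp
    next
      case False
      have "(g \<otimes> h) \<otimes> z = g \<otimes> (h \<otimes> z)" using c car[OF z] by (simp add: m_assoc)
      then show ?thesis using sc[OF g(1) h(3)] z False by simp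
    qed
    moreover have "g \<otimes> h \<noteq> \<zero>" using g h c integral by blast
    ultimately show ?case using P(6)[OF g(1) h(1)] by blast
  qed
  then obtain h where h: "h \<in> carrier R" "h \<noteq> \<zero>" "\<And>s. s \<in> S \<Longrightarrow> h \<otimes> s \<in> lspan (polys K y) us"
    using P(1) by blast
  have "\<exists>l. \<forall>s\<in>S. h \<otimes> s \<in> lspan (pspace K y l) us"
    using S(1) h(3)
  proof (induction S rule: finite_induct)
    case (insert x S)
    then obtain i where i: "\<forall>s\<in>S. h \<otimes> s \<in> lspan (pspace K y i) us" by auto
    obtain j where j: "h \<otimes> x \<in> lspan (pspace K y j) us"
      using lspan_polys_pspace[OF K y us insert.prems[of x]] by auto
    show ?case
      using i j lspan_mono[OF pspace_mono[OF K y, of i "max i j"], of us]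
        lspan_mono[OF pspace_mono[OF K y, of j "max i j"], of us]
      by (intro exI[of _ "max i j"]) auto
  qed simp
  then show ?thesis using h by blast
qed

end

section \<open>Counting residue classes by digit expansions\<close>

context valuation begin

text \<open>Finiteness of V/zV is expressed by representatives in \<open>V\<close>, which may repeat
  a class; \<open>incongruent\<close> is the dual condition, at most one representative for each
  class.\<close>

definition covers where
  "covers z S \<longleftrightarrow> finite S \<and> S \<subseteq> V \<and> (\<forall>v\<in>V. \<exists>s\<in>S. \<exists>w\<in>V. v = s \<oplus> z \<otimes> w)"

definition finite_quotient where "finite_quotient z \<longleftrightarrow> (\<exists>S. covers z S)"

definition incongruent where
  "incongruent x S \<longleftrightarrow> finite S \<and> S \<subseteq> V \<and> (\<forall>s\<in>S. \<forall>s'\<in>S. (\<exists>w\<in>V. s = s' \<oplus> x \<otimes> w) \<longrightarrow> s = s')"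

text \<open>Here \<^term>\<open>pspace S x n\<close> consists of the expansions in powers of \<open>x\<close> with \<open>n\<close> digits from \<open>S\<close>.\<close>

lemma card_expansions:
  assumes x: "x \<in> V" "x \<noteq> \<zero>" and S: "incongruent x S"
  shows "finite (pspace S x n) \<and> card (pspace S x n) = card S ^ n \<and> pspace S x n \<subseteq> V"
proof (induction n)
  case (Suc n)
  have SV: "S \<subseteq> V" "finite S" using S by (auto simp: incongruent_def)
  have "inj_on (\<lambda>(c, a). c \<oplus> x \<otimes> a) (S \<times> pspace S x n)"
  proof (rule inj_onI, clarify)
    fix c a c' a' assume m: "c \<in> S" "a \<in> pspace S x n" "c' \<in> S" "a' \<in> pspace S x n"
      and eq: "c \<oplus> x \<otimes> a = c' \<oplus> x \<otimes> a'"
    have v: "c \<in> V" "a \<in> V" "c' \<in> V" "a' \<in> V" using m SV Suc by auto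
    note k = v[THEN V_carrier] V_carrier[OF x(1)]
    \<comment> \<open>Modulo \<open>x\<close> only the lowest digit remains, so it is determined;
      \<open>x\<close> is then cancelled from the rest.\<close>
    have "c = (c \<oplus> x \<otimes> a) \<ominus> x \<otimes> a" using k by algebra
    also have "\<dots> = c' \<oplus> x \<otimes> (a' \<ominus> a)" unfolding eq using k by algebra
    finally have "c = c'" using S m v unfolding incongruent_def by blast
    moreover from this have "x \<otimes> a = x \<otimes> a'" using eq k by simp
    then have "a = a'" using m_lcancel[OF x(2)] k by simp
    ultimately show "c = c' \<and> a = a'" by simp
  qed
  then have "card (pspace S x (Suc n)) = card (S \<times> pspace S x n)"
    unfolding pspace.simps by (rule card_image)
  moreover have "pspace S x (Suc n) \<subseteq> V" using SV Suc x by auto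
  ultimately show ?case using Suc SV by (simp add: card_cartesian_product)
qed (use V_closed in simp)

text \<open>
  The \<open>|S|\<^sup>n\<close> expansions with \<open>n\<close> digits have a common denominator, and their numerators lie in a
  space of at most \<open>|K|\<close> to the power \<open>(l + e n) N\<close> elements, where \<open>N = length us\<close>.
\<close>

lemma incongruent_card_le:
  assumes K: "subfield K R" "finite K" and y: "y \<in> carrier R" and us: "set us \<subseteq> carrier R"
    and span: "V \<subseteq> lspan (generate_field R (insert y K)) us"
    and x: "x \<in> pspace K y e" "x \<in> V" "x \<noteq> \<zero>" and S: "incongruent x S"
  shows "card S \<le> card K ^ (e * length us)"
proof -
  let ?q = "card K" and ?N = "length us"
  have SV: "S \<subseteq> V" "finite S" using S by (auto simp: incongruent_def)
  have q: "?q \<ge> 1" using K(2) subringE(3)[OF subfieldE(1)[OF K(1)]] card_gt_0_iff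
    by (metis One_nat_def Suc_leI empty_iff)
  obtain h l where h: "h \<in> carrier R" "h \<noteq> \<zero>" "\<And>s. s \<in> S \<Longrightarrow> h \<otimes> s \<in> lspan (pspace K y l) us"
    using lspan_denominator_finite[OF K(1) y us SV(2)] SV(1) span by blast
  have xc: "x \<in> carrier R" using x V_carrier by blast
  note pc = pspace_carrier[OF K(1) y]
  \<comment> \<open>Each further digit multiplies by \<open>x\<close>, which costs \<open>e\<close>
    in the length; the denominator \<open>h\<close> is paid for only once, by
    \<open>l\<close>.\<close>
  have sub: "(\<otimes>) h ` pspace S x n \<subseteq> lspan (pspace K y (l + e * n)) us" for n
  proof (induction n)
    case 0
    show ?case using h lspan_zero[OF us pspace_zero[OF K(1) y]] by auto
  next
    case (Suc n)
    have "h \<otimes> (s \<oplus> x \<otimes> a) \<in> lspan (pspace K y (l + e * Suc n)) us" if m: "s \<in> S" "a \<in> pspace S x n" for s a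
    proof -
      have c: "s \<in> carrier R" "a \<in> carrier R" using m SV card_expansions[OF x(2,3) S, of n] V_carrier by auto
      have "h \<otimes> (s \<oplus> x \<otimes> a) = h \<otimes> s \<oplus> x \<otimes> (h \<otimes> a)" using c xc h by (simp add: r_distr m_lcomm)
      moreover have "h \<otimes> s \<in> lspan (pspace K y (l + e * Suc n)) us"
        using lspan_mono[OF pspace_mono[OF K(1) y, of l "l + e * Suc n"], of us] h(3)[OF m(1)] by auto
      moreover have "x \<otimes> (h \<otimes> a) \<in> lspan (pspace K y (l + e * Suc n)) us"
      proof (rule lspan_scale[OF pc us xc])
        show "h \<otimes> a \<in> lspan (pspace K y (l + e * n)) us" using Suc m by auto
        show "x \<otimes> b \<in> pspace K y (l + e * Suc n)" if "b \<in> pspace K y (l + e * n)" for b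
          using pspace_mult[OF K(1) y x(1) that] by (simp add: add.commute add.left_commute)
      qed
      ultimately show ?thesis using lspan_add[OF pc us] pspace_add[OF K(1) y] by simp
    qed
    then show ?case by auto
  qed
  have "card S ^ n \<le> ?q ^ (l * ?N) * (?q ^ (e * ?N)) ^ n" for n
  proof -
    note E = card_expansions[OF x(2,3) S, of n]
    have fin: "finite (pspace K y (l + e * n))" "card (pspace K y (l + e * n)) \<le> ?q ^ (l + e * n)"
      using pspace_card[OF K(1) y K(2)] by auto
    have "inj_on ((\<otimes>) h) (pspace S x n)"
      using E m_lcancel[OF h(2,1)] V_carrier by (intro inj_onI) (metis subsetD)
    then have "card S ^ n = card ((\<otimes>) h ` pspace S x n)" using E by (simp add: card_image)
    also have "\<dots> \<le> card (lspan (pspace K y (l + e * n)) us)"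
      using sub lspan_finite[OF fin(1)] by (intro card_mono) auto
    also have "\<dots> \<le> card (pspace K y (l + e * n)) ^ ?N" using lspan_finite[OF fin(1)] by auto
    also have "\<dots> \<le> (?q ^ (l + e * n)) ^ ?N" using fin by (intro power_mono) auto
    also have "\<dots> = ?q ^ (l * ?N) * (?q ^ (e * ?N)) ^ n"
      by (simp add: power_add algebra_simps flip: power_mult)
    finally show ?thesis .
  qed
  then show ?thesis by (rule power_growth_le[rotated]) (use q in simp)
qed

text \<open>An incongruent set of largest size covers every class, since an uncovered element could
  be added to it.\<close>

lemma finite_quotient_polys:
  assumes K: "subfield K R" "finite K" and y: "y \<in> carrier R" and us: "set us \<subseteq> carrier R"
    and span: "V \<subseteq> lspan (generate_field R (insert y K)) us"
    and x: "x \<in> polys K y" "x \<in> V" "x \<noteq> \<zero>"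
  shows "finite_quotient x"
proof -
  obtain e where e: "x \<in> pspace K y e" using x(1) by (auto simp: polys_def[OF K(1) y])
  have "incongruent x {}" by (simp add: incongruent_def)
  moreover have "\<forall>S. incongruent x S \<longrightarrow> card S \<le> card K ^ (e * length us)"
    using incongruent_card_le[OF K y us span e x(2,3)] by blast
  ultimately have "\<exists>S. incongruent x S \<and> (\<forall>S'. incongruent x S' \<longrightarrow> card S' \<le> card S)"
    by (intro ex_has_greatest_nat[of _ "{}" _ "Suc (card K ^ (e * length us))"]) (auto simp: less_Suc_eq_le)
  then obtain S where S: "incongruent x S" and max: "\<And>S'. incongruent x S' \<Longrightarrow> card S' \<le> card S"
    by blast
  have SV: "S \<subseteq> V" "finite S" using S by (auto simp: incongruent_def)
  have "\<exists>s\<in>S. \<exists>w\<in>V. v = s \<oplus> x \<otimes> w" if v: "v \<in> V" for v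
  proof (rule ccontr)
    assume n: "\<not> (\<exists>s\<in>S. \<exists>w\<in>V. v = s \<oplus> x \<otimes> w)"
    have vS: "v \<notin> S"
    proof
      assume "v \<in> S"
      moreover have "v = v \<oplus> x \<otimes> \<zero>" using v x(2) V_carrier by simp
      ultimately show False using n V_closed(1) by blast
    qed
    have "incongruent x (insert v S)"
      unfolding incongruent_def
    proof (intro conjI ballI impI)
      show "finite (insert v S)" "insert v S \<subseteq> V" using SV v by auto
      fix s s' assume m: "s \<in> insert v S" "s' \<in> insert v S" and "\<exists>w\<in>V. s = s' \<oplus> x \<otimes> w"
      then obtain w where w: "w \<in> V" "s = s' \<oplus> x \<otimes> w" by blast
      have c: "s' \<in> carrier R" "w \<in> carrier R" "x \<in> carrier R" using m v SV w x V_carrier by auto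
      \<comment> \<open>Congruence is symmetric, so the new element \<open>v\<close> may stand on
        either side.\<close>
      have "s' = s \<oplus> x \<otimes> (\<ominus> w)" unfolding w(2) using c by algebra
      then show "s = s'" using m n S w V_closed(3)[OF w(1)] unfolding incongruent_def by blast
    qed
    from max[OF this] show False using vS SV by simp
  qed
  then show ?thesis unfolding finite_quotient_def covers_def using SV by blast
qed

end

section \<open>From finite quotients to a uniformizer\<close>

context valuation begin

text \<open>Congruence modulo a multiple of \<open>z\<close> implies congruence modulo
  \<open>z\<close>.\<close>

lemma finite_quotient_factor:
  assumes c: "finite_quotient c" "c = z \<otimes> e" "z \<in> V" "e \<in> V"
  shows "finite_quotient z"
proof -
  obtain S where S: "finite S" "S \<subseteq> V" "\<And>v. v \<in> V \<Longrightarrow> \<exists>s\<in>S. \<exists>w\<in>V. v = s \<oplus> c \<otimes> w"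
    using c(1) unfolding finite_quotient_def covers_def by blast
  have "\<exists>s\<in>S. \<exists>w\<in>V. v = s \<oplus> z \<otimes> w" if v: "v \<in> V" for v
  proof -
    obtain s w where "s \<in> S" "w \<in> V" "v = s \<oplus> c \<otimes> w" using S(3)[OF v] by blast
    moreover from this have "c \<otimes> w = z \<otimes> (e \<otimes> w)" using c V_carrier by (simp add: m_assoc)
    ultimately show ?thesis using V_closed(4)[OF c(4)] by metis
  qed
  then show ?thesis unfolding finite_quotient_def covers_def using S by blast
qed

text \<open>Every nonzero \<open>z\<close> in \<open>V\<close> divides a nonzero element of K[y],
  and the cofactor lies in \<open>V\<close> because the relation has its coefficients in K[y]. For
  that multiple the count applies.\<close>

lemma finite_quotient_function_field:
  assumes K: "subfield K R" "finite K" "K \<subseteq> V" and x: "x \<in> F"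
    and fd: "finite_dimension (generate_field R (insert x K)) F" and z: "z \<in> V" "z \<noteq> \<zero>"
  shows "finite_quotient z"
proof -
  have Kc: "K \<subseteq> carrier R" using subfieldE(3)[OF K(1)] .
  \<comment> \<open>K[y] has to lie in \<open>V\<close>. If \<open>x\<close> is not in
    \<open>V\<close>, its inverse is, and it generates the same field over \<open>K\<close>.\<close>
  have "\<exists>y. y \<in> V \<and> generate_field R (insert y K) = generate_field R (insert x K)"
  proof (cases "x \<in> V")
    case False
    then have x0: "x \<noteq> \<zero>" "inv x \<in> V" using inv_nonunit[OF x] nonunits_V by auto
    note i = inv_facts[OF F_carrier[OF x] x0(1)]
    have sub: "generate_field R (insert a K) \<subseteq> generate_field R (insert b K)"
      if "a \<in> generate_field R (insert b K)" "a \<in> carrier R" "b \<in> carrier R" for a b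
      by (rule generate_field_min_subfield1[OF _ generate_field_is_subfield])
        (use that Kc in \<open>auto intro: generate_field.incl\<close>)
    have "inv x \<in> generate_field R (insert x K)"
      using x0 by (intro generate_field.m_inv generate_field.incl) auto
    moreover have "inv (inv x) \<in> generate_field R (insert (inv x) K)"
      using i by (intro generate_field.m_inv generate_field.incl) auto
    ultimately have "generate_field R (insert (inv x) K) = generate_field R (insert x K)"
      using sub[of x "inv x"] sub[of "inv x" x] i F_carrier[OF x] by auto
    then show ?thesis using x0 by blast
  qed blast
  then obtain y where y: "y \<in> V" and G: "generate_field R (insert y K) = generate_field R (insert x K)"
    by blast
  have yc: "y \<in> carrier R" using y V_carrier by blast
  let ?G = "generate_field R (insert y K)"
  have Gs: "subfield ?G R" using generate_field_is_subfield[of "insert y K"] yc Kc by auto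
  have fd': "finite_dimension ?G F" using fd G by simp
  then obtain n where "dimension n ?G F" by auto
  from exists_base[OF Gs this] obtain us where us: "set us \<subseteq> carrier R" "Span ?G us = F" by blast
  have zc: "z \<in> carrier R" using z V_carrier by blast
  have "algebraic ?G z"
    using finite_dimension_imp_algebraic[OF Gs subfieldE(1)[OF subfield_F] fd' V_F[OF z(1)]]
    by (simp add: over_def)
  from polys_relation[OF K(1) yc zc z(2) this] obtain q c where
    q: "set q \<subseteq> polys K y" "c \<in> polys K y" "c \<noteq> \<zero>" "c = z \<otimes> (\<ominus> eval q z)" by blast
  have PV: "polys K y \<subseteq> V" by (rule polys_min[OF K(1) yc subring_V K(3) y])
  have e: "\<ominus> eval q z \<in> V" using eval_closed[OF subring_V _ z(1), of q] q PV by auto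
  have "finite_quotient c"
    using finite_quotient_polys[OF K(1,2) yc us(1) _ q(2) _ q(3)] us(2) V_F q(2) PV
    unfolding Span_eq_lspan by blast
  then show ?thesis using finite_quotient_factor[OF _ q(4) z(1) e] by blast
qed

lemma nonunits_nontrivial:
  assumes "V \<noteq> F" shows "\<exists>z\<in>nonunits. z \<noteq> \<zero>"
proof -
  obtain z where z: "z \<in> F" "z \<notin> V" using assms V_sub_F by blast
  then have "inv z \<in> nonunits" "z \<noteq> \<zero>" using inv_nonunit by auto
  then show ?thesis using inv_facts(2)[of z] F_carrier z by blast
qed

definition quotient_size where
  "quotient_size z = (LEAST n. \<exists>S. covers z S \<and> card S = n)"

text \<open>
  Modulo \<open>z'\<close> the classes of \<open>0\<close> and \<open>z'\<close>, distinct modulo \<open>z' m\<close>, coincide, so a covering set loses an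
  element. Thus \<open>quotient_size\<close> serves as a measure for division by nonunits.
\<close>

lemma quotient_size_less:
  assumes fin: "finite_quotient (z' \<otimes> m)" and z': "z' \<in> V" "z' \<noteq> \<zero>" and m: "m \<in> nonunits"
  shows "quotient_size z' < quotient_size (z' \<otimes> m)"
proof -
  let ?z = "z' \<otimes> m"
  have "\<exists>n S. covers ?z S \<and> card S = n" using fin unfolding finite_quotient_def covers_def by blast
  from LeastI_ex[OF this] obtain S where S: "covers ?z S" "card S = quotient_size ?z"
    unfolding quotient_size_def by blast
  have mV: "m \<in> V" and zc: "z' \<in> carrier R" "m \<in> carrier R" using m nonunits_V z' V_carrier by auto
  have SV: "finite S" "S \<subseteq> V" and cov: "\<And>v. v \<in> V \<Longrightarrow> \<exists>s\<in>S. \<exists>w\<in>V. v = s \<oplus> ?z \<otimes> w"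
    using S by (auto simp: covers_def)
  obtain s1 w1 where 1: "s1 \<in> S" "w1 \<in> V" "\<zero> = s1 \<oplus> ?z \<otimes> w1" using cov[of \<zero>] by blast
  obtain s2 w2 where 2: "s2 \<in> S" "w2 \<in> V" "z' = s2 \<oplus> ?z \<otimes> w2" using cov[OF z'(1)] by blast
  have c: "s1 \<in> carrier R" "w1 \<in> carrier R" "s2 \<in> carrier R" "w2 \<in> carrier R"
    using 1 2 SV V_carrier by auto
  \<comment> \<open>Otherwise \<open>z'\<close> would be a multiple of
    \<open>z' \<otimes> m\<close>, and cancelling \<open>z'\<close> would make the nonunit
    \<open>m\<close> divide 1.\<close>
  have ne: "s1 \<noteq> s2"
  proof
    assume eq: "s1 = s2"
    have "s1 = (s1 \<oplus> ?z \<otimes> w1) \<ominus> ?z \<otimes> w1" using c zc by algebra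
    then have "s1 = \<zero> \<ominus> ?z \<otimes> w1" unfolding 1(3)[symmetric] .
    then have s1: "s1 = \<ominus> (?z \<otimes> w1)" using c zc by (simp add: minus_eq)
    have "z' = \<ominus> (?z \<otimes> w1) \<oplus> ?z \<otimes> w2" using 2(3) s1 eq by simp
    also have "\<dots> = z' \<otimes> (m \<otimes> (w2 \<ominus> w1))" using c zc by algebra
    finally have eq1: "z' \<otimes> \<one> = z' \<otimes> (m \<otimes> (w2 \<ominus> w1))" using zc by simp
    have "m \<otimes> (w2 \<ominus> w1) \<in> carrier R" using c zc by simp
    from iffD1[OF m_lcancel[OF z'(2) zc(1) one_closed this] eq1]
    have "\<one> = m \<otimes> (w2 \<ominus> w1)" .
    then show False using nonunits_mult[OF m V_minus[OF 2(2) 1(2)]] one_not_nonunit by metis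
  qed
  have "covers z' (S - {s2})"
    unfolding covers_def
  proof (intro conjI ballI)
    fix v assume v: "v \<in> V"
    obtain s w where s: "s \<in> S" "w \<in> V" "v = s \<oplus> ?z \<otimes> w" using cov[OF v] by blast
    have sc: "s \<in> carrier R" "w \<in> carrier R" using s SV V_carrier by auto
    show "\<exists>s\<in>S - {s2}. \<exists>w\<in>V. v = s \<oplus> z' \<otimes> w"
    proof (cases "s = s2")
      case False
      moreover have "v = s \<oplus> z' \<otimes> (m \<otimes> w)" using s sc zc by (simp add: m_assoc)
      ultimately show ?thesis using s mV by blast
    next
      case True
      \<comment> \<open>Obtained from 0 = s1 + z' m w1 and z' = s2 + z' m w2, substituted into v =
        s2 + z' m w.\<close>
      let ?w = "m \<otimes> w1 \<oplus> \<one> \<ominus> m \<otimes> w2 \<oplus> m \<otimes> w"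
      have "v = \<zero> \<oplus> (s2 \<oplus> ?z \<otimes> w2) \<ominus> ?z \<otimes> w2 \<oplus> ?z \<otimes> w" unfolding s(3) True using c zc sc by algebra
      also have "\<dots> = (s1 \<oplus> ?z \<otimes> w1) \<oplus> z' \<ominus> ?z \<otimes> w2 \<oplus> ?z \<otimes> w"
        using 1(3) 2(3) by simp
      also have "\<dots> = s1 \<oplus> z' \<otimes> ?w" using c zc sc by algebra
      finally have "v = s1 \<oplus> z' \<otimes> ?w" .
      moreover have "?w \<in> V" using mV 1 2 s V_closed V_minus by simp
      ultimately show ?thesis using ne 1(1) by blast
    qed
  qed (use SV in auto)
  then have "quotient_size z' \<le> card (S - {s2})"
    unfolding quotient_size_def by (intro Least_le) blast
  also have "\<dots> < card S" using SV 2(1) by (intro card_Diff1_less)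
  finally show ?thesis using S(2) by simp
qed

definition uniformizer where
  "uniformizer t \<longleftrightarrow> t \<in> nonunits \<and> t \<noteq> \<zero> \<and> (\<forall>z\<in>nonunits. \<exists>w\<in>V. z = t \<otimes> w)"

end

text \<open>Finiteness of all quotients takes the place of a chain condition: it yields a
  uniformizer, the termination of division by it, and a finite residue field.\<close>

locale discrete_valuation = valuation +
  assumes finite_quotients: "\<And>z. z \<in> V \<Longrightarrow> z \<noteq> \<zero> \<Longrightarrow> finite_quotient z"
    and nontrivial: "\<exists>z\<in>nonunits. z \<noteq> \<zero>"
begin

text \<open>A nonzero nonunit \<open>t\<close> with the smallest quotient generates: if
  \<open>z\<close> were not a multiple of \<open>t\<close>, then \<open>t\<close> would be a proper
  multiple of \<open>z\<close>, and the quotient of \<open>z\<close> would be smaller.\<close>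

lemma uniformizer_exists: "\<exists>t. uniformizer t"
proof -
  obtain t where t: "t \<in> nonunits \<and> t \<noteq> \<zero>"
    and min: "\<And>z. z \<in> nonunits \<and> z \<noteq> \<zero> \<Longrightarrow> quotient_size t \<le> quotient_size z"
    using ex_has_least_nat[of "\<lambda>z. z \<in> nonunits \<and> z \<noteq> \<zero>" _ quotient_size] nontrivial by metis
  have tV: "t \<in> V" "t \<in> carrier R" using t nonunits_V V_carrier by auto
  have "\<exists>w\<in>V. z = t \<otimes> w" if z: "z \<in> nonunits" for z
  proof (rule ccontr)
    assume n: "\<not> (\<exists>w\<in>V. z = t \<otimes> w)"
    have zV: "z \<in> V" using z nonunits_V by blast
    obtain w where w: "w \<in> nonunits" "t = z \<otimes> w" using quotient_cases[OF zV tV(1)] n by blast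
    have z0: "z \<noteq> \<zero>" using n V_closed(1) tV by (metis r_null)
    have "quotient_size z < quotient_size (z \<otimes> w)"
      by (rule quotient_size_less[OF _ zV z0 w(1)]) (use finite_quotients tV t w in auto)
    then show False using min[of z] z z0 w(2) by simp
  qed
  then show ?thesis unfolding uniformizer_def using t by blast
qed

text \<open>Each division by \<open>t\<close> shrinks the quotient, so the process stops at a
  unit.\<close>

lemma uniformizer_factorization:
  assumes t: "uniformizer t" and z: "z \<in> V" "z \<noteq> \<zero>"
  shows "\<exists>k u. u \<in> V - nonunits \<and> z = t [^] (k::nat) \<otimes> u"
  using z
proof (induction "quotient_size z" arbitrary: z rule: less_induct)
  case less
  have tc: "t \<in> nonunits" "t \<in> carrier R" using t nonunits_V V_carrier by (auto simp: uniformizer_def)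
  show ?case
  proof (cases "z \<in> nonunits")
    case False
    then show ?thesis using less.prems V_carrier by (intro exI[of _ 0] exI[of _ z]) auto
  next
    case True
    then obtain w where w: "w \<in> V" "z = t \<otimes> w" using t unfolding uniformizer_def by blast
    have wc: "w \<in> carrier R" using w V_carrier by blast
    have zw: "z = w \<otimes> t" using w wc tc by (simp add: m_comm)
    have w0: "w \<noteq> \<zero>" using zw less.prems tc by auto
    have "quotient_size w < quotient_size z"
      unfolding zw by (rule quotient_size_less[OF _ w(1) w0 tc(1)])
        (use finite_quotients less.prems zw in auto)
    from less.hyps[OF this w(1) w0] obtain k u where ku: "u \<in> V - nonunits" "w = t [^] (k::nat) \<otimes> u" by blast
    have "z = t [^] Suc k \<otimes> u" unfolding w(2) ku(2) using tc ku(1) V_carrier by (simp add: m_ac)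
    then show ?thesis using ku(1) by blast
  qed
qed

end

section \<open>Residue fields\<close>

context ring begin

lemma dimension_card:
  assumes K: "subfield K R" "finite K" and d: "dimension n K E"
  shows "finite E \<and> card E = card K ^ n"
  using d
proof (induction n arbitrary: E)
  case 0
  then have "E = {\<zero>}" using dimension_zero[OF K(1)] by blast
  then show ?case by simp
next
  case (Suc n)
  obtain v E' where E: "v \<in> carrier R" "v \<notin> E'" "dimension n K E'" "E = line_extension K v E'"
    using dimension_backwards[OF K(1) Suc.prems] by blast
  have IH: "finite E'" "card E' = card K ^ n" using Suc.IH[OF E(3)] by auto
  obtain us where us: "set us \<subseteq> carrier R" "Span K us = E'" using exists_base[OF K(1) E(3)] by blast
  have E'c: "E' \<subseteq> carrier R" using Span_in_carrier[OF subfieldE(3)[OF K(1)] us(1)] us(2) by simp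
  have Kc: "K \<subseteq> carrier R" using subfieldE(3)[OF K(1)] .
  have img: "E = (\<lambda>(k, x). k \<otimes> v \<oplus> x) ` (K \<times> E')"
    unfolding E(4) by (auto simp: line_extension_mem_iff) force
  have "inj_on (\<lambda>(k, x). k \<otimes> v \<oplus> x) (K \<times> E')"
  proof (rule inj_onI, clarify)
    fix k x k' x' assume m: "k \<in> K" "x \<in> E'" "k' \<in> K" "x' \<in> E'" and eq: "k \<otimes> v \<oplus> x = k' \<otimes> v \<oplus> x'"
    have c: "k \<in> carrier R" "x \<in> carrier R" "k' \<in> carrier R" "x' \<in> carrier R" using m Kc E'c by auto
    have "(k \<ominus> k') \<otimes> v = (k \<otimes> v \<oplus> x) \<ominus> x \<ominus> k' \<otimes> v" using c E(1) by algebra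
    also have "\<dots> = x' \<ominus> x" unfolding eq using c E(1) by algebra
    finally have kv: "(k \<ominus> k') \<otimes> v = x' \<ominus> x" .
    have "x' \<ominus> x \<in> E'" using Span_subgroup_props[OF K(1) us(1)] m us(2) by (simp add: minus_eq)
    moreover have "k \<ominus> k' \<in> K" using m subringE(5,7)[OF subfieldE(1)[OF K(1)]] by (simp add: minus_eq)
    ultimately have "k \<ominus> k' = \<zero>"
      using Span_m_inv_simprule[OF K(1) us(1), of "k \<ominus> k'" v] us(2) E(1,2) kv by auto
    then have "k = k'" using c by simp
    then show "k = k' \<and> x = x'" using eq c E(1) by simp
  qed
  then have "card E = card (K \<times> E')" unfolding img by (rule card_image)
  then show ?case using IH img K(2) by (simp add: card_cartesian_product)
qed

end

section \<open>Residue classes and the cardinality of the residue field\<close>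

context valuation begin

abbreviation VR where "VR \<equiv> R\<lparr>carrier := V\<rparr>"

lemma residue_class_eq_iff:
  assumes "a \<in> V" "b \<in> V"
  shows "nonunits +>\<^bsub>VR\<^esub> a = nonunits +>\<^bsub>VR\<^esub> b \<longleftrightarrow> a \<ominus> b \<in> nonunits"
proof
  have c: "a \<in> carrier R" "b \<in> carrier R" using assms V_carrier by auto
  have cs: "nonunits +>\<^bsub>VR\<^esub> x = {p \<oplus> x | p. p \<in> nonunits}" for x
    unfolding a_r_coset_def r_coset_def by auto
  show "a \<ominus> b \<in> nonunits" if eq: "nonunits +>\<^bsub>VR\<^esub> a = nonunits +>\<^bsub>VR\<^esub> b"
  proof -
    have "a = \<zero> \<oplus> a" using c by simp
    then have "a \<in> {p \<oplus> a | p. p \<in> nonunits}" using zero_nonunit by blast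
    then obtain p where p: "p \<in> nonunits" "a = p \<oplus> b" using eq unfolding cs by blast
    have "p \<in> carrier R" using p nonunits_V V_carrier by blast
    then have "a \<ominus> b = p" unfolding p(2) using c by algebra
    then show ?thesis using p by simp
  qed
  have sub: "nonunits +>\<^bsub>VR\<^esub> x \<subseteq> nonunits +>\<^bsub>VR\<^esub> y" if xy: "x \<ominus> y \<in> nonunits" "x \<in> carrier R" "y \<in> carrier R" for x y
  proof
    fix z assume "z \<in> nonunits +>\<^bsub>VR\<^esub> x"
    then obtain p where p: "p \<in> nonunits" "z = p \<oplus> x" unfolding cs by blast
    have "p \<in> carrier R" using p nonunits_V V_carrier by blast
    then have "z = (p \<oplus> (x \<ominus> y)) \<oplus> y" unfolding p(2) using xy by algebra
    then show "z \<in> nonunits +>\<^bsub>VR\<^esub> y" unfolding cs using p(1) xy(1) by blast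
  qed
  show "nonunits +>\<^bsub>VR\<^esub> a = nonunits +>\<^bsub>VR\<^esub> b" if "a \<ominus> b \<in> nonunits"
  proof -
    have "b \<ominus> a = \<ominus> (a \<ominus> b)" using c by algebra
    then have "b \<ominus> a \<in> nonunits" using nonunits_uminus[OF that] by simp
    then show ?thesis using sub that c by blast
  qed
qed

abbreviation residue_field where "residue_field \<equiv> VR Quot nonunits"
abbreviation rc where "rc a \<equiv> nonunits +>\<^bsub>VR\<^esub> a"

lemma nonunits_maximal: "maximalideal nonunits VR"
  using maximalideal_iff by blast

lemma residue_field_field: "field residue_field"
  using maximalideal.quotient_is_field[OF nonunits_maximal cring_V] .

lemma rc_hom: "ring_hom_ring VR residue_field rc"
  by (rule ideal.rcos_ring_hom_ring[OF nonunits_ideal])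

lemma residue_field_carrier: "carrier residue_field = rc ` V"
  by (auto simp: FactRing_def A_RCOSETS_def RCOSETS_def a_r_coset_def)

lemma rc_pow: "v \<in> V \<Longrightarrow> rc v [^]\<^bsub>residue_field\<^esub> (n::nat) = rc (v [^] n)"
proof -
  assume v: "v \<in> V"
  interpret h: ring_hom_ring VR residue_field rc by (rule rc_hom)
  have "v [^]\<^bsub>VR\<^esub> n = v [^] n" by (simp add: nat_pow_def)
  then show ?thesis using h.hom_nat_pow[of v n] v by simp
qed

text \<open>\<open>K\<close> is a field inside \<open>V\<close>, so its nonzero elements are units
  and it meets the maximal ideal only in zero.\<close>

lemma rc_image_subfield:
  assumes K: "subfield K R" "K \<subseteq> V"
  shows "subfield (rc ` K) residue_field" "inj_on rc K"
proof -
  interpret h: ring_hom_ring VR residue_field rc by (rule rc_hom)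
  interpret k: field residue_field by (rule residue_field_field)
  have E: "\<zero> \<in> K" "\<one> \<in> K" "\<And>h. h \<in> K \<Longrightarrow> \<ominus> h \<in> K"
    "\<And>h1 h2. h1 \<in> K \<Longrightarrow> h2 \<in> K \<Longrightarrow> h1 \<otimes> h2 \<in> K" "\<And>h1 h2. h1 \<in> K \<Longrightarrow> h2 \<in> K \<Longrightarrow> h1 \<oplus> h2 \<in> K"
    using subringE[OF subfieldE(1)[OF K(1)]] by auto
  have inter: "K \<inter> nonunits = {\<zero>}"
  proof -
    have "inv x \<in> V" if "x \<in> K" "x \<noteq> \<zero>" for x using subfield_m_inv(1)[OF K(1)] that K(2) by blast
    then show ?thesis using E(1) unfolding nonunits_def by auto
  qed
  have Kc: "K \<subseteq> carrier R" using K(2) V_carrier by blast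
  have nz: "k \<in> nonunits" if "k \<in> K" "rc k = \<zero>\<^bsub>residue_field\<^esub>" for k
  proof -
    have "rc \<zero> = \<zero>\<^bsub>residue_field\<^esub>" using h.hom_zero by simp
    then have "k \<ominus> \<zero> \<in> nonunits" using residue_class_eq_iff[of k \<zero>] that K(2) V_closed(1) by auto
    then show ?thesis using that Kc by (auto simp: minus_eq)
  qed
  show inj: "inj_on rc K"
  proof (rule inj_onI)
    fix a b assume ab: "a \<in> K" "b \<in> K" "rc a = rc b"
    have "a \<ominus> b \<in> nonunits" using residue_class_eq_iff[of a b] ab K(2) by blast
    moreover have "a \<ominus> b \<in> K" using ab E by (simp add: minus_eq)
    ultimately have "a \<ominus> b = \<zero>" using inter by blast
    then show "a = b" using ab Kc r_right_minus_eq[of a b] by blast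
  qed
  show "subfield (rc ` K) residue_field"
  proof (rule k.subfieldI')
    have "subgroup K (add_monoid VR)"
      using add.subgroup_incl[OF subring.axioms(1)[OF subfieldE(1)[OF K(1)]] subring.axioms(1)[OF subring_V] K(2)]
      by simp
    moreover have "submonoid K VR" by (rule submonoid.intro) (use E K in auto)
    ultimately have "subring K VR" by (rule subring.intro)
    then show "subring (rc ` K) residue_field"
      by (rule h.img_is_subring)
    fix k' assume k': "k' \<in> rc ` K - {\<zero>\<^bsub>residue_field\<^esub>}"
    then obtain k where k: "k \<in> K" "k' = rc k" by blast
    have k0: "k \<noteq> \<zero>" using k k' h.hom_zero by auto
    have i: "inv k \<in> K" "k \<otimes> inv k = \<one>" using subfield_m_inv[OF K(1), of k] k k0 by auto
    have "rc k \<otimes>\<^bsub>residue_field\<^esub> rc (inv k) = \<one>\<^bsub>residue_field\<^esub>"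
      using h.hom_mult[of k "inv k"] h.hom_one i k K(2) by auto
    moreover have "rc k \<in> carrier residue_field" "rc (inv k) \<in> carrier residue_field"
      unfolding residue_field_carrier using k i K(2) by blast+
    ultimately have "inv\<^bsub>residue_field\<^esub> k' = rc (inv k)"
      unfolding k(2) by (intro k.comm_inv_char)
    then show "inv\<^bsub>residue_field\<^esub> k' \<in> rc ` K" using i by auto
  qed
qed

lemma residue_field_finite:
  assumes "finite_quotient t" "t \<in> nonunits"
  shows "finite (carrier residue_field)"
proof -
  obtain S where S: "finite S" "S \<subseteq> V" "\<And>v. v \<in> V \<Longrightarrow> \<exists>s\<in>S. \<exists>w\<in>V. v = s \<oplus> t \<otimes> w"
    using assms(1) unfolding finite_quotient_def covers_def by blast
  have "rc v \<in> rc ` S" if v: "v \<in> V" for v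
  proof -
    obtain s w where s: "s \<in> S" "w \<in> V" "v = s \<oplus> t \<otimes> w" using S(3)[OF v] by blast
    have c: "s \<in> carrier R" "t \<otimes> w \<in> nonunits" "t \<otimes> w \<in> carrier R"
      using s S(2) assms(2) V_carrier nonunits_V by auto
    have "v \<ominus> s = t \<otimes> w" unfolding s(3) using c by algebra
    then have "rc v = rc s" using residue_class_eq_iff[of v s] v s S(2) c(2) by auto
    then show ?thesis using s by blast
  qed
  then show ?thesis unfolding residue_field_carrier using S(1) by (meson finite_imageI finite_subset image_subsetI)
qed

text \<open>Turns the dimension that defines the degree of a place into the exponent of a power map.
  A finite residue field spans itself, so \<open>dim\<close> is a genuine dimension.\<close>

lemma residue_field_card:
  assumes K: "subfield K R" "finite K" "K \<subseteq> V" and fin: "finite (carrier residue_field)"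
  shows "card (carrier residue_field) = card K ^ ring.dim residue_field (rc ` K) (carrier residue_field)"
proof -
  interpret k: field residue_field by (rule residue_field_field)
  note S = rc_image_subfield[OF K(1,3)]
  obtain us where us: "set us = carrier residue_field" using fin finite_list by blast
  have "k.Span (rc ` K) us = carrier residue_field"
    using k.Span_base_incl[OF S(1)] k.Span_in_carrier[OF subfieldE(3)[OF S(1)]] us by blast
  then have "k.finite_dimension (rc ` K) (carrier residue_field)"
    using k.Span_finite_dimension[OF S(1), of us] us by simp
  from k.finite_dimensionE[OF S(1) this]
  have "k.dimension (k.dim (rc ` K) (carrier residue_field)) (rc ` K) (carrier residue_field)"
    by (simp add: over_def)
  from k.dimension_card[OF S(1) _ this] show ?thesis using K(2) card_image[OF S(2)] by simp
qed

end

section \<open>Constant field extensions\<close>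

context cring begin

text \<open>The set of generators is closed under products, so a product of two combinations is a
  combination again.\<close>

lemma lspan_subring:
  assumes V: "subring V R" and ks: "set ks \<subseteq> carrier R" "\<one> \<in> set ks"
    and mult: "\<And>k l. k \<in> set ks \<Longrightarrow> l \<in> set ks \<Longrightarrow> k \<otimes> l \<in> set ks"
  shows "subring (lspan V ks) R"
proof -
  note E = subringE[OF V]
  have add: "x \<oplus> y \<in> lspan V ks" if "x \<in> lspan V ks" "y \<in> lspan V ks" for x y
    using lspan_add[OF E(1) ks(1) E(7)] that by blast
  have scale: "v \<otimes> x \<in> lspan V ks" if "v \<in> V" "x \<in> lspan V ks" for v x
    by (rule lspan_scale[OF E(1) ks(1) _ _ that(2)]) (use that E in auto)
  have km: "k \<otimes> x \<in> lspan V ks" if k: "k \<in> set ks" and us: "set us \<subseteq> set ks" and x: "x \<in> lspan V us" for k us x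
    using us x
  proof (induction us arbitrary: x)
    case Nil
    then show ?case using lspan_zero[OF ks(1) E(2)] k ks(1) by auto
  next
    case (Cons u us)
    then obtain a y where x: "x = a \<otimes> u \<oplus> y" "a \<in> V" "y \<in> lspan V us" by auto
    have usc: "set us \<subseteq> carrier R" using Cons.prems ks by auto
    have c: "k \<in> carrier R" "a \<in> carrier R" "u \<in> carrier R" "y \<in> carrier R"
      using k x E(1) ks(1) Cons.prems lspan_carrier[OF E(1) usc] by auto
    have "k \<otimes> x = a \<otimes> (k \<otimes> u) \<oplus> k \<otimes> y" unfolding x(1) using c by (simp add: r_distr m_lcomm)
    moreover have "a \<otimes> (k \<otimes> u) \<in> lspan V ks"
      using lspan_mem[OF E(1) ks(1) E(2) x(2)] mult[OF k] Cons.prems by auto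
    ultimately show ?case using add Cons.IH[OF _ x(3)] Cons.prems by auto
  qed
  have m: "x \<otimes> y \<in> lspan V ks" if us: "set us \<subseteq> set ks" and x: "x \<in> lspan V us" and y: "y \<in> lspan V ks" for us x y
    using us x
  proof (induction us arbitrary: x)
    case Nil
    then show ?case using lspan_zero[OF ks(1) E(2)] y lspan_carrier[OF E(1) ks(1)] by auto
  next
    case (Cons u us)
    then obtain a x' where x: "x = a \<otimes> u \<oplus> x'" "a \<in> V" "x' \<in> lspan V us" by auto
    have usc: "set us \<subseteq> carrier R" using Cons.prems ks by auto
    have c: "y \<in> carrier R" "a \<in> carrier R" "u \<in> carrier R" "x' \<in> carrier R"
      using x E(1) ks(1) Cons.prems lspan_carrier[OF E(1) usc] lspan_carrier[OF E(1) ks(1)] y by auto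
    have "x \<otimes> y = a \<otimes> (u \<otimes> y) \<oplus> x' \<otimes> y" unfolding x(1) using c by (simp add: l_distr m_assoc)
    moreover have "a \<otimes> (u \<otimes> y) \<in> lspan V ks"
      using scale[OF x(2) km[OF _ order_refl y]] Cons.prems by auto
    ultimately show ?case using add Cons.IH[OF _ x(3)] Cons.prems by auto
  qed
  show ?thesis
  proof (rule subringI)
    show "lspan V ks \<subseteq> carrier R" by (rule lspan_carrier[OF E(1) ks(1)])
    show "\<one> \<in> lspan V ks" using lspan_mem[OF E(1) ks(1) E(2) E(3) ks(2)] by simp
    show "\<ominus> x \<in> lspan V ks" if x: "x \<in> lspan V ks" for x
    proof -
      have "x \<in> carrier R" using x lspan_carrier[OF E(1) ks(1)] by blast
      then have "\<ominus> x = \<ominus> \<one> \<otimes> x" by (simp add: l_minus)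
      then show ?thesis using scale[OF E(5)[OF E(3)] x] by simp
    qed
  qed (use add m[OF order_refl] in auto)
qed

end

section \<open>The field F K' and the restriction of its valuation rings to F\<close>

locale constant_extension = field R for R (structure) +
  fixes K F K' m
  assumes K: "subfield K R" "finite K" and F: "subfield F R" "K \<subseteq> F"
    and function_field: "\<exists>x\<in>F. transcendental K x \<and> finite_dimension (generate_field R (insert x K)) F"
    and K': "subfield K' R" "K \<subseteq> K'" "card K' = card K ^ m"
    and K'_algebraic: "\<And>z. z \<in> K' \<Longrightarrow> algebraic K z"
    and generated: "carrier R = generate_field R (F \<union> K')"
begin

lemma K'_finite: "finite K'"
proof -
  have "card K > 0" using K(2) subringE(3)[OF subfieldE(1)[OF K(1)]] card_gt_0_iff by blast
  then have "card K' > 0" using K'(3) by simp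
  then show ?thesis by (rule card_ge_0_finite)
qed

text \<open>All of \<open>K'\<close> rather than a basis over \<open>K\<close>: this list is closed
  under products, and spanning is all that is asked of it.\<close>

definition ks where "ks = (SOME l. set l = K')"

lemma set_ks: "set ks = K'"
  unfolding ks_def by (rule someI_ex) (use K'_finite finite_list in blast)

lemma K'_closed:
  "\<zero> \<in> K'" "\<one> \<in> K'" "x \<in> K' \<Longrightarrow> \<ominus> x \<in> K'" "x \<in> K' \<Longrightarrow> x \<in> carrier R"
  "x \<in> K' \<Longrightarrow> z \<in> K' \<Longrightarrow> x \<otimes> z \<in> K'" "x \<in> K' \<Longrightarrow> z \<in> K' \<Longrightarrow> x \<oplus> z \<in> K'"
  using subringE[OF subfieldE(1)[OF K'(1)]] by auto

lemma ks_carrier: "set ks \<subseteq> carrier R" using set_ks K'_closed(4) by auto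

text \<open>Adjoining algebraic elements to \<open>F\<close> as a ring already gives a field. Hence
  a subring that contains \<open>F\<close> and \<open>K'\<close> is everything.\<close>

lemma carrier_finite_extension: "carrier R = finite_extension F ks"
proof
  have alg: "\<And>x. x \<in> set ks \<Longrightarrow> (algebraic over F) x"
    using K'_algebraic set_ks algebraic_mono[OF F(2)] by (simp add: over_def)
  have "subfield (finite_extension F ks) R"
    by (rule finite_extension_is_subfield[OF F(1) ks_carrier alg])
  moreover have "F \<union> K' \<subseteq> finite_extension F ks"
    using finite_extension_incl[OF subfieldE(3)[OF F(1)] ks_carrier]
      finite_extension_mem[OF subfieldE(1)[OF F(1)] ks_carrier] set_ks by blast
  moreover have "F \<union> K' \<subseteq> carrier R" using subfieldE(3)[OF F(1)] K'_closed(4) by blast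
  ultimately have "generate_field R (F \<union> K') \<subseteq> finite_extension F ks"
    by (intro generate_field_min_subfield1)
  then show "carrier R \<subseteq> finite_extension F ks" using generated by simp
  show "finite_extension F ks \<subseteq> carrier R"
    by (rule finite_extension_in_carrier[OF subfieldE(3)[OF F(1)] ks_carrier])
qed

lemma carrier_subset_subring: "subring S R \<Longrightarrow> F \<subseteq> S \<Longrightarrow> K' \<subseteq> S \<Longrightarrow> carrier R \<subseteq> S"
  unfolding carrier_finite_extension by (rule finite_extension_subring_incl) (auto simp: set_ks)

lemma valuation_upper:
  assumes "valuation_ring R K' (carrier R) V'" shows "valuation R (carrier R) V'"
  by (rule valuation_if_ring[OF assms carrier_is_subfield])

lemma discrete_lower:
  assumes "valuation_ring R K F V" shows "discrete_valuation R F V"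
proof -
  interpret valuation R F V by (rule valuation_if_ring[OF assms F(1)])
  obtain x where "x \<in> F" "finite_dimension (generate_field R (insert x K)) F" using function_field by blast
  moreover have "K \<subseteq> V" "V \<noteq> F" using assms by (auto simp: valuation_ring_def)
  ultimately show ?thesis
    using finite_quotient_function_field[OF K] nonunits_nontrivial by unfold_locales auto
qed

text \<open>If the trace were all of \<open>F\<close>, then \<open>V'\<close> would contain
  \<open>F\<close> and \<open>K'\<close>, hence everything. If it were \<open>K\<close>, it would
  miss both a transcendental element and its inverse.\<close>

lemma valuation_ring_restrict:
  assumes "valuation_ring R K' (carrier R) V'" shows "valuation_ring R K F (V' \<inter> F)"
proof -
  interpret up: valuation R "carrier R" V' by (rule valuation_upper[OF assms])
  have V': "K' \<subseteq> V'" "V' \<noteq> carrier R" using assms by (auto simp: valuation_ring_def)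
  have sub: "subring (V' \<inter> F) R" by (rule subring_inter[OF up.subring_V subfieldE(1)[OF F(1)]])
  have inv: "inv z \<in> F" if "z \<in> F" "z \<noteq> \<zero>" for z using subfield_m_inv(1)[OF F(1)] that by blast
  have Fc: "F \<subseteq> carrier R" using subfieldE(3)[OF F(1)] .
  have ne: "V' \<inter> F \<noteq> F"
  proof
    assume "V' \<inter> F = F"
    then have "carrier R \<subseteq> V'" using carrier_subset_subring[OF up.subring_V _ V'(1)] by blast
    then show False using V'(2) up.V_sub_F by blast
  qed
  obtain x where x: "x \<in> F" "transcendental K x" using function_field by blast
  have nK: "y \<notin> K" if "transcendental K y" for y
    using algebraic_self[OF subfieldE(1)[OF K(1)], of y] that by (auto simp: over_def)
  have xK: "x \<notin> K" by (rule nK[OF x(2)])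
  have x0: "x \<noteq> \<zero>" using xK subringE(2)[OF subfieldE(1)[OF K(1)]] by blast
  have "inv x \<notin> K"
  proof
    assume i: "inv x \<in> K"
    then have "inv (inv x) \<in> K" using subfield_m_inv(1)[OF K(1), of "inv x"] inv_facts[of x] x0 x Fc by blast
    then show False using xK inv_facts(5)[of x] x x0 Fc by auto
  qed
  then have "V' \<inter> F \<noteq> K" using up.mem_or_inv_mem[of x] x x0 xK inv[of x] Fc by blast
  then show ?thesis
    unfolding valuation_ring_def using sub ne F(2) K'(2) V'(1) up.mem_or_inv_mem inv Fc by blast
qed

end

section \<open>The ring B = V K' over a place of F\<close>

locale lower_place = constant_extension R K F K' m + discrete_valuation R F V
  for R (structure) and K F K' m V +
  fixes t
  assumes K_sub_V: "K \<subseteq> V" and uniformizer_t: "uniformizer t"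
begin

lemma t_facts: "t \<in> nonunits" "t \<in> V" "t \<in> F" "t \<in> carrier R" "t \<noteq> \<zero>"
  using uniformizer_t nonunits_V V_F V_carrier by (auto simp: uniformizer_def)

lemma residue_finite: "finite (carrier residue_field)"
  by (rule residue_field_finite[OF finite_quotients[OF t_facts(2,5)] t_facts(1)])

definition residue_degree where
  "residue_degree = ring.dim residue_field (rc ` K) (carrier residue_field)"

lemma residue_card: "card (carrier residue_field) = card K ^ residue_degree"
  unfolding residue_degree_def by (rule residue_field_card[OF K K_sub_V residue_finite])

lemma residue_power:
  assumes "v \<in> V" shows "v [^] (card K ^ (residue_degree * n)) \<ominus> v \<in> nonunits"
proof -
  interpret k: field residue_field by (rule residue_field_field)
  have r: "rc v \<in> carrier residue_field" using assms residue_field_carrier by blast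
  have 1: "rc v [^]\<^bsub>residue_field\<^esub> (card K ^ residue_degree) = rc v"
    using k.subfield_power_card[OF k.carrier_is_subfield residue_finite r] residue_card by simp
  have "rc v [^]\<^bsub>residue_field\<^esub> (card K ^ (residue_degree * n)) = rc v"
  proof (induction n)
    case 0 then show ?case using r by (simp only: mult_0_right power_0 k.nat_pow_eone)
  next
    case (Suc n)
    have "card K ^ (residue_degree * Suc n) = card K ^ (residue_degree * n) * card K ^ residue_degree"
      by (simp add: power_add)
    then show ?case using k.nat_pow_pow[OF r, of "card K ^ (residue_degree * n)" "card K ^ residue_degree"] Suc 1
      by simp
  qed
  then show ?thesis using rc_pow[OF assms] residue_class_eq_iff[OF V_pow[OF assms] assms] by simp
qed

text \<open>The exponent is a multiple of the residue degree and of \<open>m\<close>, so the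
  \<open>Q\<close>-power map is the identity both on the residue field of \<open>V\<close> and on
  \<open>K'\<close>; as an iterate of Frobenius it is additive.\<close>

definition Q where "Q = card K ^ (residue_degree * m)"

text \<open>Makes \<open>Q - 1\<close> positive, so that \<open>b [^] (Q - 1)\<close> is a nonunit
  along with \<open>b\<close>.\<close>

lemma Q_ge_2: "Q \<ge> 2"
proof -
  interpret k: field residue_field by (rule residue_field_field)
  have two: "card A \<ge> 2" if "a \<in> A" "b \<in> A" "a \<noteq> b" "finite A" for A and a b :: 'c
    using that card_le_Suc0_iff_eq[of A] by (metis not_less_eq_eq numeral_2_eq_2)
  have "card (carrier residue_field) \<ge> 2"
    using two[OF k.zero_closed k.one_closed] k.one_not_zero residue_finite by auto
  moreover have "card K' \<ge> 2" using two[OF K'_closed(1,2)] K'_finite by auto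
  ultimately have "residue_degree > 0" "m > 0" "card K \<ge> 2"
    using residue_card K'(3)
    subgoal by (metis One_nat_def not_gr_zero not_less_eq_eq numeral_2_eq_2 order_refl power_0)
    subgoal using \<open>card K' \<ge> 2\<close> K'(3) by (metis One_nat_def not_gr_zero not_less_eq_eq numeral_2_eq_2 order_refl power_0)
    subgoal using two[of \<zero> K \<one>] subringE(2,3)[OF subfieldE(1)[OF K(1)]] K(2) by auto
    done
  then show ?thesis unfolding Q_def
    by (metis One_nat_def Suc_leI le_trans mult_pos_pos power_increasing power_one_right le_simps(1) less_le_trans numeral_2_eq_2 zero_less_Suc)
qed

lemma Q_add: "x \<in> carrier R \<Longrightarrow> y \<in> carrier R \<Longrightarrow> (x \<oplus> y) [^] Q = x [^] Q \<oplus> y [^] Q"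
  unfolding Q_def by (rule frobenius_power_add[OF K])

lemma Q_fixes_K': "x \<in> K' \<Longrightarrow> x [^] Q = x"
proof -
  assume x: "x \<in> K'"
  have xc: "x \<in> carrier R" using K'_closed(4)[OF x] .
  have 1: "x [^] (card K ^ m) = x" using subfield_power_card[OF K'(1) K'_finite x] K'(3) by simp
  have "x [^] (card K ^ (n * m)) = x" for n :: nat
  proof (induction n)
    case 0 then show ?case using xc by (simp only: mult_0 power_0 nat_pow_eone)
  next
    case (Suc n)
    have "card K ^ (Suc n * m) = card K ^ (n * m) * card K ^ m" by (simp add: power_add)
    then show ?case using nat_pow_pow[OF xc, of "card K ^ (n * m)" "card K ^ m"] Suc 1 by simp
  qed
  then show ?thesis unfolding Q_def .
qed

definition B where "B = lspan V ks"

lemma V_sub_carrier: "V \<subseteq> carrier R" using V_carrier by blast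

lemma B_subring: "subring B R"
  unfolding B_def by (rule lspan_subring[OF subring_V ks_carrier]) (auto simp: set_ks K'_closed)

lemmas B_closed = subringE[OF B_subring]

lemma V_sub_B: "V \<subseteq> B"
proof
  fix v assume v: "v \<in> V"
  have "v \<otimes> \<one> \<in> B" unfolding B_def
    by (rule lspan_mem[OF V_sub_carrier ks_carrier V_closed(1) v]) (simp add: set_ks K'_closed)
  then show "v \<in> B" using v V_carrier by simp
qed

lemma K'_sub_B: "K' \<subseteq> B"
proof
  fix v assume v: "v \<in> K'"
  have "\<one> \<otimes> v \<in> B" unfolding B_def
    by (rule lspan_mem[OF V_sub_carrier ks_carrier V_closed(1) V_closed(2)]) (simp add: set_ks v)
  then show "v \<in> B" using v K'_closed(4) by simp
qed

lemma B_pow: "b \<in> B \<Longrightarrow> b [^] (n::nat) \<in> B"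
  by (induction n) (auto intro: B_closed)

text \<open>The map b -> b^Q - b is additive and sends v u, for v in \<open>V\<close> and u in
  \<open>K'\<close>, to (v^Q - v) u, where v^Q - v lies in tV.\<close>

lemma B_frobenius:
  assumes "b \<in> B" shows "\<exists>b'\<in>B. b [^] Q = b \<oplus> t \<otimes> b'"
proof -
  have "\<exists>b'\<in>lspan V us. b [^] Q = b \<oplus> t \<otimes> b'" if "set us \<subseteq> K'" "b \<in> lspan V us" for us b
    using that
  proof (induction us arbitrary: b)
    case Nil
    have "\<zero> [^] Q = \<zero>" using Q_ge_2 by (intro nat_pow_zero) auto
    then show ?case using Nil t_facts by auto
  next
    case (Cons u us)
    then obtain v b1 where b: "b = v \<otimes> u \<oplus> b1" "v \<in> V" "b1 \<in> lspan V us" by auto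
    obtain b2 where b2: "b2 \<in> lspan V us" "b1 [^] Q = b1 \<oplus> t \<otimes> b2" using Cons.IH[OF _ b(3)] Cons.prems by auto
    obtain w where w: "w \<in> V" "v [^] Q \<ominus> v = t \<otimes> w"
      using residue_power[OF b(2), of m] uniformizer_t unfolding uniformizer_def Q_def by blast
    have u: "u \<in> K'" using Cons.prems by auto
    have usc: "set us \<subseteq> carrier R" using Cons.prems K'_closed(4) by auto
    have c: "v \<in> carrier R" "u \<in> carrier R" "b1 \<in> carrier R" "b2 \<in> carrier R" "w \<in> carrier R"
      using b b2 w u K'_closed(4) V_carrier lspan_carrier[OF V_sub_carrier usc] by auto
    have "v [^] Q = (v [^] Q \<ominus> v) \<oplus> v" using c(1) nat_pow_closed[OF c(1), of Q] by algebra
    then have vQ: "v [^] Q = t \<otimes> w \<oplus> v" using w(2) by simp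
    have "b [^] Q = (v \<otimes> u) [^] Q \<oplus> b1 [^] Q" unfolding b(1) using c by (intro Q_add) auto
    also have "(v \<otimes> u) [^] Q = v [^] Q \<otimes> u" using c Q_fixes_K'[OF u] by (simp add: nat_pow_distrib)
    also have "v [^] Q \<otimes> u \<oplus> b1 [^] Q = b \<oplus> t \<otimes> (w \<otimes> u \<oplus> b2)"
      unfolding vQ b2(2) b(1) using c t_facts(4) by algebra
    finally show ?case using lspan_ConsI[OF w(1) b2(1), of u] by blast
  qed
  from this[of ks b] show ?thesis using assms unfolding B_def by (simp add: set_ks)
qed

text \<open>Each coefficient is replaced by one of finitely many representatives modulo
  \<open>t\<close>.\<close>

lemma B_finite_quotient:
  "\<exists>S. finite S \<and> S \<subseteq> B \<and> (\<forall>b\<in>B. \<exists>s\<in>S. \<exists>b'\<in>B. b = s \<oplus> t \<otimes> b')"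
proof -
  obtain T where T: "finite T" "T \<subseteq> V" "\<And>v. v \<in> V \<Longrightarrow> \<exists>s\<in>T. \<exists>w\<in>V. v = s \<oplus> t \<otimes> w"
    using finite_quotients[OF t_facts(2,5)] unfolding finite_quotient_def covers_def by blast
  have "\<exists>s\<in>lspan T us. \<exists>b'\<in>lspan V us. b = s \<oplus> t \<otimes> b'" if "set us \<subseteq> K'" "b \<in> lspan V us" for us b
    using that
  proof (induction us arbitrary: b)
    case Nil
    then show ?case using t_facts by auto
  next
    case (Cons u us)
    then obtain v b1 where b: "b = v \<otimes> u \<oplus> b1" "v \<in> V" "b1 \<in> lspan V us" by auto
    obtain s b2 where b2: "s \<in> lspan T us" "b2 \<in> lspan V us" "b1 = s \<oplus> t \<otimes> b2"
      using Cons.IH[OF _ b(3)] Cons.prems by auto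
    obtain r w where w: "r \<in> T" "w \<in> V" "v = r \<oplus> t \<otimes> w" using T(3)[OF b(2)] by blast
    have usc: "set us \<subseteq> carrier R" using Cons.prems K'_closed(4) by auto
    have c: "r \<in> carrier R" "u \<in> carrier R" "s \<in> carrier R" "b2 \<in> carrier R" "w \<in> carrier R"
      using b2 w T(2) Cons.prems K'_closed(4) V_carrier lspan_carrier[OF V_sub_carrier usc]
        lspan_mono[OF T(2), of us] by auto
    have "b = (r \<otimes> u \<oplus> s) \<oplus> t \<otimes> (w \<otimes> u \<oplus> b2)"
      unfolding b(1) w(3) b2(3) using c t_facts(4) by algebra
    then show ?case using lspan_ConsI[OF w(1) b2(1), of u] lspan_ConsI[OF w(2) b2(2), of u] by blast
  qed
  from this[of ks] have "\<forall>b\<in>B. \<exists>s\<in>lspan T ks. \<exists>b'\<in>B. b = s \<oplus> t \<otimes> b'" unfolding B_def by (simp add: set_ks)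
  moreover have "finite (lspan T ks)" "lspan T ks \<subseteq> B"
    using lspan_finite[OF T(1)] lspan_mono[OF T(2)] unfolding B_def by auto
  ultimately show ?thesis by blast
qed

text \<open>The elements having a power of \<open>t\<close> as denominator form a ring. It contains
  \<open>K'\<close>, and it contains \<open>F\<close>, since an element of \<open>F\<close> outside
  \<open>V\<close> is the inverse of a power of \<open>t\<close> times a unit.\<close>

lemma B_denominator:
  assumes "z \<in> carrier R" shows "\<exists>k. t [^] (k::nat) \<otimes> z \<in> B"
proof -
  let ?W = "{z \<in> carrier R. \<exists>k. t [^] (k::nat) \<otimes> z \<in> B}"
  note Bc = subsetD[OF B_closed(1)]
  have tB: "t [^] (k::nat) \<in> B" for k using V_sub_B V_pow[OF t_facts(2)] by blast
  note tc = Bc[OF tB]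
  have 1: "x \<in> ?W" if "x \<in> B" for x using that Bc[OF that] by (auto intro!: exI[of _ 0])
  have "carrier R \<subseteq> ?W"
  proof (rule carrier_subset_subring)
    show "K' \<subseteq> ?W" using 1 K'_sub_B by blast
    show "F \<subseteq> ?W"
    proof
      fix z assume z: "z \<in> F"
      show "z \<in> ?W"
      proof (cases "z \<in> V")
        case True then show ?thesis using 1 V_sub_B by blast
      next
        case False
        then have i: "inv z \<in> V" "z \<noteq> \<zero>" using inv_nonunit[OF z] nonunits_V by auto
        have zc: "z \<in> carrier R" using z F_carrier by blast
        note iz = inv_facts[OF zc i(2)]
        obtain k u where ku: "u \<in> V - nonunits" "inv z = t [^] (k::nat) \<otimes> u"
          using uniformizer_factorization[OF uniformizer_t i(1) iz(2)] by blast
        have u: "u \<noteq> \<zero>" "inv u \<in> V" "u \<in> carrier R" using unitD ku(1) V_carrier by auto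
        have "(t [^] k \<otimes> z) \<otimes> u = z \<otimes> inv z" unfolding ku(2) using zc tc u by (simp add: m_ac)
        then have "(t [^] k \<otimes> z) \<otimes> u = \<one>" using iz by simp
        then have "t [^] k \<otimes> z = inv u" using cancel_inv(6)[OF u(3,1), of "t [^] k \<otimes> z"] zc tc u inv_facts[OF u(3,1)] by simp
        then have "t [^] k \<otimes> z \<in> B" using u(2) V_sub_B by auto
        then show ?thesis using zc by blast
      qed
    qed
    show "subring ?W R"
    proof (rule subringI)
      show "\<one> \<in> ?W" using 1 B_closed(3) by blast
      show "\<ominus> x \<in> ?W" if x: "x \<in> ?W" for x
      proof -
        obtain k where k: "x \<in> carrier R" "t [^] (k::nat) \<otimes> x \<in> B" using x by blast
        have "t [^] k \<otimes> \<ominus> x = \<ominus> (t [^] k \<otimes> x)" using k tc by (simp add: r_minus)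
        then have "t [^] k \<otimes> \<ominus> x \<in> B" using k B_closed(5) by simp
        then show ?thesis using k(1) by blast
      qed
      fix x y assume "x \<in> ?W" "y \<in> ?W"
      then obtain k l where kl: "x \<in> carrier R" "t [^] (k::nat) \<otimes> x \<in> B"
        "y \<in> carrier R" "t [^] (l::nat) \<otimes> y \<in> B" by blast
      have p: "t [^] (k + l) = t [^] k \<otimes> t [^] l" using t_facts(4) by (simp add: nat_pow_mult)
      have "t [^] (k + l) \<otimes> (x \<otimes> y) = (t [^] k \<otimes> x) \<otimes> (t [^] l \<otimes> y)"
        unfolding p using kl tc by (simp add: m_ac)
      then show "x \<otimes> y \<in> ?W" using kl B_closed(6) by (metis (mono_tags, lifting) m_closed mem_Collect_eq)
      have "t [^] (k + l) \<otimes> (x \<oplus> y) = t [^] l \<otimes> (t [^] k \<otimes> x) \<oplus> t [^] k \<otimes> (t [^] l \<otimes> y)"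
        unfolding p using kl tc by (simp add: r_distr m_ac)
      then have "t [^] (k + l) \<otimes> (x \<oplus> y) \<in> B" using kl tB B_closed(6,7) by metis
      then show "x \<oplus> y \<in> ?W" using kl by blast
    qed auto
  qed
  then show ?thesis using assms by blast
qed

end

section \<open>A valuation ring V' of F K' above V\<close>

locale place_above = lower_place R K F K' m V t
  for R (structure) and K F K' m V t +
  fixes V'
  assumes V'_ring: "valuation_ring R K' (carrier R) V'" and V_restrict: "V = V' \<inter> F"
begin

sublocale up: valuation R "carrier R" V'
  by (rule valuation_upper[OF V'_ring])

lemma V_sub_V': "V \<subseteq> V'" and K'_sub_V': "K' \<subseteq> V'"
  using V_restrict V'_ring by (auto simp: valuation_ring_def)

lemma B_sub_V': "B \<subseteq> V'"
proof -
  have "x \<in> V'" if "set us \<subseteq> K'" "x \<in> lspan V us" for us x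
    using that
  proof (induction us arbitrary: x)
    case Nil then show ?case using up.V_closed(1) by simp
  next
    case (Cons u us)
    then obtain a y where x: "x = a \<otimes> u \<oplus> y" "a \<in> V" "y \<in> lspan V us" by auto
    then have "a \<in> V'" "u \<in> V'" "y \<in> V'" using Cons V_sub_V' K'_sub_V' by auto
    then show ?case unfolding x(1) by (intro up.V_closed)
  qed
  then show ?thesis unfolding B_def using set_ks by auto
qed

lemma nonunits_restrict: "nonunits = up.nonunits \<inter> F"
  unfolding nonunits_def up.nonunits_def using V_restrict F_closed(6) by auto

lemma t_nonunit: "t \<in> up.nonunits" using t_facts(1) nonunits_restrict by blast

lemma t_pow: "t [^] (k::nat) \<in> V'" "t [^] (k::nat) \<in> carrier R" "t [^] (k::nat) \<noteq> \<zero>"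
  using V_pow[OF t_facts(2)] V_sub_V' V_carrier pow_nonzero t_facts by blast+

text \<open>
  If \<open>b\<close> is a nonunit above, then \<open>b (b\<^sup>Q\<^sup>-\<^sup>1 - 1) = t b'\<close> with \<open>b'\<close> in \<open>B\<close>, and the second factor on
  the left is a unit. Continuing with \<open>b'\<close> terminates because \<open>b\<close> divides a power of \<open>t\<close>.
\<close>

lemma B_reduction:
  assumes "b \<in> B" "b \<noteq> \<zero>"
  shows "\<exists>j e b1. e \<in> B - up.nonunits \<and> b1 \<in> B - up.nonunits \<and> b \<otimes> e = t [^] (j::nat) \<otimes> b1"
proof -
  note Bc = subsetD[OF B_closed(1)]
  have base: "\<exists>j e b1. e \<in> B - up.nonunits \<and> b1 \<in> B - up.nonunits \<and> b \<otimes> e = t [^] (j::nat) \<otimes> b1"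
    if "b \<in> B" "b \<notin> up.nonunits" for b
  proof -
    have "\<one> \<in> B - up.nonunits" using B_closed(3) up.one_not_nonunit by blast
    moreover have "b \<otimes> \<one> = t [^] (0::nat) \<otimes> b" using Bc[OF that(1)] by simp
    ultimately show ?thesis using that by blast
  qed
  \<comment> \<open>The exponent \<open>n\<close> of a power of \<open>t\<close> that
    \<open>b\<close> divides in \<open>V'\<close> is the induction measure; passing from
    \<open>b\<close> to \<open>b'\<close> lowers it by one.\<close>
  have "\<exists>j e b1. e \<in> B - up.nonunits \<and> b1 \<in> B - up.nonunits \<and> b \<otimes> e = t [^] (j::nat) \<otimes> b1"
    if "b \<in> B" "b \<noteq> \<zero>" "w \<in> V'" "t [^] (n::nat) = b \<otimes> w" for n b w
    using that
  proof (induction n arbitrary: b w)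
    case 0
    have "b \<otimes> w = \<one>" using 0(4) by simp
    then have "b \<notin> up.nonunits" using up.nonunits_mult[OF _ 0(3), of b] up.one_not_nonunit by metis
    then show ?case using base[OF 0(1)] by blast
  next
    case (Suc n)
    show ?case
    proof (cases "b \<in> up.nonunits")
      case False
      then show ?thesis using base[OF Suc.prems(1)] by blast
    next
      case True
      obtain b' where b': "b' \<in> B" "b [^] Q = b \<oplus> t \<otimes> b'" using B_frobenius[OF Suc.prems(1)] by blast
      have c: "b \<in> carrier R" "b' \<in> carrier R" "w \<in> carrier R" "t \<in> carrier R"
        using Bc b' Suc.prems up.V_carrier t_facts by auto
      define e where "e = b [^] (Q - 1) \<ominus> \<one>"
      have bp: "b [^] (Q - 1) \<in> up.nonunits" using up.nonunit_pow[OF True] Q_ge_2 by simp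
      have bpc: "b [^] (Q - 1) \<in> carrier R" using c by simp
      have eB: "e \<in> B" unfolding e_def minus_eq using B_pow[OF Suc.prems(1)] B_closed by auto
      have eneg: "e = \<ominus> (\<one> \<ominus> b [^] (Q - 1))" unfolding e_def using bpc by algebra
      have eu: "e \<notin> up.nonunits"
      proof
        assume "e \<in> up.nonunits"
        then have "\<ominus> e \<in> up.nonunits" by blast
        then show False using up.one_minus_unit[OF bp] bpc unfolding eneg by simp
      qed
      have ec: "e \<in> carrier R" using eB Bc by blast
      have "b [^] Suc (Q - 1) = b [^] (Q - 1) \<otimes> b" by simp
      moreover have "Suc (Q - 1) = Q" using Q_ge_2 by simp
      ultimately have bQ: "b [^] Q = b [^] (Q - 1) \<otimes> b" by simp
      have "b \<otimes> e = b [^] (Q - 1) \<otimes> b \<ominus> b" unfolding e_def using c bpc by algebra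
      also have "\<dots> = (b \<oplus> t \<otimes> b') \<ominus> b" using bQ b'(2) by simp
      also have "\<dots> = t \<otimes> b'" using c by algebra
      finally have be: "b \<otimes> e = t \<otimes> b'" .
      have e0: "e \<noteq> \<zero>" using eu up.zero_nonunit by blast
      have "b \<otimes> e \<noteq> \<zero>" using c ec e0 Suc.prems(2) integral by blast
      then have b'0: "b' \<noteq> \<zero>" using be c by auto
      have ei: "inv e \<in> V'" using up.unitD(2)[OF _ eu] eB B_sub_V' by blast
      note ie = inv_facts[OF ec e0]
      have "t \<otimes> (b' \<otimes> w) = (b \<otimes> e) \<otimes> w" using be c by (simp add: m_assoc)
      also have "\<dots> = (b \<otimes> w) \<otimes> e" using c ec by (simp add: m_ac)
      also have "\<dots> = t \<otimes> (t [^] n \<otimes> e)" unfolding Suc.prems(4)[symmetric] using c t_pow(2)[of n] ec by (simp add: m_ac)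
      finally have "b' \<otimes> w = t [^] n \<otimes> e"
        using m_lcancel[OF t_facts(5,4), of "b' \<otimes> w" "t [^] n \<otimes> e"] c ec t_pow(2)[of n] by simp
      then have "(b' \<otimes> w) \<otimes> inv e = t [^] n" using ec e0 t_pow(2)[of n] by (simp add: cancel_inv)
      then have tn: "t [^] n = b' \<otimes> (w \<otimes> inv e)" using c ie by (simp add: m_assoc)
      obtain j e' b1 where IH: "e' \<in> B - up.nonunits" "b1 \<in> B - up.nonunits" "b' \<otimes> e' = t [^] (j::nat) \<otimes> b1"
        using Suc.IH[OF b'(1) b'0 up.V_closed(4)[OF Suc.prems(3) ei] tn] by blast
      have c': "e' \<in> carrier R" "b1 \<in> carrier R" using IH Bc by auto
      have "b \<otimes> (e \<otimes> e') = t \<otimes> (b' \<otimes> e')" using be c ec c' by (simp add: m_assoc[symmetric])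
      also have "\<dots> = t [^] Suc j \<otimes> b1" unfolding IH(3) using c c' t_pow(2)[of j] by (simp add: m_ac)
      finally have "b \<otimes> (e \<otimes> e') = t [^] Suc j \<otimes> b1" .
      moreover have "e \<otimes> e' \<in> B - up.nonunits"
        using up.unit_mult[of e e'] eB eu IH(1) B_sub_V' B_closed(6) by auto
      ultimately show ?thesis using IH(2) by blast
    qed
  qed
  moreover have bc: "b \<in> carrier R" using assms Bc by blast
  note ib = inv_facts[OF bc assms(2)]
  \<comment> \<open>A power of \<open>t\<close> clears the denominator of 1/b, so \<open>b\<close>
    divides that power within \<open>V'\<close>.\<close>
  obtain n where n: "t [^] (n::nat) \<otimes> inv b \<in> B" using B_denominator[OF ib(1)] by blast
  moreover have "t [^] n = b \<otimes> (t [^] n \<otimes> inv b)" using bc assms(2) t_pow(2)[of n] by (simp add: cancel_inv)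
  ultimately show ?thesis using assms B_sub_V' by blast
qed

text \<open>A power t^k first moves \<open>z\<close> into \<open>B\<close>. As \<open>z\<close> lies
  in \<open>V'\<close>, the exponent reached there is at least k; otherwise \<open>b1\<close> would
  be a multiple of \<open>t\<close>.\<close>

lemma upper_reduction:
  assumes z: "z \<in> V'" "z \<noteq> \<zero>"
  shows "\<exists>j e b1. e \<in> B - up.nonunits \<and> b1 \<in> B - up.nonunits \<and> z \<otimes> e = t [^] (j::nat) \<otimes> b1"
proof -
  note Bc = subsetD[OF B_closed(1)]
  have zc: "z \<in> carrier R" using z up.V_carrier by blast
  obtain k where k: "t [^] (k::nat) \<otimes> z \<in> B" using B_denominator[OF zc] by blast
  have "t [^] k \<otimes> z \<noteq> \<zero>" using z zc t_pow integral by blast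
  from B_reduction[OF k this] obtain j e b1 where
    *: "e \<in> B - up.nonunits" "b1 \<in> B - up.nonunits" "(t [^] k \<otimes> z) \<otimes> e = t [^] (j::nat) \<otimes> b1" by blast
  have c: "e \<in> carrier R" "b1 \<in> carrier R" using * Bc by auto
  have eV: "e \<in> V'" using * B_sub_V' by blast
  show ?thesis
  proof (cases "k \<le> j")
    case True
    then have "t [^] j = t [^] k \<otimes> t [^] (j - k)" using t_facts(4) by (simp add: nat_pow_mult)
    then have "t [^] k \<otimes> (z \<otimes> e) = t [^] k \<otimes> (t [^] (j - k) \<otimes> b1)"
      using *(3) c zc t_pow(2)[of k] t_pow(2)[of "j - k"] by (simp add: m_assoc)
    then have "z \<otimes> e = t [^] (j - k) \<otimes> b1"
      using m_lcancel[OF t_pow(3)[of k] t_pow(2)[of k], of "z \<otimes> e" "t [^] (j - k) \<otimes> b1"] c zc t_pow(2)[of "j - k"] by simp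
    then show ?thesis using *(1,2) by blast
  next
    case False
    then have "t [^] k = t [^] j \<otimes> t [^] (k - j)" using t_facts(4) by (simp add: nat_pow_mult)
    then have "t [^] j \<otimes> (t [^] (k - j) \<otimes> (z \<otimes> e)) = t [^] j \<otimes> b1"
      using *(3) c zc t_pow(2)[of j] t_pow(2)[of "k - j"] by (simp add: m_assoc)
    then have "t [^] (k - j) \<otimes> (z \<otimes> e) = b1"
      using m_lcancel[OF t_pow(3)[of j] t_pow(2)[of j], of "t [^] (k - j) \<otimes> (z \<otimes> e)" b1] c zc t_pow(2)[of "k - j"] by simp
    moreover have "t [^] (k - j) \<in> up.nonunits" using up.nonunit_pow[OF t_nonunit] False by simp
    ultimately have "b1 \<in> up.nonunits" using up.nonunits_mult up.V_closed(4)[OF z(1) eV] by blast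
    then show ?thesis using *(2) by blast
  qed
qed

lemma upper_factorization:
  assumes z: "z \<in> V'" "z \<noteq> \<zero>"
  shows "\<exists>j u. u \<in> V' - up.nonunits \<and> z = t [^] (j::nat) \<otimes> u"
proof -
  obtain j e b1 where *: "e \<in> B - up.nonunits" "b1 \<in> B - up.nonunits" "z \<otimes> e = t [^] (j::nat) \<otimes> b1"
    using upper_reduction[OF z] by blast
  have u: "e \<in> V' - up.nonunits" "b1 \<in> V' - up.nonunits" using * B_sub_V' by auto
  have c: "e \<in> carrier R" "b1 \<in> carrier R" "z \<in> carrier R" using u z up.V_carrier by auto
  have e0: "e \<noteq> \<zero>" using u up.zero_nonunit by blast
  note ie = inv_facts[OF c(1) e0]
  have "z = (z \<otimes> e) \<otimes> inv e" using c e0 by (simp add: cancel_inv)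
  also have "\<dots> = t [^] j \<otimes> (b1 \<otimes> inv e)" unfolding *(3) using c ie t_pow(2)[of j] by (simp add: m_assoc)
  finally show ?thesis using up.unit_mult[OF u(2) up.unit_inv[OF u(1)]] by blast
qed

text \<open>This is unramifiedness: the same \<open>t\<close> normalizes the valuations below and
  above, as \<open>conorm\<close> presupposes.\<close>

lemma upper_uniformizer: "up.uniformizer t"
  unfolding up.uniformizer_def
proof (intro conjI ballI)
  show "t \<in> up.nonunits" "t \<noteq> \<zero>" using t_nonunit t_facts by auto
  fix z assume z: "z \<in> up.nonunits"
  then have zV: "z \<in> V'" by (rule up.nonunits_V)
  show "\<exists>w\<in>V'. z = t \<otimes> w"
  proof (cases "z = \<zero>")
    case True then show ?thesis using up.V_closed(1) t_facts by (intro bexI[of _ \<zero>]) auto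
  next
    case False
    obtain j u where u: "u \<in> V' - up.nonunits" "z = t [^] (j::nat) \<otimes> u"
      using upper_factorization[OF zV False] by blast
    have uc: "u \<in> carrier R" using u up.V_carrier by blast
    have "j \<noteq> 0" using u z uc by (intro notI) simp
    then obtain i where i: "j = Suc i" using not0_implies_Suc by blast
    have "z = t \<otimes> (t [^] i \<otimes> u)" unfolding u(2) i using uc t_pow(2)[of i] t_facts(4) by (simp add: m_ac)
    then show ?thesis using up.V_closed(4)[OF t_pow(1)] u(1) by blast
  qed
qed

text \<open>\<open>V'\<close> is the localization of \<open>B\<close> at the trace of its maximal
  ideal and is therefore determined by that trace. Counting rings becomes counting traces.\<close>

lemma upper_eq_localization:
  "V' = {z \<in> carrier R. \<exists>e\<in>B - (up.nonunits \<inter> B). z \<otimes> e \<in> B}"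
proof (intro equalityI subsetI)
  fix z assume z: "z \<in> V'"
  then have zc: "z \<in> carrier R" by (rule up.V_carrier)
  show "z \<in> {z \<in> carrier R. \<exists>e\<in>B - (up.nonunits \<inter> B). z \<otimes> e \<in> B}"
  proof (cases "z = \<zero>")
    case True
    have "\<one> \<in> B - (up.nonunits \<inter> B)" using B_closed(3) up.one_not_nonunit by blast
    moreover have "z \<otimes> \<one> \<in> B" using True B_closed(2) by simp
    ultimately show ?thesis using zc by blast
  next
    case False
    obtain j e b1 where *: "e \<in> B - up.nonunits" "b1 \<in> B - up.nonunits" "z \<otimes> e = t [^] (j::nat) \<otimes> b1"
      using upper_reduction[OF z False] by blast
    have "t [^] j \<in> B" using V_sub_B V_pow[OF t_facts(2)] by blast
    then have "z \<otimes> e \<in> B" using * B_closed(6) by auto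
    then show ?thesis using * zc by blast
  qed
next
  fix z assume "z \<in> {z \<in> carrier R. \<exists>e\<in>B - (up.nonunits \<inter> B). z \<otimes> e \<in> B}"
  then obtain e where z: "z \<in> carrier R" "e \<in> B" "e \<notin> up.nonunits" "z \<otimes> e \<in> B" by blast
  have e: "e \<in> V'" "e \<in> carrier R" "e \<noteq> \<zero>" using z B_sub_V' up.V_carrier up.zero_nonunit by auto
  have "(z \<otimes> e) \<otimes> inv e \<in> V'" using up.V_closed(4) up.unitD(2)[OF e(1) z(3)] z(4) B_sub_V' by blast
  then show "z \<in> V'" using z e by (simp add: cancel_inv)
qed

end

context lower_place begin

text \<open>\<open>t\<close> lies in every maximal ideal above, so its trace on \<open>B\<close> is
  a union of classes modulo \<open>t\<close> and is fixed by its intersection with a finite set of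
  representatives.\<close>

lemma finite_places_above:
  "finite {V'. valuation_ring R K' (carrier R) V' \<and> V = V' \<inter> F}" (is "finite ?W")
proof -
  obtain S where S: "finite S" "S \<subseteq> B" "\<And>b. b \<in> B \<Longrightarrow> \<exists>s\<in>S. \<exists>b'\<in>B. b = s \<oplus> t \<otimes> b'"
    using B_finite_quotient by blast
  define M where "M V' = valuation.nonunits R V'" for V'
  have pa: "place_above R K F K' m V t V'" if "V' \<in> ?W" for V'
    using that by unfold_locales auto
  have "inj_on (\<lambda>V'. M V' \<inter> S) ?W"
  proof (rule inj_onI)
    fix V1 V2 assume V: "V1 \<in> ?W" "V2 \<in> ?W" and eq: "M V1 \<inter> S = M V2 \<inter> S"
    interpret v1: place_above R K F K' m V t V1 by (rule pa[OF V(1)])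
    interpret v2: place_above R K F K' m V t V2 by (rule pa[OF V(2)])
    have mem: "s \<oplus> t \<otimes> b' \<in> valuation.nonunits R V' \<longleftrightarrow> s \<in> valuation.nonunits R V'"
      if "place_above R K F K' m V t V'" "s \<in> B" "b' \<in> B" for V' s b'
    proof -
      interpret v: place_above R K F K' m V t V' by fact
      have tb: "t \<otimes> b' \<in> v.up.nonunits" using v.t_nonunit v.B_sub_V' that(3) by blast
      have c: "s \<in> carrier R" "t \<otimes> b' \<in> carrier R" using that B_closed(1) t_facts(4) by auto
      have "s = (s \<oplus> t \<otimes> b') \<ominus> t \<otimes> b'" using c by algebra
      then show ?thesis using tb v.up.nonunits_add v.up.nonunits_minus by metis
    qed
    have "M V1 \<inter> B = M V2 \<inter> B"
    proof -
      have "b \<in> M V1 \<longleftrightarrow> b \<in> M V2" if b: "b \<in> B" for b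
      proof -
        obtain s b' where s: "s \<in> S" "b' \<in> B" "b = s \<oplus> t \<otimes> b'" using S(3)[OF b] by blast
        have sB: "s \<in> B" using s S(2) by blast
        have "b \<in> M V1 \<longleftrightarrow> s \<in> M V1" "b \<in> M V2 \<longleftrightarrow> s \<in> M V2"
          unfolding M_def s(3) using mem[OF pa[OF V(1)] sB s(2)] mem[OF pa[OF V(2)] sB s(2)] by auto
        then show ?thesis using eq s(1) by blast
      qed
      then show ?thesis by blast
    qed
    then show "V1 = V2"
      using v1.upper_eq_localization v2.upper_eq_localization unfolding M_def by simp
  qed
  moreover have "(\<lambda>V'. M V' \<inter> S) ` ?W \<subseteq> Pow S" by blast
  ultimately show ?thesis using S(1) by (meson finite_Pow_iff finite_imageD finite_subset)
qed

end

section \<open>Places, divisors and values\<close>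

context valuation begin

lemma nat_exponent_unique:
  assumes t: "t \<in> nonunits" "t \<noteq> \<zero>" and u: "u \<in> V - nonunits" "u' \<in> V - nonunits"
    and eq: "t [^] (a::nat) \<otimes> u = t [^] (b::nat) \<otimes> u'"
  shows "a = b"
proof -
  have tc: "t \<in> carrier R" using t nonunits_V V_carrier by blast
  have no: False if "u \<in> V - nonunits" "u' \<in> V - nonunits" "t [^] a \<otimes> u = t [^] b \<otimes> u'" "a < b"
    for u u' and a b :: nat
  proof -
    have c: "u \<in> carrier R" "u' \<in> carrier R" using that V_carrier by auto
    have "t [^] b = t [^] a \<otimes> t [^] (b - a)" using that(4) tc by (simp add: nat_pow_mult)
    then have "t [^] a \<otimes> u = t [^] a \<otimes> (t [^] (b - a) \<otimes> u')" using that(3) c tc by (simp add: m_assoc)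
    then have "u = t [^] (b - a) \<otimes> u'"
      using m_lcancel[OF pow_nonzero[OF tc t(2), of a], of u "t [^] (b - a) \<otimes> u'"] c tc by simp
    moreover have "t [^] (b - a) \<in> nonunits" using nonunit_pow[OF t(1)] that(4) by simp
    ultimately show False using nonunits_mult[of "t [^] (b - a)" u'] that(1,2) by blast
  qed
  show ?thesis using no[OF u eq] no[OF u(2,1) eq[symmetric]] by (meson linorder_neqE_nat)
qed

lemma uniformizer_associated:
  assumes "uniformizer t" "uniformizer t'" shows "\<exists>w\<in>V - nonunits. t' = t \<otimes> w"
proof -
  obtain w where w: "w \<in> V" "t' = t \<otimes> w" using assms unfolding uniformizer_def by blast
  obtain w' where w': "w' \<in> V" "t = t' \<otimes> w'" using assms unfolding uniformizer_def by blast
  have t: "t \<in> nonunits" "t \<noteq> \<zero>" using assms(1) unfolding uniformizer_def by blast+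
  have c: "t \<in> carrier R" "w \<in> carrier R" "w' \<in> carrier R"
    using V_carrier[OF nonunits_V[OF t(1)]] V_carrier[OF w(1)] V_carrier[OF w'(1)] .
  have "t = (t \<otimes> w) \<otimes> w'" using w'(2) unfolding w(2) .
  then have "t \<otimes> \<one> = t \<otimes> (w \<otimes> w')" unfolding m_assoc[OF c] r_one[OF c(1)] .
  from iffD1[OF m_lcancel[OF t(2) c(1) one_closed m_closed[OF c(2,3)]] this]
  have "w \<notin> nonunits" using nonunits_mult[of w w'] w'(1) one_not_nonunit by metis
  then show ?thesis using w by blast
qed

text \<open>One of \<open>nat i\<close> and \<open>nat (- i)\<close> is zero. Multiplication by
  \<open>t [^] nat (- i)\<close> turns equations with integer exponents into equations with natural
  ones.\<close>

lemma int_pow_cross: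
  assumes "t \<in> carrier R" "t \<noteq> \<zero>"
  shows "t [^] (i::int) \<in> carrier R" "t [^] i \<otimes> t [^] (nat (- i)) = t [^] (nat i)"
proof -
  note p = pow_nonzero[OF assms, of "nat (- i)"] nat_pow_closed[OF assms(1), of "nat (- i)"]
  note ip = inv_facts[OF p(2,1)]
  have "t [^] i \<in> carrier R \<and> t [^] i \<otimes> t [^] (nat (- i)) = t [^] (nat i)"
  proof (cases "i < 0")
    case True
    then have "t [^] i = inv (t [^] nat (- i))" by (simp only: int_pow_def2 if_True)
    then show ?thesis using ip True by simp
  next
    case False
    then have "t [^] i = t [^] nat i" by (simp only: int_pow_def2 if_False)
    moreover have "nat (- i) = 0" using False by simp
    moreover have "t [^] nat i \<in> carrier R" by (rule nat_pow_closed[OF assms(1)])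
    ultimately show ?thesis by (simp only: nat_pow_0 r_one simp_thms)
  qed
  then show "t [^] i \<in> carrier R" "t [^] i \<otimes> t [^] (nat (- i)) = t [^] (nat i)" by blast+
qed

text \<open>Two different uniformizers are allowed, because \<open>place_val\<close> quantifies over
  the generator for each candidate exponent.\<close>

lemma exponent_unique:
  assumes t: "uniformizer t" "uniformizer t'" and u: "u \<in> V - nonunits" "u' \<in> V - nonunits"
    and eq: "t [^] (i::int) \<otimes> u = t' [^] (i'::int) \<otimes> u'"
  shows "i = i'"
proof -
  obtain w where w: "w \<in> V - nonunits" "t' = t \<otimes> w" using uniformizer_associated[OF t] by blast
  have tc: "t \<in> nonunits" "t \<noteq> \<zero>" "t' \<noteq> \<zero>" "t \<in> carrier R" "t' \<in> carrier R"
    using t nonunits_V V_carrier unfolding uniformizer_def by auto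
  have c: "u \<in> carrier R" "u' \<in> carrier R" "w \<in> carrier R" using u w V_carrier by auto
  define f where "f = t [^] i \<otimes> u"
  note ip = int_pow_cross[OF tc(4,2), of i] int_pow_cross[OF tc(5,3), of i']
  have fc: "f \<in> carrier R" unfolding f_def using ip c by auto
  have f1: "f \<otimes> t [^] nat (- i) = t [^] nat i \<otimes> u"
    unfolding f_def ip(2)[symmetric] using ip(1) c tc by (simp add: m_ac)
  have "f \<otimes> t' [^] nat (- i') = t' [^] nat i' \<otimes> u'"
    unfolding f_def eq ip(4)[symmetric] using ip(3) c tc by (simp add: m_ac)
  then have f2: "f \<otimes> (t [^] nat (- i') \<otimes> w [^] nat (- i')) = (t [^] nat i' \<otimes> w [^] nat i') \<otimes> u'"
    unfolding w(2) using tc c by (simp add: nat_pow_distrib)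
  define p n p' n' where "p = nat i" and "n = nat (- i)" and "p' = nat i'" and "n' = nat (- i')"
  note f1 = f1[folded p_def n_def] and f2 = f2[folded p'_def n'_def]
  have pc: "t [^] k \<in> carrier R" "w [^] k \<in> carrier R" for k :: nat using tc c by auto
  have "t [^] (p + n') \<otimes> (u \<otimes> w [^] n') = (t [^] p \<otimes> u) \<otimes> (t [^] n' \<otimes> w [^] n')"
    using pc c tc(4) by (simp add: nat_pow_mult[symmetric] m_ac)
  also have "\<dots> = (f \<otimes> (t [^] n' \<otimes> w [^] n')) \<otimes> t [^] n"
    unfolding f1[symmetric] using pc fc by (simp add: m_ac)
  also have "\<dots> = t [^] (p' + n) \<otimes> (w [^] p' \<otimes> u')"
    unfolding f2 using pc c tc(4) by (simp add: nat_pow_mult[symmetric] m_ac)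
  finally have "p + n' = p' + n"
    by (rule nat_exponent_unique[OF tc(1,2) unit_mult[OF u(1) unit_pow[OF w(1)]]
          unit_mult[OF unit_pow[OF w(1)] u(2)]])
  then show ?thesis unfolding p_def n_def p'_def n'_def by linarith
qed

end

lemma (in field) place_ring_nonunits:
  assumes "valuation_ring R k E V" "subfield E R"
  shows "place_ring R k E (valuation.nonunits R V) = R\<lparr>carrier := V\<rparr>"
proof -
  note val = valuation_if_ring[OF _ assms(2)]
  interpret v: valuation R E V by (rule val[OF assms(1)])
  have "(THE W. valuation_ring R k E W \<and> maximalideal v.nonunits (R\<lparr>carrier := W\<rparr>)) = V"
  proof (rule the_equality)
    show "valuation_ring R k E V \<and> maximalideal v.nonunits (R\<lparr>carrier := V\<rparr>)"
      using assms(1) v.nonunits_maximal by blast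
    fix W assume W: "valuation_ring R k E W \<and> maximalideal v.nonunits (R\<lparr>carrier := W\<rparr>)"
    interpret w: valuation R E W by (rule val) (rule conjunct1[OF W])
    have "v.nonunits = w.nonunits" using W w.maximalideal_iff by blast
    then show "W = V" using v.V_eq w.V_eq by simp
  qed
  then show ?thesis unfolding place_ring_def by simp
qed

lemma (in field) places_iff:
  assumes "subfield E R"
  shows "P \<in> places R k E \<longleftrightarrow> (\<exists>V. valuation_ring R k E V \<and> P = valuation.nonunits R V)"
proof -
  have "maximalideal P (R\<lparr>carrier := V\<rparr>) \<longleftrightarrow> P = valuation.nonunits R V" if "valuation_ring R k E V" for V
    by (rule valuation.maximalideal_iff[OF valuation_if_ring[OF that assms]])
  then show ?thesis unfolding places_def by blast
qed

context valuation begin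

text \<open>A nonzero nonunit rules out that the ideal is generated by zero.\<close>

lemma PIdl_uniformizer:
  assumes "\<exists>z\<in>nonunits. z \<noteq> \<zero>" "t \<in> V"
  shows "nonunits = PIdl\<^bsub>VR\<^esub> t \<longleftrightarrow> uniformizer t"
proof -
  have pi: "PIdl\<^bsub>VR\<^esub> t = {x \<otimes> t | x. x \<in> V}" unfolding cgenideal_def by simp
  have tc: "t \<in> carrier R" using assms(2) V_carrier by blast
  show ?thesis
  proof
    assume eq: "nonunits = PIdl\<^bsub>VR\<^esub> t"
    have "\<one> \<otimes> t \<in> PIdl\<^bsub>VR\<^esub> t" unfolding pi using V_closed(2) by blast
    then have "t \<in> nonunits" using eq tc by simp
    moreover have "t \<noteq> \<zero>"
    proof
      assume "t = \<zero>"
      then have "PIdl\<^bsub>VR\<^esub> t \<subseteq> {\<zero>}" unfolding pi using V_carrier by auto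
      then show False using assms(1) eq by blast
    qed
    moreover have "\<exists>w\<in>V. z = t \<otimes> w" if z: "z \<in> nonunits" for z
    proof -
      have "z \<in> PIdl\<^bsub>VR\<^esub> t" using z eq by simp
      then obtain x where "x \<in> V" "z = x \<otimes> t" unfolding pi by blast
      then show ?thesis using m_comm tc V_carrier by metis
    qed
    ultimately show "uniformizer t" unfolding uniformizer_def by blast
  next
    assume u: "uniformizer t"
    show "nonunits = PIdl\<^bsub>VR\<^esub> t"
      unfolding pi
    proof (intro equalityI subsetI)
      fix z assume "z \<in> nonunits"
      then obtain w where "w \<in> V" "z = t \<otimes> w" using u unfolding uniformizer_def by blast
      moreover from this have "z = w \<otimes> t" using m_comm tc V_carrier by metis
      ultimately show "z \<in> {x \<otimes> t | x. x \<in> V}" by blast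
    next
      fix z assume "z \<in> {x \<otimes> t | x. x \<in> V}"
      then show "z \<in> nonunits" using u unfolding uniformizer_def by blast
    qed
  qed
qed

lemma Units_VR: "Units VR = V - nonunits"
proof (intro equalityI subsetI)
  fix u assume "u \<in> Units VR"
  then obtain v where v: "u \<in> V" "v \<in> V" "u \<otimes> v = \<one>" by (auto simp: Units_def)
  then show "u \<in> V - nonunits" using nonunits_mult[of u v] one_not_nonunit by auto
next
  fix u assume u: "u \<in> V - nonunits"
  note i = unitD[of u]
  have "u \<in> carrier R" using u V_carrier by blast
  then show "u \<in> Units VR" using u i inv_facts[of u] by (auto simp: Units_def)
qed

lemma place_val_eq:
  assumes V: "valuation_ring R k F V" and t: "uniformizer t" and u: "u \<in> V - nonunits"
  shows "place_val R k F nonunits (t [^] (i::int) \<otimes> u) = i"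
proof -
  have ne: "\<exists>z\<in>nonunits. z \<noteq> \<zero>" using t unfolding uniformizer_def by blast
  have tV: "t \<in> V" using t nonunits_V unfolding uniformizer_def by blast
  show ?thesis
    unfolding place_val_def place_ring_nonunits[OF V subfield_F]
  proof (rule the_equality)
    show "\<exists>t'\<in>carrier VR. \<exists>u'\<in>Units VR. nonunits = PIdl\<^bsub>VR\<^esub> t' \<and> t [^] i \<otimes> u = t' [^] i \<otimes> u'"
      using PIdl_uniformizer[OF ne tV] t u Units_VR tV by auto
    fix j :: int assume "\<exists>t'\<in>carrier VR. \<exists>u'\<in>Units VR. nonunits = PIdl\<^bsub>VR\<^esub> t' \<and> t [^] i \<otimes> u = t' [^] j \<otimes> u'"
    then obtain t' u' where *: "t' \<in> V" "u' \<in> V - nonunits" "nonunits = PIdl\<^bsub>VR\<^esub> t'" "t [^] i \<otimes> u = t' [^] j \<otimes> u'"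
      using Units_VR by auto
    then have "uniformizer t'" using PIdl_uniformizer[OF ne] by blast
    from exponent_unique[OF t this u *(2,4)] show "j = i" by simp
  qed
qed

end

lemma (in discrete_valuation) int_factorization:
  assumes t: "uniformizer t" and z: "z \<in> F" "z \<noteq> \<zero>"
  shows "\<exists>i u. u \<in> V - nonunits \<and> z = t [^] (i::int) \<otimes> u"
proof (cases "z \<in> V")
  case True
  then show ?thesis using uniformizer_factorization[OF t True z(2)] by (metis int_pow_int)
next
  case False
  have zc: "z \<in> carrier R" using z F_carrier by blast
  have i: "inv z \<in> V" using inv_nonunit[OF z(1) False] nonunits_V by blast
  note iz = inv_facts[OF zc z(2)]
  obtain k u where ku: "u \<in> V - nonunits" "inv z = t [^] (k::nat) \<otimes> u"
    using uniformizer_factorization[OF t i iz(2)] by blast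
  have tc: "t \<in> carrier R" "t \<noteq> \<zero>" using t nonunits_V V_carrier unfolding uniformizer_def by auto
  have uc: "u \<in> carrier R" "u \<noteq> \<zero>" using ku V_carrier unitD by auto
  have "z = inv (t [^] k \<otimes> u)" using iz ku(2) by simp
  also have "\<dots> = inv (t [^] k) \<otimes> inv u" using inv_mult[OF _ pow_nonzero[OF tc] uc] tc by simp
  also have "inv (t [^] k) = t [^] (- int k)" unfolding int_pow_def2 by simp
  finally show ?thesis using unit_inv[OF ku(1)] by blast
qed

section \<open>Restriction of places and the conorm\<close>

context constant_extension begin

lemma lower_place_exists:
  assumes "valuation_ring R K F V" shows "\<exists>t. lower_place R K F K' m V t"
proof -
  interpret discrete_valuation R F V by (rule discrete_lower[OF assms])
  obtain t where "uniformizer t" using uniformizer_exists by blast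
  moreover have "K \<subseteq> V" using assms by (auto simp: valuation_ring_def)
  ultimately have "lower_place R K F K' m V t" by unfold_locales
  then show ?thesis by blast
qed

lemma place_above_exists:
  assumes "valuation_ring R K' (carrier R) V'"
  shows "\<exists>t. place_above R K F K' m (V' \<inter> F) t V'"
proof -
  obtain t where "lower_place R K F K' m (V' \<inter> F) t"
    using lower_place_exists[OF valuation_ring_restrict[OF assms]] by blast
  then interpret lower_place R K F K' m "V' \<inter> F" t .
  have "place_above R K F K' m (V' \<inter> F) t V'" by unfold_locales (rule assms refl)+
  then show ?thesis by blast
qed

lemma lower_placeE:
  assumes "P \<in> places R K F"
  obtains V t where "valuation_ring R K F V" "P = valuation.nonunits R V" "lower_place R K F K' m V t"
  using assms lower_place_exists unfolding places_iff[OF F(1)] by blast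

lemma place_aboveE:
  assumes "P' \<in> places R K' (carrier R)"
  obtains V' t where "valuation_ring R K' (carrier R) V'" "P' = valuation.nonunits R V'"
    "valuation_ring R K F (V' \<inter> F)" "P' \<inter> F = valuation.nonunits R (V' \<inter> F)"
    "place_above R K F K' m (V' \<inter> F) t V'"
proof -
  obtain V' where V': "valuation_ring R K' (carrier R) V'" "P' = valuation.nonunits R V'"
    using assms unfolding places_iff[OF carrier_is_subfield] by blast
  obtain t where t: "place_above R K F K' m (V' \<inter> F) t V'" using place_above_exists[OF V'(1)] by blast
  interpret place_above R K F K' m "V' \<inter> F" t V' by (rule t)
  show ?thesis by (rule that[OF V' valuation_ring_restrict[OF V'(1)] _ t]) (use V'(2) nonunits_restrict in simp)
qed

lemma restrict_place: "P' \<in> places R K' (carrier R) \<Longrightarrow> P' \<inter> F \<in> places R K F"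
  unfolding places_iff[OF F(1)] by (metis place_aboveE)

text \<open>A discrete valuation ring is a maximal proper subring, so comparable places coincide.\<close>

lemma places_subset_eq:
  assumes PQ: "P \<in> places R K F" "Q \<in> places R K F" and sub: "Q \<subseteq> P"
  shows "Q = P"
proof -
  obtain VP t where P: "P = valuation.nonunits R VP" "lower_place R K F K' m VP t"
    using lower_placeE[OF PQ(1)] .
  obtain VQ s where Q: "Q = valuation.nonunits R VQ" "lower_place R K F K' m VQ s"
    using lower_placeE[OF PQ(2)] .
  interpret p: lower_place R K F K' m VP t by (rule P(2))
  interpret q: lower_place R K F K' m VQ s by (rule Q(2))
  have V: "VP \<subseteq> VQ"
  proof
    fix z assume z: "z \<in> VP"
    show "z \<in> VQ"
    proof (rule ccontr)
      assume n: "z \<notin> VQ"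
      note i = q.inv_nonunit[OF p.V_F[OF z] n]
      have zc: "z \<in> carrier R" using z p.V_carrier by blast
      have "inv z \<in> p.nonunits" using i sub P(1) Q(1) by blast
      then have "inv z \<otimes> z \<in> p.nonunits" using z by blast
      then show False using inv_facts(4)[OF zc i(2)] p.one_not_nonunit by simp
    qed
  qed
  have "z \<in> q.nonunits" if z: "z \<in> p.nonunits" for z
  proof (rule ccontr)
    assume n: "z \<notin> q.nonunits"
    have zV: "z \<in> VP" using z p.nonunits_V by blast
    have z0: "z \<noteq> \<zero>" using n q.zero_nonunit by blast
    have tc: "t \<in> carrier R" using p.t_facts by blast
    have sP: "s \<in> VP" using q.t_facts(1) sub P(1) Q(1) p.nonunits_V by blast
    obtain a u where a: "u \<in> VP - p.nonunits" "s = t [^] (a::nat) \<otimes> u"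
      using p.uniformizer_factorization[OF p.uniformizer_t sP q.t_facts(5)] by blast
    obtain b where b: "b \<in> VP" "z = t \<otimes> b" using z p.uniformizer_t unfolding p.uniformizer_def by blast
    have c: "u \<in> carrier R" "b \<in> carrier R" using a b p.V_carrier by auto
    have u: "u \<noteq> \<zero>" "inv u \<in> VP" using p.unitD a(1) by auto
    note iu = inv_facts[OF c(1) u(1)]
    \<comment> \<open>Since \<open>s\<close> is t^a times a unit of \<open>VP\<close> and
      \<open>t\<close> divides \<open>z\<close> there, z^a becomes a multiple of \<open>s\<close>,
      hence a nonunit of \<open>VQ\<close>.\<close>
    have "z [^] a = t [^] a \<otimes> b [^] a" unfolding b(2) using c tc by (simp add: nat_pow_distrib)
    also have "\<dots> = s \<otimes> (inv u \<otimes> b [^] a)"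
      unfolding a(2) using c tc iu u(1) by (simp add: m_assoc cancel_inv)
    finally have e: "z [^] a = s \<otimes> (inv u \<otimes> b [^] a)" .
    have "inv u \<otimes> b [^] a \<in> VQ" using V u(2) p.V_pow[OF b(1)] by blast
    then have "z [^] a \<in> q.nonunits" unfolding e using q.t_facts(1) by blast
    moreover have "z [^] a \<in> VQ - q.nonunits" by (rule q.unit_pow) (use n zV V in blast)
    ultimately show False by blast
  qed
  then show ?thesis using sub P(1) Q(1) by blast
qed

text \<open>\<open>places_over\<close> asks only for containment, but \<open>Q\<close> inside the
  place \<open>P' \<inter> F\<close> already forces equality.\<close>

lemma places_over_iff:
  assumes P': "P' \<in> places R K' (carrier R)" and Q: "Q \<in> places R K F"
  shows "P' \<in> places_over R K' Q \<longleftrightarrow> Q = P' \<inter> F"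
proof
  assume "P' \<in> places_over R K' Q"
  then have "Q \<subseteq> P'" by (simp add: places_over_def)
  moreover have "Q \<subseteq> F"
  proof -
    obtain V t where V: "Q = valuation.nonunits R V" "lower_place R K F K' m V t" using lower_placeE[OF Q] .
    interpret lower_place R K F K' m V t by (rule V(2))
    show ?thesis using V(1) nonunits_V V_F by blast
  qed
  ultimately show "Q = P' \<inter> F" using places_subset_eq[OF restrict_place[OF P'] Q] by blast
next
  assume "Q = P' \<inter> F"
  then show "P' \<in> places_over R K' Q" using P' by (auto simp: places_over_def)
qed

lemma place_ring_unique:
  assumes "valuation_ring R K F V" "valuation_ring R K F W" "valuation.nonunits R V = valuation.nonunits R W"
  shows "V = W"
  using valuation.V_eq[OF valuation_if_ring[OF assms(1) F(1)]]
    valuation.V_eq[OF valuation_if_ring[OF assms(2) F(1)]] assms(3) by simp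

text \<open>Guards the sum in \<open>conorm\<close>, which would be 0 over an infinite index
  set.\<close>

lemma finite_places_over:
  assumes Q: "Q \<in> places R K F" shows "finite (places_over R K' Q)"
proof -
  obtain V t where V: "valuation_ring R K F V" "Q = valuation.nonunits R V" "lower_place R K F K' m V t"
    using lower_placeE[OF Q] .
  interpret lower_place R K F K' m V t by (rule V(3))
  have "P' \<in> (\<lambda>V'. valuation.nonunits R V') ` {V'. valuation_ring R K' (carrier R) V' \<and> V = V' \<inter> F}"
    if P': "P' \<in> places_over R K' Q" for P'
  proof -
    have pl: "P' \<in> places R K' (carrier R)" using P' by (simp add: places_over_def)
    obtain V' t' where V': "valuation_ring R K' (carrier R) V'" "P' = valuation.nonunits R V'"
      "valuation_ring R K F (V' \<inter> F)" "P' \<inter> F = valuation.nonunits R (V' \<inter> F)"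
      using place_aboveE[OF pl] .
    have "V = V' \<inter> F" using place_ring_unique[OF V(1) V'(3)] V(2) V'(4) places_over_iff[OF pl Q] P' by simp
    then show ?thesis using V'(1,2) by blast
  qed
  then show ?thesis by (intro finite_subset[OF subsetI finite_imageI[OF finite_places_above]])
qed

text \<open>By unramifiedness, one factorization t^i u computes both valuations.\<close>

lemma place_val_restrict:
  assumes P': "P' \<in> places R K' (carrier R)" and f: "f \<in> F" "f \<noteq> \<zero>"
  shows "place_val R K' (carrier R) P' f = place_val R K F (P' \<inter> F) f"
proof -
  obtain V' t where V': "valuation_ring R K' (carrier R) V'" "P' = valuation.nonunits R V'"
    "valuation_ring R K F (V' \<inter> F)" "P' \<inter> F = valuation.nonunits R (V' \<inter> F)"
    "place_above R K F K' m (V' \<inter> F) t V'"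
    using place_aboveE[OF P'] .
  interpret place_above R K F K' m "V' \<inter> F" t V' by (rule V'(5))
  obtain i u where u: "u \<in> V' \<inter> F - nonunits" "f = t [^] (i::int) \<otimes> u"
    using int_factorization[OF uniformizer_t f] by blast
  have "u \<in> V' - up.nonunits" using u(1) nonunits_restrict by blast
  then show ?thesis
    unfolding V'(2,4) u(2) V'(4)[unfolded V'(2)]
    using place_val_eq[OF V'(3) uniformizer_t u(1)] up.place_val_eq[OF V'(1) upper_uniformizer] by simp
qed

text \<open>Each place above lies over exactly one place of \<open>F\<close>, so a single term of
  the double sum survives at \<open>P'\<close>.\<close>

lemma lookup_conorm:
  assumes G: "G \<in> divisors R K F" and P': "P' \<in> places R K' (carrier R)"
  shows "Poly_Mapping.lookup (conorm R K' G) P' = Poly_Mapping.lookup G (P' \<inter> F)"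
proof -
  have keys: "Q \<in> places R K F" if "Q \<in> Poly_Mapping.keys G" for Q
    using G that by (auto simp: divisors_def)
  have inner: "Poly_Mapping.lookup (\<Sum>P''\<in>places_over R K' Q. frag_of P'') P' = (if Q = P' \<inter> F then 1 else 0)"
    if Q: "Q \<in> Poly_Mapping.keys G" for Q
  proof -
    have "Poly_Mapping.lookup (\<Sum>P''\<in>places_over R K' Q. frag_of P'') P' = (\<Sum>P''\<in>places_over R K' Q. if P'' = P' then 1 else 0)"
      unfolding lookup_sum by (intro sum.cong refl) (auto simp: lookup_single when_def)
    also have "\<dots> = (if P' \<in> places_over R K' Q then 1 else 0)"
      using finite_places_over[OF keys[OF Q]] by simp
    finally show ?thesis using places_over_iff[OF P' keys[OF Q]] by simp
  qed
  have "Poly_Mapping.lookup (conorm R K' G) P'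
      = (\<Sum>Q\<in>Poly_Mapping.keys G. Poly_Mapping.lookup G Q * (if Q = P' \<inter> F then 1 else 0))"
    unfolding conorm_def frag_extend_def lookup_sum by (intro sum.cong refl) (simp add: inner)
  also have "\<dots> = (if P' \<inter> F \<in> Poly_Mapping.keys G then Poly_Mapping.lookup G (P' \<inter> F) else 0)"
    by (simp add: if_distrib[of "(*) _"] cong: if_cong)
  also have "\<dots> = Poly_Mapping.lookup G (P' \<inter> F)" by (simp add: in_keys_iff)
  finally show ?thesis .
qed

lemma riemann_roch_space_conorm:
  assumes "G \<in> divisors R K F"
  shows "riemann_roch_space R K F G \<subseteq> riemann_roch_space R K' (carrier R) (conorm R K' G)"
proof
  fix f assume f: "f \<in> riemann_roch_space R K F G"
  show "f \<in> riemann_roch_space R K' (carrier R) (conorm R K' G)"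
  proof (cases "f = \<zero>")
    case False
    then have fF: "f \<in> F" and v: "\<And>P. P \<in> places R K F \<Longrightarrow> place_val R K F P f \<ge> - Poly_Mapping.lookup G P"
      using f by (auto simp: riemann_roch_space_def)
    have "f \<in> carrier R" using fF subfieldE(3)[OF F(1)] by blast
    then show ?thesis
      using v[OF restrict_place] False place_val_restrict[OF _ fF False] lookup_conorm[OF assms]
      by (simp add: riemann_roch_space_def)
  qed (simp add: riemann_roch_space_def)
qed

text \<open>Outside the support the coefficient is 0, so the valuation of \<open>f\<close> is
  nonnegative there.\<close>

lemma regular_mem_ring:
  assumes f: "f \<in> riemann_roch_space R K F G" and V: "valuation_ring R K F V"
    and n: "valuation.nonunits R V \<notin> Poly_Mapping.keys G"
  shows "f \<in> V"
proof -
  obtain t where "lower_place R K F K' m V t" using lower_place_exists[OF V] by blast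
  then interpret lower_place R K F K' m V t .
  show ?thesis
  proof (cases "f = \<zero>")
    case False
    have pl: "nonunits \<in> places R K F" unfolding places_iff[OF F(1)] using V by blast
    have fF: "f \<in> F" and v: "place_val R K F nonunits f \<ge> - Poly_Mapping.lookup G nonunits"
      using f False pl by (auto simp: riemann_roch_space_def)
    obtain i u where u: "u \<in> V - nonunits" "f = t [^] (i::int) \<otimes> u"
      using int_factorization[OF uniformizer_t fF False] by blast
    have "i \<ge> 0" using v place_val_eq[OF V uniformizer_t u(1), of i] n u(2) by (simp add: in_keys_iff)
    then have "f = t [^] nat i \<otimes> u" using u(2) by simp
    then show ?thesis using V_pow[OF t_facts(2)] u(1) by (metis DiffD1 V_closed(4))
  qed (use V_closed(1) in blast)
qed

end

section \<open>Values of functions at places above\<close>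

context place_above begin

lemma K'_subring_facts: "inj_on up.rc K'" "subfield (up.rc ` K') up.residue_field"
  using up.rc_image_subfield[OF K'(1) K'_sub_V'] by blast+

lemma residue_class_upper: "residue_class R K' (carrier R) up.nonunits f = up.rc f"
  unfolding residue_class_def place_ring_nonunits[OF V'_ring carrier_is_subfield] ..

lemma place_eval_eq:
  assumes "f \<in> V'" "a \<in> K'" "f \<ominus> a \<in> up.nonunits"
  shows "place_eval R K' (carrier R) f up.nonunits = a"
  unfolding place_eval_def residue_class_upper
proof (rule the_equality)
  show *: "a \<in> K' \<and> up.rc f = up.rc a"
    using assms up.residue_class_eq_iff[of f a] K'_sub_V' by blast
  show "b = a" if "b \<in> K' \<and> up.rc f = up.rc b" for b
    using that * inj_onD[OF K'_subring_facts(1), of b a] by simp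
qed

text \<open>With d the residue degree, the residue of \<open>f\<close> is fixed by the power q^d,
  hence by q^m, and the q^m residues of \<open>K'\<close> are all the elements fixed by the latter.
  As \<open>K'\<close> embeds into the residue field, the equation for q^d passes on to
  \<open>a\<close>.\<close>

lemma residue_in_K':
  assumes f: "f \<in> V" and dvd: "residue_degree dvd m"
  shows "\<exists>a\<in>K'. f \<ominus> a \<in> up.nonunits \<and> a [^] (card K ^ residue_degree) = a"
proof -
  interpret k: field up.residue_field by (rule up.residue_field_field)
  have fV: "f \<in> V'" using f V_sub_V' by blast
  have pw: "up.rc (f [^] (card K ^ (residue_degree * n))) = up.rc f" for n
    using residue_power[OF f, of n] nonunits_restrict up.residue_class_eq_iff[OF up.V_pow[OF fV] fV] by blast
  let ?S = "up.rc ` K'"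
  have card: "card ?S = card K ^ m" using card_image[OF K'_subring_facts(1)] K'(3) by simp
  have fin: "finite ?S" using K'_finite by blast
  obtain n where n: "m = residue_degree * n" using dvd by blast
  have "up.rc f \<in> ?S"
  proof (rule k.fixed_by_power_mem)
    show "?S \<subseteq> carrier up.residue_field" using subfieldE(3)[OF K'_subring_facts(2)] .
    show "finite ?S" by (rule fin)
    show "\<zero>\<^bsub>up.residue_field\<^esub> \<in> ?S" "\<one>\<^bsub>up.residue_field\<^esub> \<in> ?S"
      using subringE(2,3)[OF subfieldE(1)[OF K'_subring_facts(2)]] by auto
    show "a [^]\<^bsub>up.residue_field\<^esub> card ?S = a" if "a \<in> ?S" for a
      by (rule k.subfield_power_card[OF K'_subring_facts(2) fin that])
    show "up.rc f \<in> carrier up.residue_field" using up.residue_field_carrier fV by blast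
    show "up.rc f [^]\<^bsub>up.residue_field\<^esub> card ?S = up.rc f"
      unfolding card up.rc_pow[OF fV] n by (rule pw)
  qed
  then obtain a where a: "a \<in> K'" "up.rc f = up.rc a" by blast
  have aV: "a \<in> V'" using a K'_sub_V' by blast
  have "up.rc (a [^] (card K ^ residue_degree)) = up.rc a"
  proof -
    have "up.rc (a [^] (card K ^ residue_degree)) = up.rc (f [^] (card K ^ residue_degree))"
      using up.rc_pow[OF aV] up.rc_pow[OF fV] a(2) by metis
    then show ?thesis using pw[of 1] a(2) by simp
  qed
  moreover have "a [^] (k::nat) \<in> K'" for k by (induction k) (use a K'_closed in auto)
  ultimately have "a [^] (card K ^ residue_degree) = a"
    using inj_onD[OF K'_subring_facts(1)] a(1) by blast
  then show ?thesis using a up.residue_class_eq_iff[OF fV aV] by blast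
qed

lemma residue_degree_eq: "place_degree R K F nonunits = residue_degree"
proof -
  have vr: "valuation_ring R K F V" using valuation_ring_restrict[OF V'_ring] V_restrict by simp
  show ?thesis
    unfolding place_degree_def residue_degree_def residue_class_def place_ring_nonunits[OF vr F(1)] ..
qed

end

context constant_extension begin

lemma place_eval_above:
  assumes P': "P' \<in> places R K' (carrier R)" and G: "P' \<inter> F \<notin> Poly_Mapping.keys G"
    and f: "f \<in> riemann_roch_space R K F G" and a: "a \<in> K'" "f \<ominus> a \<in> P'"
  shows "place_eval R K' (carrier R) f P' = a"
proof -
  obtain V' t where V': "valuation_ring R K' (carrier R) V'" "P' = valuation.nonunits R V'"
    "valuation_ring R K F (V' \<inter> F)" "P' \<inter> F = valuation.nonunits R (V' \<inter> F)"
    "place_above R K F K' m (V' \<inter> F) t V'"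
    using place_aboveE[OF P'] .
  interpret place_above R K F K' m "V' \<inter> F" t V' by (rule V'(5))
  have "f \<in> V' \<inter> F" by (rule regular_mem_ring[OF f V'(3)]) (use G V'(4) in simp)
  then show ?thesis using place_eval_eq[OF _ a(1)] a(2) V'(2) by simp
qed

lemma residue_above_exists:
  assumes P': "P' \<in> places R K' (carrier R)" and G: "P' \<inter> F \<notin> Poly_Mapping.keys G"
    and f: "f \<in> riemann_roch_space R K F G" and dvd: "place_degree R K F (P' \<inter> F) dvd m"
  shows "\<exists>a\<in>K'. f \<ominus> a \<in> P' \<and> a [^] (card K ^ place_degree R K F (P' \<inter> F)) = a"
proof -
  obtain V' t where V': "valuation_ring R K' (carrier R) V'" "P' = valuation.nonunits R V'"
    "valuation_ring R K F (V' \<inter> F)" "P' \<inter> F = valuation.nonunits R (V' \<inter> F)"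
    "place_above R K F K' m (V' \<inter> F) t V'"
    using place_aboveE[OF P'] .
  interpret place_above R K F K' m "V' \<inter> F" t V' by (rule V'(5))
  have "f \<in> V' \<inter> F" by (rule regular_mem_ring[OF f V'(3)]) (use G V'(4) in simp)
  moreover have "place_degree R K F (P' \<inter> F) = residue_degree" using residue_degree_eq V'(4) by simp
  ultimately show ?thesis using residue_in_K' dvd V'(2) by simp
qed

end

section \<open>Blocks and Hamming weights\<close>

lemma concat_map_upt_Suc: "concat (map f [0..<Suc s]) = concat (map f [0..<s]) @ f s"
  by simp

lemma length_concat_blocks:
  "(\<And>i. i < s \<Longrightarrow> length (f i) = d i) \<Longrightarrow> length (concat (map f [0..<s])) = (\<Sum>i<s. d i)"
  by (induction s) auto

lemma vec_add_append:
  "length x = length y \<Longrightarrow> vec_add L (x @ x') (y @ y') = vec_add L x y @ vec_add L x' y'"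
  by (simp add: vec_add_def)

lemma vec_add_blocks:
  assumes "\<And>i. i < s \<Longrightarrow> length (f i) = length (g i)"
  shows "vec_add L (concat (map f [0..<s])) (concat (map g [0..<s]))
    = concat (map (\<lambda>i. vec_add L (f i) (g i)) [0..<s])"
  using assms
proof (induction s)
  case (Suc s)
  have "length (concat (map f [0..<s])) = length (concat (map g [0..<s]))"
    using length_concat_blocks[of s f "\<lambda>i. length (g i)"] length_concat_blocks[of s g "\<lambda>i. length (g i)"] Suc.prems
    by simp
  then show ?case using Suc by (simp add: vec_add_append)
qed (simp add: vec_add_def)

lemma hamming_weight_filter: "hamming_weight L v = length (filter (\<lambda>x. x \<noteq> \<zero>\<^bsub>L\<^esub>) v)"
  by (simp add: hamming_weight_def length_filter_conv_card)

lemma hamming_weight_blocks: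
  "hamming_weight L (concat (map f [0..<s])) = (\<Sum>i<s. hamming_weight L (f i))"
  by (induction s) (simp_all add: hamming_weight_filter)

lemma blocks_eq_iff:
  assumes "\<And>i. i < s \<Longrightarrow> length (f i) = length (g i)"
  shows "concat (map f [0..<s]) = concat (map g [0..<s]) \<longleftrightarrow> (\<forall>i<s. f i = g i)"
proof -
  have "concat (map f [0..<s]) = concat (map g [0..<s]) \<longleftrightarrow> map f [0..<s] = map g [0..<s]"
    by (rule concat_eq_concat_iff) (use assms in \<open>auto simp: set_zip\<close>)
  then show ?thesis by auto
qed

lemma prod_map_bij:
  assumes "\<And>i. i < s \<Longrightarrow> bij_betw (\<pi> i) (E i) (vecs K (d i))"
  shows "bij_betw (prod_map s \<pi>) (Lambda s E) (vecs K (\<Sum>i<s. d i))"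
proof -
  have m: "\<pi> i z \<in> vecs K (d i)" if "i < s" "z \<in> E i" for i z
    using assms[OF that(1)] that(2) by (rule bij_betw_apply)
  have len: "length (\<pi> i z) = d i" if "i < s" "z \<in> E i" for i z using m[OF that] by (simp add: vecs_def)
  show ?thesis
    unfolding bij_betw_def
  proof
    show "inj_on (prod_map s \<pi>) (Lambda s E)"
    proof (rule inj_onI)
      fix x y assume x: "x \<in> Lambda s E" and y: "y \<in> Lambda s E" and eq: "prod_map s \<pi> x = prod_map s \<pi> y"
      have "\<forall>i<s. \<pi> i (x ! i) = \<pi> i (y ! i)"
        using eq x y blocks_eq_iff[of s "\<lambda>i. \<pi> i (x ! i)" "\<lambda>i. \<pi> i (y ! i)"] len
        by (simp add: prod_map_def Lambda_def)
      then have "\<forall>i<s. x ! i = y ! i"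
        using x y inj_onD[OF bij_betw_imp_inj_on[OF assms]] by (simp add: Lambda_def)
      then show "x = y" using x y by (simp add: Lambda_def list_eq_iff_nth_eq)
    qed
    \<comment> \<open>Induction over the number of blocks, splitting off the last one.\<close>
    have surj: "y \<in> prod_map r \<pi> ` Lambda r E" if "r \<le> s" "y \<in> vecs K (\<Sum>i<r. d i)" for r y
      using that
    proof (induction r arbitrary: y)
      case 0
      then show ?case by (auto simp: vecs_def prod_map_def Lambda_def)
    next
      case (Suc r)
      let ?n = "\<Sum>i<r. d i"
      have y: "take ?n y \<in> vecs K ?n" "drop ?n y \<in> vecs K (d r)"
        using Suc.prems(2) set_take_subset[of ?n y] set_drop_subset[of ?n y] by (auto simp: vecs_def)
      obtain x where x: "x \<in> Lambda r E" "take ?n y = prod_map r \<pi> x" using Suc.IH[OF _ y(1)] Suc.prems(1) by auto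
      obtain z where z: "z \<in> E r" "drop ?n y = \<pi> r z"
        using y(2) assms[of r] Suc.prems(1) by (auto simp: bij_betw_def)
      have "x @ [z] \<in> Lambda (Suc r) E" using x(1) z(1) by (auto simp: Lambda_def nth_append less_Suc_eq)
      moreover have "prod_map (Suc r) \<pi> (x @ [z]) = prod_map r \<pi> x @ \<pi> r z"
      proof -
        have mp: "map (\<lambda>i. \<pi> i ((x @ [z]) ! i)) [0..<r] = map (\<lambda>i. \<pi> i (x ! i)) [0..<r]"
          using x(1) by (auto simp: Lambda_def nth_append)
        have "(x @ [z]) ! r = z" using x(1) by (auto simp: Lambda_def nth_append)
        then show ?thesis unfolding prod_map_def concat_map_upt_Suc mp by simp
      qed
      then have "prod_map (Suc r) \<pi> (x @ [z]) = y" using x(2) z(2) by (metis append_take_drop_id)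
      ultimately show ?case by blast
    qed
    have "prod_map s \<pi> x \<in> vecs K (\<Sum>i<s. d i)" if x: "x \<in> Lambda s E" for x
    proof -
      have "z \<in> K" if "i < s" "z \<in> set (\<pi> i (x ! i))" for i z
        using m[OF that(1), of "x ! i"] x that by (auto simp: vecs_def Lambda_def)
      moreover have "length (prod_map s \<pi> x) = (\<Sum>i<s. d i)"
        unfolding prod_map_def by (rule length_concat_blocks) (use len x in \<open>simp add: Lambda_def\<close>)
      ultimately show ?thesis by (auto simp: vecs_def prod_map_def)
    qed
    then show "prod_map s \<pi> ` Lambda s E = vecs K (\<Sum>i<s. d i)" using surj[of s] by blast
  qed
qed

text \<open>The bound on \<open>card I\<close> is one less than the least integer w for which a w
  plus the sum of the (i - a) \<open>\<nu> i\<close> reaches t + 1. The excesses over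
  \<open>a\<close> are summed over all blocks, not only those in \<open>I\<close>, and grouped by
  degree.\<close>

lemma weighted_blocks_bound:
  fixes d \<nu> :: "nat \<Rightarrow> nat"
  assumes I: "I \<subseteq> {..<s}" and \<mu>: "\<mu> = Max (d ` {..<s})" and \<nu>: "\<forall>i. \<nu> i = card {j. j < s \<and> d j = i}"
    and a: "a > 0"
    and w: "int (card I) \<le> \<lceil>(real t + 1 - (\<Sum>i=a+1..\<mu>. (real i - real a) * real (\<nu> i))) / real a\<rceil> - 1"
  shows "(\<Sum>i\<in>I. d i) \<le> t"
proof (rule ccontr)
  assume n: "\<not> (\<Sum>i\<in>I. d i) \<le> t"
  have fin: "finite I" using I finite_subset by blast
  \<comment> \<open>Natural subtraction is exact here, since i exceeds \<open>a\<close>; for a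
    single block, \<open>d i - a\<close> is the positive part of the difference.\<close>
  define S where "S = (\<Sum>i=a+1..\<mu>. (i - a) * \<nu> i)"
  have "(\<Sum>i\<in>I. d i) \<le> (\<Sum>i\<in>I. a + (d i - a))" by (intro sum_mono) auto
  also have "\<dots> = a * card I + (\<Sum>i\<in>I. d i - a)" by (simp add: sum.distrib)
  also have "(\<Sum>i\<in>I. d i - a) \<le> (\<Sum>i<s. d i - a)" using I by (intro sum_mono2) auto
  also have "(\<Sum>i<s. d i - a) = (\<Sum>i\<in>{i\<in>{..<s}. d i > a}. d i - a)"
    by (rule sum.mono_neutral_right) auto
  also have "\<dots> = (\<Sum>j=a+1..\<mu>. \<Sum>i\<in>{i\<in>{i\<in>{..<s}. d i > a}. d i = j}. d i - a)"
    by (rule sum.group[symmetric]) (auto simp: \<mu>)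
  also have "\<dots> = S"
    unfolding S_def
  proof (rule sum.cong[OF refl])
    fix j assume j: "j \<in> {a+1..\<mu>}"
    then have "{i\<in>{i\<in>{..<s}. d i > a}. d i = j} = {i. i < s \<and> d i = j}" by auto
    then show "(\<Sum>i\<in>{i\<in>{i\<in>{..<s}. d i > a}. d i = j}. d i - a) = (j - a) * \<nu> j" using \<nu> by simp
  qed
  finally have "t + 1 \<le> a * card I + S" using n by simp
  then have "real (t + 1) \<le> real (a * card I + S)" by (simp only: of_nat_le_iff)
  moreover have "real S = (\<Sum>i=a+1..\<mu>. (real i - real a) * real (\<nu> i))"
    unfolding S_def of_nat_sum by (intro sum.cong refl) (auto simp: of_nat_diff)
  ultimately have "(real t + 1 - (\<Sum>i=a+1..\<mu>. (real i - real a) * real (\<nu> i))) / real a \<le> real (card I)"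
    using a by (simp add: divide_le_eq mult.commute)
  then show False using w by linarith
qed

locale linear_blocks = field L for L (structure) +
  fixes K E n p
  assumes K: "subfield K L" and E: "subfield E L" and iso: "linear_iso_to_vecs L K E n p"
begin

lemma zero_vector: "p \<zero> = replicate n \<zero>"
proof -
  have z: "\<zero> \<in> K" "\<zero> \<in> E" using subringE(2) subfieldE(1) K E by blast+
  have v: "p \<zero> \<in> vecs K n" using iso z(2) bij_betw_apply unfolding linear_iso_to_vecs_def by metis
  have "p (\<zero> \<otimes> \<zero>) = vec_smult L \<zero> (p \<zero>)" using iso z unfolding linear_iso_to_vecs_def by blast
  then have "p \<zero> = map (\<lambda>x. \<zero> \<otimes> x) (p \<zero>)" by (simp add: vec_smult_def)
  also have "\<dots> = map (\<lambda>x. \<zero>) (p \<zero>)"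
    using v subfieldE(3)[OF K] by (auto simp: vecs_def)
  finally show ?thesis using v by (simp add: vecs_def map_replicate_const)
qed

lemma weight_pos:
  assumes z: "z \<in> E" "z \<noteq> \<zero>" shows "hamming_weight L (p z) \<ge> 1"
proof (rule ccontr)
  assume "\<not> hamming_weight L (p z) \<ge> 1"
  then have "length (filter (\<lambda>x. x \<noteq> \<zero>) (p z)) = 0" unfolding hamming_weight_filter by linarith
  then have "filter (\<lambda>x. x \<noteq> \<zero>) (p z) = []" by blast
  then have "\<forall>x\<in>set (p z). x = \<zero>" by (auto simp: filter_empty_conv)
  moreover have "p z \<in> vecs K n" using iso z(1) bij_betw_apply unfolding linear_iso_to_vecs_def by metis
  ultimately have "p z = replicate n \<zero>" by (metis (mono_tags, lifting) mem_Collect_eq replicate_eqI vecs_def)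
  then have "p z = p \<zero>" using zero_vector by simp
  moreover have "\<zero> \<in> E" using subringE(2)[OF subfieldE(1)[OF E]] .
  ultimately show False using iso z bij_betw_imp_inj_on inj_onD unfolding linear_iso_to_vecs_def by metis
qed

end

section \<open>Decoding C by means of the extended code\<close>

theorem theorem1:
  fixes L :: "('a, 'b) ring_scheme"
    and K F K' :: "'a set"
    and q s n \<mu> m a t :: nat
    and d \<nu> :: "nat \<Rightarrow> nat"
    and P :: "nat \<Rightarrow> 'a set"
    and Pt :: "nat \<Rightarrow> nat \<Rightarrow> 'a set"
    and G :: "'a set \<Rightarrow>\<^sub>0 int"
    and \<sigma> :: "'a \<Rightarrow> 'a"
    and E :: "nat \<Rightarrow> 'a set"
    and \<pi> :: "nat \<Rightarrow> 'a \<Rightarrow> 'a list"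
    and alg :: "'a list \<Rightarrow> 'a list"
    and T :: int
    and \<pi>s \<pi>s_inv \<phi> \<phi>_inv :: "'a list \<Rightarrow> 'a list"
    and C :: "'a list set"
  assumes "function_field L K F" and "finite K" and "q = card K"
    and "full_constant_field L K F"
    and "s > 0"
    and "\<forall>i<s. P i \<in> places L K F" and "inj_on P {..<s}"
    and "G \<in> divisors L K F" and "\<forall>i<s. P i \<notin> Poly_Mapping.keys G"
    and "\<forall>i<s. d i = place_degree L K F (P i)"
    and "n = (\<Sum>i<s. d i)"
    and "\<mu> = Max (d ` {..<s})"
    and "\<forall>i. \<nu> i = card {j. j < s \<and> d j = i}"
    and "m = Lcm (d ` {..<s})"
    and "constant_field_extension L K F K'" and "card K' = q ^ m"
    and "frobenius_automorphism L K F K' \<sigma>"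
    and "\<forall>i<s. bij_betw (Pt i) {..<d i} (places_over L K' (P i))"
    and "\<forall>i<s. \<forall>j<d i. \<sigma> ` Pt i j = Pt i ((j + 1) mod d i)"
    and "\<forall>i<s. subfield (E i) L \<and> E i \<subseteq> K' \<and> card (E i) = q ^ d i"
    and "\<forall>i<s. linear_iso_to_vecs L K (E i) (d i) (\<pi> i)"
    and "\<pi>s = prod_map s \<pi>" and "\<pi>s_inv = inv_into (Lambda s E) \<pi>s"
    and "\<phi> = conjugates_map s d \<sigma>" and "\<phi>_inv = inv_into (Lambda s E) \<phi>"
    and "C = place_code L K F K' s Pt \<pi> G"
    and "corrects_errors L K' n (extended_code L K' s d Pt G) (int t) alg"
    and "a > 0"
    and "(\<Sum>i=a+1..\<mu>. i * \<nu> i) < t + 1" and "t + 1 \<le> (\<Sum>i=a..\<mu>. i * \<nu> i)"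
    and "T = \<lceil>(real t + 1 - (\<Sum>i=a+1..\<mu>. (real i - real a) * real (\<nu> i))) / real a\<rceil> - 1"
  shows "C \<subseteq> vecs K n \<and>
    (\<forall>c\<in>C. \<forall>e\<in>vecs K n. int (hamming_weight L e) \<le> T \<longrightarrow>
       alg (\<phi> (\<pi>s_inv (vec_add L c e))) = \<phi> (\<pi>s_inv c) \<and>
       \<pi>s (\<phi>_inv (\<phi> (\<pi>s_inv c))) = c) \<and>
    corrects_errors L K n C T (\<lambda>y. \<pi>s (\<phi>_inv (alg (\<phi> (\<pi>s_inv y)))))"
proof -
  have ff: "field L" "subfield K L" "subfield F L" "K \<subseteq> F"
    "\<exists>x\<in>F. ring.transcendental L K x \<and> ring.finite_dimension L (generate_field L (insert x K)) F"
    using assms(1) unfolding function_field_def by auto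
  have cfe: "subfield K' L" "K \<subseteq> K'" "\<forall>z\<in>K'. ring.algebraic L K z" "carrier L = generate_field L (F \<union> K')"
    using assms(15) unfolding constant_field_extension_def by auto
  have fin: "finite K" and q: "q = card K" and K'card: "card K' = card K ^ m" using assms(2,3,16) by auto
  interpret field L by (rule ff(1))
  interpret constant_extension L K F K' m
    by (rule constant_extension.intro[OF ff(1) constant_extension_axioms.intro])
      (use ff fin cfe K'card in auto)
  have \<sigma>: "\<sigma> \<in> ring_iso L L" "\<And>x. x \<in> F \<Longrightarrow> \<sigma> x = x" "\<And>\<alpha>. \<alpha> \<in> K' \<Longrightarrow> \<sigma> \<alpha> = \<alpha> [^]\<^bsub>L\<^esub> card K"
    using assms(17) unfolding frobenius_automorphism_def by auto
  have \<sigma>j_hom: "(\<sigma> ^^ j) \<in> ring_iso L L" for j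
  proof (induction j)
    case 0
    show ?case by (simp only: funpow.simps(1) ring_iso_set_refl)
  next
    case (Suc j)
    show ?case unfolding funpow.simps(2) by (rule ring_iso_set_trans[OF Suc \<sigma>(1)])
  qed
  have \<sigma>j: "(\<sigma> ^^ j) x \<in> carrier L" "(\<sigma> ^^ j) (x \<oplus>\<^bsub>L\<^esub> y) = (\<sigma> ^^ j) x \<oplus>\<^bsub>L\<^esub> (\<sigma> ^^ j) y"
    if "x \<in> carrier L" "y \<in> carrier L" for x y j
    using \<sigma>j_hom[of j] that by (auto simp: ring_iso_def ring_hom_def)
  have \<sigma>j_zero: "(\<sigma> ^^ j) x = \<zero>\<^bsub>L\<^esub> \<longleftrightarrow> x = \<zero>\<^bsub>L\<^esub>" if x: "x \<in> carrier L" for x j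
  proof -
    have z: "(\<sigma> ^^ j) \<zero>\<^bsub>L\<^esub> = \<zero>\<^bsub>L\<^esub>"
      using ring_hom_zero[OF _ ring_axioms ring_axioms] \<sigma>j_hom[of j] by (auto simp: ring_iso_def)
    have "inj_on (\<sigma> ^^ j) (carrier L)" using \<sigma>j_hom[of j] by (auto simp: ring_iso_def bij_betw_def)
    then show ?thesis using z x inj_onD by fastforce
  qed
  have \<sigma>j_F: "(\<sigma> ^^ j) x = x" if "x \<in> F" for x j
    by (induction j) (use \<sigma>(2) that in auto)
  have \<sigma>j_K': "(\<sigma> ^^ j) x \<in> K'" if x: "x \<in> K'" for x j
  proof (induction j)
    case (Suc j)
    have "y [^]\<^bsub>L\<^esub> (k::nat) \<in> K'" if "y \<in> K'" for y k by (induction k) (use that K'_closed in auto)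
    then show ?case using Suc \<sigma>(3) by simp
  qed (use x in simp)
  have \<sigma>j_minus: "(\<sigma> ^^ j) (x \<ominus>\<^bsub>L\<^esub> y) = (\<sigma> ^^ j) x \<ominus>\<^bsub>L\<^esub> (\<sigma> ^^ j) y"
    if "x \<in> carrier L" "y \<in> carrier L" for x y j
  proof -
    have "(\<sigma> ^^ j) x = (\<sigma> ^^ j) ((x \<ominus>\<^bsub>L\<^esub> y) \<oplus>\<^bsub>L\<^esub> y)" using that by (simp add: minus_eq a_assoc l_neg)
    also have "\<dots> = (\<sigma> ^^ j) (x \<ominus>\<^bsub>L\<^esub> y) \<oplus>\<^bsub>L\<^esub> (\<sigma> ^^ j) y" using that by (intro \<sigma>j) auto
    finally show ?thesis using that \<sigma>j(1) by (simp add: minus_eq a_assoc r_neg)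
  qed

  \<comment> \<open>A degree 0 would make the least common multiple 0 and leave \<open>K'\<close>
    with one element. So all degrees are positive, and each block has a first place
    \<open>Pt i 0\<close>.\<close>
  have m0: "m \<noteq> 0"
  proof
    assume "m = 0"
    then have "card K' = 1" using K'card by simp
    then show False using K'_closed(1,2) one_not_zero by (metis card_1_singletonE singletonD)
  qed
  have d_dvd: "d i dvd m" if "i < s" for i using assms(14) that by simp
  have d_pos: "d i > 0" if "i < s" for i using d_dvd[OF that] m0 by (metis dvd_0_left gr0I)

  have Pt: "Pt i j \<in> places L K' (carrier L)" "Pt i j \<inter> F = P i" if ij: "i < s" "j < d i" for i j
  proof -
    have po: "Pt i j \<in> places_over L K' (P i)" using assms(18) ij bij_betw_apply by fastforce
    then show pl: "Pt i j \<in> places L K' (carrier L)" by (simp add: places_over_def)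
    have "P i \<in> places L K F" using assms(6) ij by blast
    from places_over_iff[OF pl this] po show "Pt i j \<inter> F = P i" by simp
  qed
  have Pt_conj: "(\<sigma> ^^ j) ` Pt i 0 = Pt i j" if "i < s" "j < d i" for i j
    using that
  proof (induction j)
    case (Suc j)
    have "(\<sigma> ^^ Suc j) ` Pt i 0 = \<sigma> ` Pt i j"
      unfolding funpow.simps(2) image_comp[symmetric] using Suc by simp
    also have "\<dots> = Pt i (Suc j)" using assms(19) Suc.prems by simp
    finally show ?case .
  qed simp

  have E: "subfield (E i) L" "E i \<subseteq> K'" "card (E i) = card K ^ d i" if "i < s" for i
    using assms(20) that q by auto
  have E_closed: "x \<in> carrier L" if "i < s" "x \<in> E i" for i x using E(2)[OF that(1)] that(2) K'_closed(4) by blast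
  have iso: "linear_iso_to_vecs L K (E i) (d i) (\<pi> i)" if "i < s" for i using assms(21) that by blast
  have blk: "linear_blocks L K (E i) (d i) (\<pi> i)" if "i < s" for i
    by (rule linear_blocks.intro[OF ff(1) linear_blocks_axioms.intro[OF ff(2) E(1)[OF that] iso[OF that]]])
  have \<pi>_bij: "bij_betw (\<pi> i) (E i) (vecs K (d i))" if "i < s" for i
    using iso[OF that] unfolding linear_iso_to_vecs_def by blast
  have \<pi>_len: "length (\<pi> i z) = d i" if "i < s" "z \<in> E i" for i z
    using bij_betw_apply[OF \<pi>_bij[OF that(1)] that(2)] by (simp add: vecs_def)

  have \<pi>s_bij: "bij_betw \<pi>s (Lambda s E) (vecs K n)"
    unfolding assms(22,11) by (rule prod_map_bij[OF \<pi>_bij])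
  have inv_\<pi>s: "\<pi>s_inv (\<pi>s x) = x" if "x \<in> Lambda s E" for x
    unfolding assms(23) by (rule inv_into_f_f[OF bij_betw_imp_inj_on[OF \<pi>s_bij] that])

  have Lambda_add: "vec_add L x y \<in> Lambda s E" "\<pi>s (vec_add L x y) = vec_add L (\<pi>s x) (\<pi>s y)"
    "\<phi> (vec_add L x y) = vec_add L (\<phi> x) (\<phi> y)"
    if x: "x \<in> Lambda s E" and y: "y \<in> Lambda s E" for x y
  proof -
    have len: "length x = s" "length y = s" and mem: "\<And>i. i < s \<Longrightarrow> x ! i \<in> E i" "\<And>i. i < s \<Longrightarrow> y ! i \<in> E i"
      using x y by (auto simp: Lambda_def)
    have nth: "vec_add L x y ! i = x ! i \<oplus>\<^bsub>L\<^esub> y ! i" if "i < s" for i using len that by (simp add: vec_add_def)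
    show "vec_add L x y \<in> Lambda s E"
      using nth mem len subringE(7)[OF subfieldE(1)[OF E(1)]] by (simp add: Lambda_def) (simp add: vec_add_def)
    have "\<pi> i (x ! i \<oplus>\<^bsub>L\<^esub> y ! i) = vec_add L (\<pi> i (x ! i)) (\<pi> i (y ! i))" if "i < s" for i
      using iso[OF that] mem[OF that] unfolding linear_iso_to_vecs_def by blast
    then show "\<pi>s (vec_add L x y) = vec_add L (\<pi>s x) (\<pi>s y)"
      unfolding assms(22) prod_map_def
      using nth mem \<pi>_len by (subst vec_add_blocks) (auto intro!: arg_cong[where f = concat])
    have "vec_add L (map (\<lambda>j. (\<sigma> ^^ j) (x ! i)) [0..<d i]) (map (\<lambda>j. (\<sigma> ^^ j) (y ! i)) [0..<d i])
        = map (\<lambda>j. (\<sigma> ^^ j) (vec_add L x y ! i)) [0..<d i]" if "i < s" for i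
      using nth[OF that] \<sigma>j(2) E_closed[OF that] mem[OF that]
      by (simp add: vec_add_def zip_map_map split_def list_eq_iff_nth_eq)
    then show "\<phi> (vec_add L x y) = vec_add L (\<phi> x) (\<phi> y)"
      unfolding assms(24) conjugates_map_def
      by (subst vec_add_blocks) (auto intro!: arg_cong[where f = concat])
  qed

  have \<phi>_inj: "inj_on \<phi> (Lambda s E)"
  proof (rule inj_onI)
    fix x y assume x: "x \<in> Lambda s E" and y: "y \<in> Lambda s E" and eq: "\<phi> x = \<phi> y"
    have "\<forall>i<s. map (\<lambda>j. (\<sigma> ^^ j) (x ! i)) [0..<d i] = map (\<lambda>j. (\<sigma> ^^ j) (y ! i)) [0..<d i]"
      using eq unfolding assms(24) conjugates_map_def by (subst (asm) blocks_eq_iff) auto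
    \<comment> \<open>The entry with index 0 of each block is the component itself, and blocks are
      nonempty.\<close>
    then have "\<forall>i<s. x ! i = y ! i" using d_pos by (force simp: list_eq_iff_nth_eq)
    then show "x = y" using x y by (simp add: Lambda_def list_eq_iff_nth_eq)
  qed
  have inv_\<phi>: "\<phi>_inv (\<phi> x) = x" if "x \<in> Lambda s E" for x
    unfolding assms(25) by (rule inv_into_f_f[OF \<phi>_inj that])
  have \<phi>_vecs: "\<phi> x \<in> vecs K' n" if x: "x \<in> Lambda s E" for x
    using x \<sigma>j_K' E(2) length_concat_blocks[of s "\<lambda>i. map (\<lambda>j. (\<sigma> ^^ j) (x ! i)) [0..<d i]" d]
    unfolding assms(24) conjugates_map_def assms(11) by (auto simp: vecs_def Lambda_def) blast

  have weight: "hamming_weight L (\<phi> x) \<le> t"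
    if x: "x \<in> Lambda s E" and w: "int (hamming_weight L (\<pi>s x)) \<le> T" for x
  proof -
    define I where "I = {i \<in> {..<s}. x ! i \<noteq> \<zero>\<^bsub>L\<^esub>}"
    have mem: "x ! i \<in> E i" if "i < s" for i using x that by (simp add: Lambda_def)
    have "card I = (\<Sum>i\<in>I. 1)" by simp
    \<comment> \<open>A nonzero component has a nonzero image under \<open>\<pi> i\<close>, so every
      block in \<open>I\<close> carries at least one error.\<close>
    also have "\<dots> \<le> (\<Sum>i\<in>I. hamming_weight L (\<pi> i (x ! i)))"
      using linear_blocks.weight_pos[OF blk] mem by (intro sum_mono) (auto simp: I_def)
    also have "\<dots> \<le> (\<Sum>i<s. hamming_weight L (\<pi> i (x ! i)))" by (intro sum_mono2) (auto simp: I_def)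
    also have "\<dots> = hamming_weight L (\<pi>s x)" unfolding assms(22) prod_map_def hamming_weight_blocks ..
    finally have "int (card I) \<le> T" using w by linarith
    then have bound: "(\<Sum>i\<in>I. d i) \<le> t"
      unfolding assms(31) by (intro weighted_blocks_bound[OF _ assms(12,13,28)]) (auto simp: I_def)
    \<comment> \<open>Conjugates of a nonzero element are nonzero, so a block of
      \<open>\<phi> x\<close> is either full or zero.\<close>
    have "hamming_weight L (map (\<lambda>j. (\<sigma> ^^ j) (x ! i)) [0..<d i]) = (if i \<in> I then d i else 0)" if i: "i < s" for i
      using \<sigma>j_zero[OF E_closed[OF i mem[OF i]]] i by (simp add: hamming_weight_filter filter_map o_def I_def)
    then have "hamming_weight L (\<phi> x) = (\<Sum>i<s. if i \<in> I then d i else 0)"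
      unfolding assms(24) conjugates_map_def hamming_weight_blocks by simp
    also have "\<dots> = (\<Sum>i\<in>I. d i)" by (simp add: sum.If_cases I_def Int_def)
    finally show ?thesis using bound by simp
  qed

  have code: "\<exists>x\<in>Lambda s E. c = \<pi>s x \<and> \<phi> x \<in> extended_code L K' s d Pt G" if c: "c \<in> C" for c
  proof -
    obtain f where f: "f \<in> riemann_roch_space L K F G"
      and cf: "c = concat (map (\<lambda>i. \<pi> i (place_eval L K' (carrier L) f (Pt i 0))) [0..<s])"
      using c unfolding assms(26) place_code_def by blast
    have fF: "f \<in> F" "f \<in> carrier L"
      using f subringE(2)[OF subfieldE(1)[OF ff(3)]] subfieldE(3)[OF ff(3)] by (auto simp: riemann_roch_space_def)
    define ev where "ev i j = place_eval L K' (carrier L) f (Pt i j)" for i j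
    have ev: "ev i 0 \<in> E i \<and> (\<forall>j<d i. ev i j = (\<sigma> ^^ j) (ev i 0))" if i: "i < s" for i
    proof -
      note p0 = Pt[OF i d_pos[OF i]]
      have nk: "P i \<notin> Poly_Mapping.keys G" using assms(9) i by blast
      have deg: "place_degree L K F (P i) = d i" using assms(10) i by simp
      obtain a where a: "a \<in> K'" "f \<ominus>\<^bsub>L\<^esub> a \<in> Pt i 0" "a [^]\<^bsub>L\<^esub> (card K ^ d i) = a"
        using residue_above_exists[OF p0(1) _ f] p0(2) nk deg d_dvd[OF i] by auto
      have ac: "a \<in> carrier L" using a(1) K'_closed(4) by blast
      have finE: "finite (E i)" using E(2)[OF i] K'_finite finite_subset by blast
      \<comment> \<open>The q^(d i) elements of \<open>E i\<close> are all the elements of the field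
        fixed by the power q^(d i), and \<open>a\<close> is one of them.\<close>
      have "a \<in> E i"
      proof (rule fixed_by_power_mem[OF _ finE _ _ _ ac])
        show "E i \<subseteq> carrier L" "\<zero>\<^bsub>L\<^esub> \<in> E i" "\<one>\<^bsub>L\<^esub> \<in> E i" using subringE(1-3)[OF subfieldE(1)[OF E(1)[OF i]]] by auto
        show "b [^]\<^bsub>L\<^esub> card (E i) = b" if "b \<in> E i" for b by (rule subfield_power_card[OF E(1)[OF i] finE that])
        show "a [^]\<^bsub>L\<^esub> card (E i) = a" using a(3) E(3)[OF i] by simp
      qed
      moreover have conj: "ev i j = (\<sigma> ^^ j) a" if j: "j < d i" for j
      proof -
        note pj = Pt[OF i j]
        \<comment> \<open>\<open>\<sigma>\<close> fixes \<open>f\<close> and permutes the places, so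
          the congruence of \<open>f\<close> and \<open>a\<close> at the first place becomes one of
          \<open>f\<close> and a conjugate of \<open>a\<close> at the place with index
          \<open>j\<close>.\<close>
        have "(\<sigma> ^^ j) (f \<ominus>\<^bsub>L\<^esub> a) \<in> Pt i j" using a(2) Pt_conj[OF i j] by blast
        then have "f \<ominus>\<^bsub>L\<^esub> (\<sigma> ^^ j) a \<in> Pt i j" using \<sigma>j_minus[OF fF(2) ac] \<sigma>j_F[OF fF(1)] by simp
        then show ?thesis unfolding ev_def
          by (intro place_eval_above[OF pj(1) _ f \<sigma>j_K'[OF a(1)]]) (use pj(2) nk in simp_all)
      qed
      ultimately show ?thesis using conj[OF d_pos[OF i]] by simp
    qed
    define x where "x = map (\<lambda>i. ev i 0) [0..<s]"
    have xi: "x ! i = ev i 0" if "i < s" for i using that by (simp add: x_def)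
    have x: "x \<in> Lambda s E" using ev xi by (simp add: Lambda_def) (simp add: x_def)
    have cx: "c = \<pi>s x"
      unfolding cf assms(22) prod_map_def using xi by (auto intro!: arg_cong[where f = concat] simp: ev_def)
    have "map (\<lambda>j. (\<sigma> ^^ j) (x ! i)) [0..<d i] = map (\<lambda>j. ev i j) [0..<d i]" if i: "i < s" for i
    proof (rule map_cong[OF refl])
      fix j assume "j \<in> set [0..<d i]"
      then have "j < d i" by simp
      then have "ev i j = (\<sigma> ^^ j) (ev i 0)" using ev[OF i] by blast
      then show "(\<sigma> ^^ j) (x ! i) = ev i j" using xi[OF i] by metis
    qed
    then have "\<phi> x = concat (map (\<lambda>i. map (\<lambda>j. ev i j) [0..<d i]) [0..<s])"
      unfolding assms(24) conjugates_map_def by (intro arg_cong[where f = concat] map_cong[OF refl]) simp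
    moreover have "f \<in> riemann_roch_space L K' (carrier L) (conorm L K' G)"
      using riemann_roch_space_conorm[OF assms(8)] f by blast
    ultimately have "\<phi> x \<in> extended_code L K' s d Pt G" unfolding extended_code_def ev_def by blast
    then show ?thesis using x cx by blast
  qed

  have C_vecs: "C \<subseteq> vecs K n" using code bij_betw_apply[OF \<pi>s_bij] by blast
  have decode: "alg (\<phi> (\<pi>s_inv (vec_add L c e))) = \<phi> (\<pi>s_inv c) \<and> \<pi>s (\<phi>_inv (\<phi> (\<pi>s_inv c))) = c"
    if c: "c \<in> C" and e: "e \<in> vecs K n" "int (hamming_weight L e) \<le> T" for c e
  proof -
    obtain x where x: "x \<in> Lambda s E" "c = \<pi>s x" "\<phi> x \<in> extended_code L K' s d Pt G" using code[OF c] by blast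
    obtain y where y: "y \<in> Lambda s E" "e = \<pi>s y" using \<pi>s_bij e(1) unfolding bij_betw_def by blast
    have "vec_add L c e = \<pi>s (vec_add L x y)" using Lambda_add(2)[OF x(1) y(1)] x(2) y(2) by simp
    then have "\<phi> (\<pi>s_inv (vec_add L c e)) = vec_add L (\<phi> x) (\<phi> y)"
      using inv_\<pi>s[OF Lambda_add(1)[OF x(1) y(1)]] Lambda_add(3)[OF x(1) y(1)] by simp
    moreover have "int (hamming_weight L (\<phi> y)) \<le> int t" using weight[OF y(1)] e(2) y(2) by simp
    ultimately have "alg (\<phi> (\<pi>s_inv (vec_add L c e))) = \<phi> x"
      using assms(27) x(3) \<phi>_vecs[OF y(1)] unfolding corrects_errors_def by simp
    then show ?thesis using inv_\<pi>s[OF x(1)] inv_\<phi>[OF x(1)] x(2) by simp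
  qed
  then have "corrects_errors L K n C T (\<lambda>y. \<pi>s (\<phi>_inv (alg (\<phi> (\<pi>s_inv y)))))"
    unfolding corrects_errors_def by simp
  then show ?thesis using C_vecs decode by blast
qed

end
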